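(* Let $\mathbb{K}$ be an algebraically closed field of characteristic zero. Let $$X=\mathbb{V}\left(T_0^{l_0}+T_1^{l_1}+T_{21}T_{22}^{l_{22}}\cdots T_{2n_2}^{l_{2n_2}}\right)\subset\mathbb{K}^{n_0+n_1+n_2},$$ where $n_0\ge 0$, $n_1\ge 1$, $n_2\ge 2$, all exponents $l_{ij}$ with $(i,j)\neq(2,1)$ are integers $\ge 2$, and $\{l_{01},\ldots,l_{0n_0}\}\neq\{2,2a_1,\ldots,2a_{n_0-1}\}$ for all positive integers $a_1,\ldots,a_{n_0-1}$ (that is, it is not the case that $l_{01},\ldots,l_{0n_0}$ are all even and at least one of them equals $2$). Then 1) $\mathrm{ML}(X)=\mathbb{K}[T_{22},\ldots,T_{2n_2}]$; 2) generic $\mathrm{SAut}(X)$-orbits on $X$ can be separated by functions from $\mathrm{ML}(X)$.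
   Context: Here $T_i^{l_i}=T_{i1}^{l_{i1}}\cdots T_{in_i}^{l_{in_i}}$ (equal to $1$ if $n_i=0$), the $T_{ij}$ are the coordinates on $\mathbb{K}^{n_0+n_1+n_2}$, and $\mathbb{V}(g)$ is the zero locus of $g$. A derivation $\partial$ of a commutative $\mathbb{K}$-algebra $A$ is locally nilpotent (an LND) if for every $a\in A$ there is a positive integer $n$ with $\partial^n(a)=0$. The Makar-Limanov invariant $\mathrm{ML}(X)\subset\mathbb{K}[X]$ is the intersection of the kernels of all LNDs of $\mathbb{K}[X]$. $\mathrm{SAut}(X)$ is the subgroup of $\mathrm{Aut}(X)$ generated by all algebraic subgroups isomorphic to the additive group of $\mathbb{K}$ (equivalently, by all $\exp(s\partial)$ with $s\in\mathbb{K}$ and $\partial$ an LND of $\mathbb{K}[X]$). "Generic $\mathrm{SAut}(X)$-orbits can be separated by functions from $\mathrm{ML}(X)$" means: there is a nonempty Zariski open $\mathrm{SAut}(X)$-invariant subset $U\subset X$ such that for any two points $P,Q\in U$ in different $\mathrm{SAut}(X)$-orbits there is $f\in\mathrm{ML}(X)$ with $f(P)\neq f(Q)$. *)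

theory Defs
  imports
    "HOL-Computational_Algebra.Polynomial"
    "HOL-Algebra.Bij"
    "HOL-Algebra.Generated_Groups"
    "HOL-Algebra.Group_Action"
begin

(* A point of the affine space with coordinates indexed by I is an element of
   "I \<rightarrow>\<^sub>E UNIV".  Closed subvarieties X are subsets of it; since the base
   field is infinite, polynomials are identified with polynomial functions. *)

inductive_set poly_functions :: "'v set \<Rightarrow> (('v \<Rightarrow> 'a::field) \<Rightarrow> 'a) set"
  for V :: "'v set"
  where
    const: "(\<lambda>_. c) \<in> poly_functions V"
  | coord: "v \<in> V \<Longrightarrow> (\<lambda>p. p v) \<in> poly_functions V"
  | add: "f \<in> poly_functions V \<Longrightarrow> g \<in> poly_functions V \<Longrightarrow> (\<lambda>p. f p + g p) \<in> poly_functions V"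
  | mult: "f \<in> poly_functions V \<Longrightarrow> g \<in> poly_functions V \<Longrightarrow> (\<lambda>p. f p * g p) \<in> poly_functions V"

(* The subalgebra of K[X] generated by the coordinates in V, so that K[X] itself is
   coord_algebra I X.  Functions on X are extended by 0, which makes the
   algebra operations the pointwise ones. *)
definition coord_algebra :: "'v set \<Rightarrow> ('v \<Rightarrow> 'a::field) set \<Rightarrow> (('v \<Rightarrow> 'a) \<Rightarrow> 'a) set"
  where "coord_algebra V X = (\<lambda>f p. if p \<in> X then f p else 0) ` poly_functions V"

(* Here A is an algebra of functions under the pointwise operations. *)
definition derivation :: "('p \<Rightarrow> 'a::field) set \<Rightarrow> (('p \<Rightarrow> 'a) \<Rightarrow> ('p \<Rightarrow> 'a)) \<Rightarrow> bool"
  where "derivation A D \<longleftrightarrow>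
    D \<in> A \<rightarrow> A \<and>
    (\<forall>f\<in>A. \<forall>g\<in>A. D (\<lambda>p. f p + g p) = (\<lambda>p. D f p + D g p)) \<and>
    (\<forall>c. \<forall>f\<in>A. D (\<lambda>p. c * f p) = (\<lambda>p. c * D f p)) \<and>
    (\<forall>f\<in>A. \<forall>g\<in>A. D (\<lambda>p. f p * g p) = (\<lambda>p. D f p * g p + f p * D g p))"

definition locally_nilpotent_derivation ::
    "('p \<Rightarrow> 'a::field) set \<Rightarrow> (('p \<Rightarrow> 'a) \<Rightarrow> ('p \<Rightarrow> 'a)) \<Rightarrow> bool"
  where "locally_nilpotent_derivation A D \<longleftrightarrow>
    derivation A D \<and> (\<forall>f\<in>A. \<exists>n>0. (D ^^ n) f = (\<lambda>_. 0))"

definition makar_limanov :: "'v set \<Rightarrow> ('v \<Rightarrow> 'a::field) set \<Rightarrow> (('v \<Rightarrow> 'a) \<Rightarrow> 'a) set"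
  where "makar_limanov I X =
    {f \<in> coord_algebra I X.
      \<forall>D. locally_nilpotent_derivation (coord_algebra I X) D \<longrightarrow> D f = (\<lambda>_. 0)}"

definition zariski_open :: "'v set \<Rightarrow> ('v \<Rightarrow> 'a::field) set \<Rightarrow> ('v \<Rightarrow> 'a) set \<Rightarrow> bool"
  where "zariski_open I X U \<longleftrightarrow>
    (\<exists>S \<subseteq> coord_algebra I X. U = {p \<in> X. \<exists>f\<in>S. f p \<noteq> 0})"

definition regular_on ::
    "'v set \<Rightarrow> ('v \<Rightarrow> 'a::field) set \<Rightarrow> (('v \<Rightarrow> 'a) \<Rightarrow> ('v \<Rightarrow> 'a)) \<Rightarrow> bool"
  where "regular_on I X \<phi> \<longleftrightarrow> (\<forall>i\<in>I. \<exists>F \<in> poly_functions I. \<forall>p\<in>X. \<phi> p i = F p)"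

definition aut_group :: "'v set \<Rightarrow> ('v \<Rightarrow> 'a::field) set \<Rightarrow> (('v \<Rightarrow> 'a) \<Rightarrow> ('v \<Rightarrow> 'a)) monoid"
  where "aut_group I X = (BijGroup X)
    \<lparr>carrier := {\<phi> \<in> Bij X. regular_on I X \<phi> \<and> regular_on I X (inv_into X \<phi>)}\<rparr>"

definition additive_group :: "'a::field monoid"
  where "additive_group = \<lparr>carrier = UNIV, mult = (+), one = 0\<rparr>"

(* H is an algebraic subgroup isomorphic to the additive group: the
   action map (s, p) \<mapsto> \<alpha> s p is a morphism K \<times> X \<rightarrow> X.  Points of
   K \<times> X are encoded with the extra coordinate None holding s. *)
definition additive_subgroup_of_aut ::
    "'v set \<Rightarrow> ('v \<Rightarrow> 'a::field) set \<Rightarrow> (('v \<Rightarrow> 'a) \<Rightarrow> ('v \<Rightarrow> 'a)) set \<Rightarrow> bool"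
  where "additive_subgroup_of_aut I X H \<longleftrightarrow>
    subgroup H (aut_group I X) \<and>
    (\<exists>\<alpha> \<in> iso additive_group ((aut_group I X)\<lparr>carrier := H\<rparr>).
      \<forall>i\<in>I. \<exists>F \<in> poly_functions (insert None (Some ` I)).
        \<forall>s. \<forall>p\<in>X. \<alpha> s p i = F (case_option s p))"

definition saut_group :: "'v set \<Rightarrow> ('v \<Rightarrow> 'a::field) set \<Rightarrow> (('v \<Rightarrow> 'a) \<Rightarrow> ('v \<Rightarrow> 'a)) monoid"
  where "saut_group I X = (aut_group I X)
    \<lparr>carrier := generate (aut_group I X) (\<Union> {H. additive_subgroup_of_aut I X H})\<rparr>"

definition saut_orbit :: "'v set \<Rightarrow> ('v \<Rightarrow> 'a::field) set \<Rightarrow> ('v \<Rightarrow> 'a) \<Rightarrow> ('v \<Rightarrow> 'a) set"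
  where "saut_orbit I X p = orbit (saut_group I X) (\<lambda>\<phi>. \<phi>) p"

definition generic_saut_orbits_separated_by_ML :: "'v set \<Rightarrow> ('v \<Rightarrow> 'a::field) set \<Rightarrow> bool"
  where "generic_saut_orbits_separated_by_ML I X \<longleftrightarrow>
    (\<exists>U. U \<noteq> {} \<and> zariski_open I X U \<and>
      (\<forall>\<phi> \<in> carrier (saut_group I X). \<phi> ` U = U) \<and>
      (\<forall>P\<in>U. \<forall>Q\<in>U. saut_orbit I X P \<noteq> saut_orbit I X Q \<longrightarrow>
        (\<exists>f \<in> makar_limanov I X. f P \<noteq> f Q)))"

(* The coordinate T_ij has index (i, j), with i \<in> {0, 1, 2} and 1 \<le> j \<le> n i. *)
definition var_index :: "(nat \<Rightarrow> nat) \<Rightarrow> (nat \<times> nat) set"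
  where "var_index n = (SIGMA i:{0..2}. {1..n i})"

(* The exponent of T_21 is 1; the value l 2 1 is not used. *)
definition trinomial ::
    "(nat \<Rightarrow> nat) \<Rightarrow> (nat \<Rightarrow> nat \<Rightarrow> nat) \<Rightarrow> (nat \<times> nat \<Rightarrow> 'a::field) \<Rightarrow> 'a"
  where "trinomial n l p =
    (\<Prod>j\<in>{1..n 0}. p (0, j) ^ l 0 j) + (\<Prod>j\<in>{1..n 1}. p (1, j) ^ l 1 j)
      + p (2, 1) * (\<Prod>j\<in>{2..n 2}. p (2, j) ^ l 2 j)"

definition trinomial_variety ::
    "(nat \<Rightarrow> nat) \<Rightarrow> (nat \<Rightarrow> nat \<Rightarrow> nat) \<Rightarrow> (nat \<times> nat \<Rightarrow> 'a::field) set"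
  where "trinomial_variety n l = {p \<in> var_index n \<rightarrow>\<^sub>E UNIV. trinomial n l p = 0}"

end

theory Submission
  imports Defs
begin

text \<open>
  Write x, y for the coordinates of the first two groups, w for the coordinates T_2j with j at least 2,
  z = T_21 and P for the monomial in w, so that X is given by a(x) + b(y) + z P(w) = 0.

  Where P does not vanish, the fibres of w are affine spaces with coordinates x, y, and the shears
  v := v + s P (with z corrected accordingly) act transitively on them. Hence every element of the
  Makar-Limanov invariant is a function of w, and everything else follows once each locally
  nilpotent derivation D is known to kill every w_j.

  Grade K[X] by deg w_j = -1, deg z = l_2j. If the leading component of D has degree at most 0, then
  all derivatives of w_j have negative degree, so they vanish where w_j does; along the flow of D
  the function w_j is then a polynomial without a new zero, that is, a constant. If the degree is
  positive, pass to leading components for further gradings until the derivation is normalized by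
  the whole torus of X. For the same reason it kills z. Let C be a general flow line, x' and y' the d-th roots
  of the monomials a and b, with d the gcd of their exponents. If two points of C have the same
  x'/y', a torus element maps one to the other, and it preserves C, on which it acts by an affine map.
  All these maps fix the barycentre of the zeros of the coordinates on C, so x' and y' become polynomials of
  the form c_0 + c_1 s^m in a suitable parameter s. Now P is up to a constant the product of the d pairwise
  independent forms x' - \<epsilon> y' with \<epsilon>^d = -1, and has no simple zero. This forces d to be at most 2,
  and then x' has a simple zero, which contradicts the condition on the exponents.
\<close>

subsection \<open>Polynomial functions\<close>

text \<open>The argument on a general flow line C presupposes two things. One is that x' and y' have
  no common zero on C. At a common zero P vanishes as well, and a one-parameter subgroup of the
  torus fixes that point; its dilations turn all coordinates on C into monomials, and then x'/y' is
  constant on C. The other is that x'/y' is not constant on C. If it is constant on all general flow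
  lines, the derivation is zero: P and b are then proportional on lines with z nonzero, so a line
  through a general point of w_j = 0 stays in w_j = 0 and w_j is killed; now a + b is a nonzero
  constant on general lines, so a, b and all coordinates are constant there. As leading components
  are nonzero, positive degree is impossible.

  The exponent condition is felt at d = 2, where one of x' + i y' and x' - i y' may be constant and
  the other a power of s. This happens for u^2 + v^2 + z w^2 = 0: with p = u + i v and q = u - i v,
  the derivation p -> 0, z -> 0, w -> p, q -> -2 z w moves w.\<close>

lemma poly_functions_sum:
  "finite S \<Longrightarrow> (\<And>i. i \<in> S \<Longrightarrow> f i \<in> poly_functions V) \<Longrightarrow> (\<lambda>p. \<Sum>i\<in>S. f i p) \<in> poly_functions V"
  by (induction S rule: finite_induct) (auto intro: poly_functions.intros)

lemma poly_functions_prod: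
  "finite S \<Longrightarrow> (\<And>i. i \<in> S \<Longrightarrow> f i \<in> poly_functions V) \<Longrightarrow> (\<lambda>p. \<Prod>i\<in>S. f i p) \<in> poly_functions V"
  by (induction S rule: finite_induct) (auto intro: poly_functions.intros)

lemma poly_functions_power: "f \<in> poly_functions V \<Longrightarrow> (\<lambda>p. f p ^ k) \<in> poly_functions V"
  by (induction k) (auto intro: poly_functions.intros)

lemma poly_functions_diff:
  assumes "f \<in> poly_functions V" "g \<in> poly_functions V"
  shows "(\<lambda>p. f p - g p) \<in> poly_functions V"
proof -
  have "(\<lambda>p. f p + (- 1) * g p) \<in> poly_functions V"
    by (intro poly_functions.intros assms)
  then show ?thesis by simp
qed

lemma poly_functions_mono:
  assumes "f \<in> poly_functions V" "V \<subseteq> W"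
  shows "f \<in> poly_functions W"
  using assms by (induction rule: poly_functions.induct) (auto intro: poly_functions.intros)

lemma poly_functions_subst:
  assumes "F \<in> poly_functions V" "\<And>v. v \<in> V \<Longrightarrow> (\<lambda>p. G p v) \<in> poly_functions W"
  shows "(\<lambda>p. F (G p)) \<in> poly_functions W"
  using assms by (induction rule: poly_functions.induct) (auto intro: poly_functions.intros)

lemma poly_functions_cong:
  assumes "F \<in> poly_functions V" "\<And>v. v \<in> V \<Longrightarrow> p v = q v"
  shows "F p = F q"
  using assms by (induction rule: poly_functions.induct) auto

lemma poly_functions_curve:
  fixes F :: "('v \<Rightarrow> 'a::field) \<Rightarrow> 'a"
  assumes "F \<in> poly_functions V" "\<And>v. v \<in> V \<Longrightarrow> \<exists>Q. \<forall>t. c t v = poly Q t"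
  shows "\<exists>Q. \<forall>t. F (c t) = poly Q t"
  using assms
proof (induction rule: poly_functions.induct)
  case (const k)
  show ?case by (rule exI[of _ "[:k:]"]) simp
next
  case (add f g)
  then obtain q r where "\<forall>t. f (c t) = poly q t" "\<forall>t. g (c t) = poly r t" by blast
  then show ?case by (intro exI[of _ "q + r"]) simp
next
  case (mult f g)
  then obtain q r where "\<forall>t. f (c t) = poly q t" "\<forall>t. g (c t) = poly r t" by blast
  then show ?case by (intro exI[of _ "q * r"]) simp
qed auto

lemma poly_eqI_infinite:
  fixes q r :: "'a::{field_char_0} poly"
  assumes "finite B" "\<And>t. t \<notin> B \<Longrightarrow> poly q t = poly r t"
  shows "q = r"
proof (rule ccontr)
  assume "q \<noteq> r"
  then have "finite {t. poly (q - r) t = 0}" by (intro poly_roots_finite) auto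
  moreover have "UNIV \<subseteq> B \<union> {t. poly (q - r) t = 0}" using assms(2) by auto
  ultimately have "finite (UNIV :: 'a set)" using assms(1) finite_subset by blast
  then show False by (simp add: infinite_UNIV_char_0)
qed

lemma ex_not_in_finite:
  fixes B :: "'a::field_char_0 set"
  assumes "finite B" shows "\<exists>t. t \<notin> B"
  using assms ex_new_if_finite infinite_UNIV_char_0 by blast

text \<open>In characteristic zero a polynomial is determined by its derivative and one value.
  Identities between flows are proved this way: differentiating replaces f by D f, and nilpotency
  makes the induction end.\<close>

lemma poly_eqI_pderiv:
  fixes q r :: "'a::field_char_0 poly"
  assumes "pderiv q = pderiv r" "poly q 0 = poly r 0"
  shows "q = r"
proof -
  have "pderiv (q - r) = 0" using assms by (simp add: pderiv_diff)
  then obtain c where c: "q - r = [:c:]"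
    by (metis degree_eq_zeroE pderiv_eq_0_iff)
  then have "poly (q - r) 0 = c" by simp
  then have "c = 0" using assms by simp
  then show ?thesis using c by simp
qed

subsection \<open>Affine sets and their coordinate algebras\<close>

text \<open>Extension by zero gives every element of K[X] one representative, so equality in K[X] is
  equality of functions, and a polynomial that vanishes on X becomes literally zero.\<close>

definition res :: "'p set \<Rightarrow> ('p \<Rightarrow> 'a::zero) \<Rightarrow> 'p \<Rightarrow> 'a"
  where "res X f = (\<lambda>p. if p \<in> X then f p else 0)"

lemma coord_algebra_eq: "coord_algebra V X = res X ` poly_functions V"
  by (simp add: coord_algebra_def res_def)

lemma res_in_coord_algebra: "f \<in> poly_functions V \<Longrightarrow> res X f \<in> coord_algebra V X"
  by (auto simp: coord_algebra_eq)

lemma res_add: "(\<lambda>p. res X f p + res X g p) = res X (\<lambda>p. f p + (g p :: 'a::field))"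
  by (auto simp: res_def)

lemma res_mult: "(\<lambda>p. res X f p * res X g p) = res X (\<lambda>p. f p * (g p :: 'a::field))"
  by (auto simp: res_def)

lemma coord_algebra_zero_outside: "f \<in> coord_algebra V X \<Longrightarrow> p \<notin> X \<Longrightarrow> f p = 0"
  by (auto simp: coord_algebra_def)

lemma coord_algebra_add:
  "f \<in> coord_algebra V X \<Longrightarrow> g \<in> coord_algebra V X \<Longrightarrow> (\<lambda>p. f p + g p) \<in> coord_algebra V X"
  by (auto simp: coord_algebra_eq res_add intro!: imageI poly_functions.intros)

lemma coord_algebra_mult:
  "f \<in> coord_algebra V X \<Longrightarrow> g \<in> coord_algebra V X \<Longrightarrow> (\<lambda>p. f p * g p) \<in> coord_algebra V X"
  by (auto simp: coord_algebra_eq res_mult intro!: imageI poly_functions.intros)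

lemma coord_algebra_scale:
  assumes "f \<in> coord_algebra V X" shows "(\<lambda>p. c * f p) \<in> coord_algebra V X"
proof -
  obtain F where F: "F \<in> poly_functions V" "f = res X F" using assms by (auto simp: coord_algebra_eq)
  have "(\<lambda>p. c * f p) = res X (\<lambda>p. c * F p)" by (auto simp: F res_def)
  moreover have "(\<lambda>p. c * F p) \<in> poly_functions V" by (intro poly_functions.intros F)
  ultimately show ?thesis by (auto simp: coord_algebra_eq)
qed

lemma coord_algebra_zero: "(\<lambda>_. 0) \<in> coord_algebra V X"
  using res_in_coord_algebra[OF poly_functions.const[of 0 V], of X] by (simp add: res_def)

lemma coord_algebra_sum:
  "(\<And>i. i \<in> S \<Longrightarrow> f i \<in> coord_algebra V X) \<Longrightarrow> (\<lambda>p. \<Sum>i\<in>S. f i p) \<in> coord_algebra V X"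
  by (induction S rule: infinite_finite_induct) (auto intro: coord_algebra_add coord_algebra_zero)

lemma coord_algebra_diff:
  assumes "f \<in> coord_algebra V X" "g \<in> coord_algebra V X"
  shows "(\<lambda>p. f p - g p) \<in> coord_algebra V X"
  using coord_algebra_add[OF assms(1) coord_algebra_scale[OF assms(2), of "-1"]] by simp

lemma coord_algebra_induct [consumes 1, case_names const coord add mult]:
  assumes "f \<in> coord_algebra V X"
    and "\<And>c. Q (res X (\<lambda>_. c))"
    and "\<And>v. v \<in> V \<Longrightarrow> Q (res X (\<lambda>p. p v))"
    and "\<And>f g. f \<in> coord_algebra V X \<Longrightarrow> g \<in> coord_algebra V X \<Longrightarrow> Q f \<Longrightarrow> Q g \<Longrightarrow> Q (\<lambda>p. f p + g p)"
    and "\<And>f g. f \<in> coord_algebra V X \<Longrightarrow> g \<in> coord_algebra V X \<Longrightarrow> Q f \<Longrightarrow> Q g \<Longrightarrow> Q (\<lambda>p. f p * g p)"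
  shows "Q f"
proof -
  obtain F where F: "F \<in> poly_functions V" "f = res X F" using assms(1) by (auto simp: coord_algebra_eq)
  have "Q (res X F)" using F(1)
  proof (induction rule: poly_functions.induct)
    case (add f g)
    then show ?case using assms(4)[of "res X f" "res X g"] by (simp add: res_in_coord_algebra res_add)
  next
    case (mult f g)
    then show ?case using assms(5)[of "res X f" "res X g"] by (simp add: res_in_coord_algebra res_mult)
  qed (use assms in auto)
  then show ?thesis by (simp add: F)
qed

text \<open>Along the curve f becomes a polynomial in t with infinitely many zeros. The density
  statements below are reduced to this: a curve through the given point whose general point lies
  where f is known to vanish.\<close>

lemma coord_algebra_curve_limit:
  fixes c :: "'a::field_char_0 \<Rightarrow> 'v \<Rightarrow> 'a"
  assumes "f \<in> coord_algebra V X" "finite B"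
    and "\<And>t. c t \<in> X" "\<And>v. v \<in> V \<Longrightarrow> \<exists>Q. \<forall>t. c t v = poly Q t"
    and "\<And>t. t \<notin> B \<Longrightarrow> f (c t) = 0"
  shows "f (c 0) = 0"
proof -
  obtain F where F: "F \<in> poly_functions V" "f = res X F" using assms(1) by (auto simp: coord_algebra_eq)
  obtain Q where Q: "\<And>t. F (c t) = poly Q t" using poly_functions_curve[OF F(1), of c] assms(4) by blast
  have "Q = 0"
    by (rule poly_eqI_infinite[OF assms(2)]) (use assms(3,5) Q F in \<open>auto simp: res_def\<close>)
  then show ?thesis using Q assms(3) F by (auto simp: res_def)
qed

locale coordinate_ring =
  fixes I :: "'v set" and X :: "('v \<Rightarrow> 'a::field_char_0) set"
begin

abbreviation "A \<equiv> coord_algebra I X"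
abbreviation "crd v \<equiv> res X (\<lambda>p. p v)"

lemma const_in: "res X (\<lambda>_. c) \<in> A"
  by (intro res_in_coord_algebra poly_functions.intros)

lemma crd_in: "v \<in> I \<Longrightarrow> crd v \<in> A"
  by (intro res_in_coord_algebra poly_functions.intros)

end

section \<open>Derivations of a coordinate ring\<close>

locale derivation_on = coordinate_ring I X
  for I :: "'v set" and X :: "('v \<Rightarrow> 'a::field_char_0) set" +
  fixes D :: "(('v \<Rightarrow> 'a) \<Rightarrow> 'a) \<Rightarrow> (('v \<Rightarrow> 'a) \<Rightarrow> 'a)"
  assumes der: "derivation (coord_algebra I X) D"
begin

lemma D_closed: "f \<in> A \<Longrightarrow> D f \<in> A"
  and D_add: "f \<in> A \<Longrightarrow> g \<in> A \<Longrightarrow> D (\<lambda>p. f p + g p) = (\<lambda>p. D f p + D g p)"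
  and D_scale: "f \<in> A \<Longrightarrow> D (\<lambda>p. c * f p) = (\<lambda>p. c * D f p)"
  and D_mult: "f \<in> A \<Longrightarrow> g \<in> A \<Longrightarrow> D (\<lambda>p. f p * g p) = (\<lambda>p. D f p * g p + f p * D g p)"
  using der by (auto simp: derivation_def)

lemma D_zero: "D (\<lambda>_. 0) = (\<lambda>_. 0)"
  using D_scale[of "\<lambda>_. 0" 0] by (simp add: coord_algebra_zero)

lemma D_const: "D (res X (\<lambda>_. c)) = (\<lambda>_. 0)"
proof -
  let ?u = "res X (\<lambda>_. 1 :: 'a)"
  have D0: "D ?u p = 0" for p
  proof (cases "p \<in> X")
    case True
    have "(\<lambda>p. ?u p * ?u p) = ?u" by (auto simp: res_def)
    then have "D ?u = (\<lambda>p. D ?u p * ?u p + ?u p * D ?u p)" using D_mult[of ?u ?u] const_in by simp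
    then have "D ?u p = D ?u p * ?u p + ?u p * D ?u p" by (rule fun_cong)
    then show ?thesis using True by (simp add: res_def)
  next
    case False
    then show ?thesis using coord_algebra_zero_outside[OF D_closed[OF const_in]] by blast
  qed
  have "res X (\<lambda>_. c) = (\<lambda>p. c * ?u p)" by (auto simp: res_def)
  then have "D (res X (\<lambda>_. c)) = (\<lambda>p. c * D ?u p)" using D_scale[of ?u c] const_in by simp
  then show ?thesis using D0 by simp
qed

lemma D_sum:
  "(\<And>i. i \<in> S \<Longrightarrow> f i \<in> A) \<Longrightarrow> D (\<lambda>p. \<Sum>i\<in>S. f i p) = (\<lambda>p. \<Sum>i\<in>S. D (f i) p)"
  by (induction S rule: infinite_finite_induct) (auto simp: D_zero D_add coord_algebra_sum)

lemma Dn_closed: "f \<in> A \<Longrightarrow> (D ^^ k) f \<in> A"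
  by (induction k) (auto intro: D_closed)

lemma Dn_zero: "(D ^^ k) (\<lambda>_. 0) = (\<lambda>_. 0)"
  by (induction k) (auto simp: D_zero)

lemma Dn_zero_mono: "(D ^^ n) f = (\<lambda>_. 0) \<Longrightarrow> n \<le> k \<Longrightarrow> (D ^^ k) f = (\<lambda>_. 0)"
  by (metis Dn_zero funpow_add le_add_diff_inverse2 o_apply)

lemma Dn_add: "f \<in> A \<Longrightarrow> g \<in> A \<Longrightarrow> (D ^^ k) (\<lambda>p. f p + g p) = (\<lambda>p. (D ^^ k) f p + (D ^^ k) g p)"
  by (induction k) (auto simp: D_add Dn_closed)

lemma Dn_scale: "f \<in> A \<Longrightarrow> (D ^^ k) (\<lambda>p. c * f p) = (\<lambda>p. c * (D ^^ k) f p)"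
  by (induction k) (auto simp: D_scale Dn_closed)

lemma D_eq_zeroI:
  assumes "\<And>v. v \<in> I \<Longrightarrow> D (crd v) = (\<lambda>_. 0)" "f \<in> A"
  shows "D f = (\<lambda>_. 0)"
  using assms(2) by (induction rule: coord_algebra_induct) (auto simp: D_const D_add D_mult assms(1))

end

subsection \<open>The flow of a locally nilpotent derivation\<close>

locale lnd_on = derivation_on I X D
  for I :: "'v set" and X :: "('v \<Rightarrow> 'a::field_char_0) set" and D +
  assumes nilp: "f \<in> coord_algebra I X \<Longrightarrow> \<exists>n. (D ^^ n) f = (\<lambda>_. 0)"
begin

(* exp (s D) f at p, as a polynomial in s *)
definition flow :: "('v \<Rightarrow> 'a) \<Rightarrow> (('v \<Rightarrow> 'a) \<Rightarrow> 'a) \<Rightarrow> 'a poly"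
  where "flow p f = Abs_poly (\<lambda>k. (D ^^ k) f p / fact k)"

lemma coeff_flow:
  assumes "f \<in> A" shows "coeff (flow p f) k = (D ^^ k) f p / fact k"
proof -
  obtain n where n: "(D ^^ n) f = (\<lambda>_. 0)" using nilp[OF assms] by blast
  have "\<And>i. i > n \<Longrightarrow> (D ^^ i) f p / fact i = 0"
    using Dn_zero_mono[OF n] by simp
  then show ?thesis unfolding flow_def by (subst coeff_Abs_poly) auto
qed

lemma poly_flow_0: "f \<in> A \<Longrightarrow> poly (flow p f) 0 = f p"
  by (simp add: poly_0_coeff_0 coeff_flow)

lemma pderiv_flow:
  assumes "f \<in> A" shows "pderiv (flow p f) = flow p (D f)"
proof (rule poly_eqI)
  fix k
  have "(D ^^ Suc k) f p = (D ^^ k) (D f) p" by (simp add: funpow_swap1)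
  then show "coeff (pderiv (flow p f)) k = coeff (flow p (D f)) k"
    using assms by (simp add: coeff_pderiv coeff_flow D_closed del: funpow.simps of_nat_Suc)
qed

lemma flow_zero [simp]: "flow p (\<lambda>_. 0) = 0"
  by (rule poly_eqI) (simp add: coeff_flow coord_algebra_zero Dn_zero)

lemma flow_add:
  "f \<in> A \<Longrightarrow> g \<in> A \<Longrightarrow> flow p (\<lambda>q. f q + g q) = flow p f + flow p g"
  by (rule poly_eqI) (simp add: coeff_flow coord_algebra_add Dn_add add_divide_distrib)

lemma flow_const: "p \<in> X \<Longrightarrow> flow p (res X (\<lambda>_. c)) = [:c:]"
  by (rule poly_eqI_pderiv) (simp_all add: pderiv_flow const_in D_const poly_flow_0 pderiv_pCons, simp add: res_def)

text \<open>The map exp(s D) is multiplicative. By the Leibniz rule the derivatives of both sides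
  are sums of the same statement for D f, g and for f, D g, whose nilpotency orders have a smaller
  sum; this sum is the induction measure.\<close>

lemma flow_mult:
  assumes "f \<in> A" "g \<in> A"
  shows "flow p (\<lambda>q. f q * g q) = flow p f * flow p g"
proof -
  obtain m n where "(D ^^ m) f = (\<lambda>_. 0)" "(D ^^ n) g = (\<lambda>_. 0)" using nilp assms by blast
  then show ?thesis using assms
  proof (induction "m + n" arbitrary: f g m n rule: less_induct)
    case less
    show ?case
    proof (cases "m = 0 \<or> n = 0")
      case True
      then have "f = (\<lambda>_. 0) \<or> g = (\<lambda>_. 0)" using less.prems by auto
      then show ?thesis by auto
    next
      case False
      then obtain m' n' where mn: "m = Suc m'" "n = Suc n'" by (metis not0_implies_Suc)
      have 1: "flow p (\<lambda>q. D f q * g q) = flow p (D f) * flow p g"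
        using less.prems mn by (intro less.hyps[of m' n]) (auto simp: funpow_swap1 D_closed)
      have 2: "flow p (\<lambda>q. f q * D g q) = flow p f * flow p (D g)"
        using less.prems mn by (intro less.hyps[of m n']) (auto simp: funpow_swap1 D_closed)
      have "pderiv (flow p (\<lambda>q. f q * g q)) = flow p (\<lambda>q. D f q * g q + f q * D g q)"
        using less.prems by (simp add: pderiv_flow coord_algebra_mult D_mult)
      also have "\<dots> = flow p (D f) * flow p g + flow p f * flow p (D g)"
        using less.prems 1 2 by (simp add: flow_add coord_algebra_mult D_closed)
      also have "\<dots> = pderiv (flow p f * flow p g)"
        using less.prems by (simp add: pderiv_mult pderiv_flow mult.commute add.commute)
      finally have d: "pderiv (flow p (\<lambda>q. f q * g q)) = pderiv (flow p f * flow p g)" .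
      have "poly (flow p (\<lambda>q. f q * g q)) 0 = poly (flow p f * flow p g) 0"
        using less.prems(3,4) by (simp add: poly_flow_0 coord_algebra_mult)
      then show ?thesis by (rule poly_eqI_pderiv[OF d])
    qed
  qed
qed

lemma degree_flow_D: "f \<in> A \<Longrightarrow> degree (flow p f) = 0 \<Longrightarrow> D f p = 0"
  by (metis D_closed pderiv_eq_0_iff pderiv_flow poly_0 poly_flow_0)

end

locale lnd_on_affine = lnd_on I X D
  for I :: "'v set" and X :: "('v \<Rightarrow> 'a::field_char_0) set" and D +
  assumes closed: "\<exists>E\<subseteq>poly_functions I. X = {p \<in> I \<rightarrow>\<^sub>E UNIV. \<forall>F\<in>E. F p = 0}"
begin

text \<open>The orbit map s -> exp(s D) p of the additive group action generated by D, in
  coordinates.\<close>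

definition curve :: "('v \<Rightarrow> 'a) \<Rightarrow> 'a \<Rightarrow> 'v \<Rightarrow> 'a"
  where "curve p s = (\<lambda>v\<in>I. poly (flow p (crd v)) s)"

lemma poly_flow_poly_function:
  assumes "F \<in> poly_functions I" "p \<in> X"
  shows "poly (flow p (res X F)) s = F (curve p s)"
  using assms(1)
proof (induction rule: poly_functions.induct)
  case (const c)
  then show ?case using assms(2) by (simp add: flow_const)
next
  case (coord v)
  then show ?case by (simp add: curve_def)
next
  case (add f g)
  then show ?case by (simp add: flow_add res_in_coord_algebra flip: res_add)
next
  case (mult f g)
  then show ?case by (simp add: flow_mult res_in_coord_algebra flip: res_mult)
qed

text \<open>A defining polynomial of X is zero in K[X], so its flow is zero; this flow is also the
  defining polynomial evaluated along the curve.\<close>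

lemma curve_in: "p \<in> X \<Longrightarrow> curve p s \<in> X"
proof -
  assume p: "p \<in> X"
  obtain E where E: "E \<subseteq> poly_functions I" "X = {p \<in> I \<rightarrow>\<^sub>E UNIV. \<forall>F\<in>E. F p = 0}"
    using closed by blast
  have "F (curve p s) = 0" if "F \<in> E" for F
  proof -
    have "res X F = (\<lambda>_. 0)" using that by (auto simp: res_def E(2))
    moreover have "poly (flow p (res X F)) s = F (curve p s)"
      using that E p by (intro poly_flow_poly_function) auto
    ultimately show ?thesis by simp
  qed
  then show ?thesis by (subst E(2)) (auto simp: curve_def)
qed

lemma poly_flow: 
  assumes "f \<in> A" "p \<in> X" shows "poly (flow p f) s = f (curve p s)"
proof -
  obtain F where F: "F \<in> poly_functions I" "f = res X F" using assms(1) by (auto simp: coord_algebra_eq)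
  show ?thesis using poly_flow_poly_function[OF F(1) assms(2)] curve_in[OF assms(2)]
    by (simp add: F res_def)
qed

text \<open>The group law: the flow starting at exp(s D) p is the flow from p with time shifted by
  s. The induction runs over the nilpotency order of f, since the derivatives of both sides are the
  same statement for D f.\<close>

lemma flow_curve:
  assumes "f \<in> A" "p \<in> X" shows "flow (curve p s) f = pcompose (flow p f) [:s, 1:]"
proof -
  obtain n where "(D ^^ n) f = (\<lambda>_. 0)" using nilp assms by blast
  then show ?thesis using assms(1)
  proof (induction n arbitrary: f)
    case 0
    then show ?case by simp
  next
    case (Suc n)
    have "flow (curve p s) (D f) = pcompose (flow p (D f)) [:s, 1:]"
      using Suc.prems by (intro Suc.IH) (auto simp: funpow_swap1 D_closed)
    then have "pderiv (flow (curve p s) f) = pderiv (pcompose (flow p f) [:s, 1:])"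
      using Suc.prems(2) by (simp add: pderiv_flow pderiv_pcompose pderiv_pCons)
    moreover have "poly (flow (curve p s) f) 0 = poly (pcompose (flow p f) [:s, 1:]) 0"
      using Suc.prems(2) assms(2) by (simp add: poly_flow_0 poly_pcompose poly_flow)
    ultimately show ?case by (rule poly_eqI_pderiv)
  qed
qed

text \<open>A root r of the flow of f at p gives a point of X where f vanishes with all its derivatives.\<close>
lemma flow_rootless:
  assumes "f \<in> A" "p \<in> X" "f p \<noteq> 0"
    and "\<And>q m. q \<in> X \<Longrightarrow> f q = 0 \<Longrightarrow> (D ^^ m) f q = 0"
  shows "poly (flow p f) r \<noteq> 0"
proof
  assume "poly (flow p f) r = 0"
  then have "f (curve p r) = 0" using assms by (simp add: poly_flow)
  then have "flow (curve p r) f = 0"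
    using assms curve_in by (intro poly_eqI) (simp add: coeff_flow)
  then have "pcompose (flow p f) [:r, 1:] = 0" using flow_curve[OF assms(1,2)] by simp
  then have "flow p f = 0" by (rule pcompose_eq_0) simp
  then show False using assms poly_flow_0[of f p] by simp
qed

end

subsection \<open>Laurent expansions\<close>

text \<open>The exponent set S is the same for all p, so G is a finitely supported family of
  functions. The value at t = 0, where negative exponents give a default value, is left
  free.\<close>

definition laurent :: "('a::field_char_0 \<Rightarrow> 'p \<Rightarrow> 'a) \<Rightarrow> (int \<Rightarrow> 'p \<Rightarrow> 'a) \<Rightarrow> bool"
  where "laurent g G \<longleftrightarrow> (\<exists>S. finite S \<and> (\<forall>k. k \<notin> S \<longrightarrow> G k = (\<lambda>_. 0)) \<and>
    (\<forall>t p. t \<noteq> 0 \<longrightarrow> g t p = (\<Sum>k\<in>S. t powi k * G k p)))"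

lemma laurentI:
  assumes "finite S" "\<And>k. k \<notin> S \<Longrightarrow> G k = (\<lambda>_. 0)"
    "\<And>t p. t \<noteq> 0 \<Longrightarrow> g t p = (\<Sum>k\<in>S. t powi k * G k p)"
  shows "laurent g G"
  using assms by (auto simp: laurent_def)

lemma laurentE:
  assumes "laurent g G"
  obtains S where "finite S" "\<And>k. k \<notin> S \<Longrightarrow> G k = (\<lambda>_. 0)"
    "\<And>T t p. finite T \<Longrightarrow> S \<subseteq> T \<Longrightarrow> t \<noteq> 0 \<Longrightarrow> g t p = (\<Sum>k\<in>T. t powi k * G k p)"
proof -
  obtain S where S: "finite S" "\<And>k. k \<notin> S \<Longrightarrow> G k = (\<lambda>_. 0)"
    "\<And>t p. t \<noteq> 0 \<Longrightarrow> g t p = (\<Sum>k\<in>S. t powi k * G k p)" using assms by (auto simp: laurent_def)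
  have "g t p = (\<Sum>k\<in>T. t powi k * G k p)" if "finite T" "S \<subseteq> T" "t \<noteq> 0" for T t p
    unfolding S(3)[OF that(3)] using that S(2) by (intro sum.mono_neutral_left) auto
  then show ?thesis using S that by blast
qed

lemma laurent_polynomial_zero:
  fixes c :: "int \<Rightarrow> 'a::field_char_0"
  assumes "finite S" "\<And>t. t \<noteq> 0 \<Longrightarrow> (\<Sum>k\<in>S. t powi k * c k) = 0" "k \<in> S"
  shows "c k = 0"
proof -
  \<comment> \<open>Multiplication by t^N clears the negative exponents and turns the sum into a
    polynomial.\<close>
  obtain N where N: "\<And>k. k \<in> S \<Longrightarrow> k + N \<ge> 0"
  proof -
    have "k + (\<Sum>j\<in>S. \<bar>j\<bar>) \<ge> 0" if "k \<in> S" for k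
      using member_le_sum[of k S abs] assms(1) that by auto
    then show ?thesis using that by blast
  qed
  define q where "q = (\<Sum>k\<in>S. monom (c k) (nat (k + N)))"
  have "q = 0"
  proof (rule poly_eqI_infinite[of "{0}"])
    fix t :: 'a assume t: "t \<notin> {0}"
    have "poly q t = (\<Sum>k\<in>S. t powi N * (t powi k * c k))"
      unfolding q_def poly_sum
    proof (rule sum.cong)
      fix k assume "k \<in> S"
      then have "t ^ nat (k + N) = t powi (k + N)" using N[of k] by (simp add: power_int_def)
      then show "poly (monom (c k) (nat (k + N))) t = t powi N * (t powi k * c k)"
        using t by (simp add: poly_monom power_int_add mult_ac)
    qed simp
    then show "poly q t = poly 0 t"
      using assms(2)[of t] t by (simp flip: sum_distrib_left)
  qed simp
  then have "0 = coeff q (nat (k + N))" by simp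
  also have "\<dots> = (\<Sum>j\<in>S. if j = k then c k else 0)"
    unfolding q_def coeff_sum
    using N[OF assms(3)] N by (intro sum.cong) (auto simp: nat_eq_iff)
  finally show ?thesis using assms by simp
qed

lemma laurent_unique:
  assumes "laurent g G" "laurent g H"
  shows "G = H"
proof (intro ext)
  fix k p
  obtain S where S: "finite S" "\<And>k. k \<notin> S \<Longrightarrow> G k = (\<lambda>_. 0)"
    "\<And>T t p. finite T \<Longrightarrow> S \<subseteq> T \<Longrightarrow> t \<noteq> 0 \<Longrightarrow> g t p = (\<Sum>k\<in>T. t powi k * G k p)"
    using laurentE[OF assms(1)] by blast
  obtain R where R: "finite R" "\<And>k. k \<notin> R \<Longrightarrow> H k = (\<lambda>_. 0)"
    "\<And>T t p. finite T \<Longrightarrow> R \<subseteq> T \<Longrightarrow> t \<noteq> 0 \<Longrightarrow> g t p = (\<Sum>k\<in>T. t powi k * H k p)"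
    using laurentE[OF assms(2)] by blast
  show "G k p = H k p"
  proof (cases "k \<in> S \<union> R")
    case True
    have *: "(\<Sum>k\<in>S \<union> R. t powi k * (G k p - H k p)) = 0" if "t \<noteq> 0" for t
      using S(3)[of "S \<union> R" t p] R(3)[of "S \<union> R" t p] S(1) R(1) that
      by (simp add: right_diff_distrib sum_subtractf)
    have "G k p - H k p = 0"
      by (rule laurent_polynomial_zero[of "S \<union> R" "\<lambda>k. G k p - H k p"]) (use S(1) R(1) True * in auto)
    then show ?thesis by simp
  qed (use S R in auto)
qed

lemma laurent_cong:
  assumes "\<And>t p. t \<noteq> 0 \<Longrightarrow> g t p = h t p" "laurent g G"
  shows "laurent h G"
  using assms unfolding laurent_def by metis

lemma laurent_add:
  assumes "laurent g G" "laurent h H"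
  shows "laurent (\<lambda>t p. g t p + h t p) (\<lambda>k p. G k p + H k p)"
proof -
  obtain S where S: "finite S" "\<And>k. k \<notin> S \<Longrightarrow> G k = (\<lambda>_. 0)"
    "\<And>T t p. finite T \<Longrightarrow> S \<subseteq> T \<Longrightarrow> t \<noteq> 0 \<Longrightarrow> g t p = (\<Sum>k\<in>T. t powi k * G k p)"
    using laurentE[OF assms(1)] by blast
  obtain R where R: "finite R" "\<And>k. k \<notin> R \<Longrightarrow> H k = (\<lambda>_. 0)"
    "\<And>T t p. finite T \<Longrightarrow> R \<subseteq> T \<Longrightarrow> t \<noteq> 0 \<Longrightarrow> h t p = (\<Sum>k\<in>T. t powi k * H k p)"
    using laurentE[OF assms(2)] by blast
  show ?thesis
  proof (rule laurentI[of "S \<union> R"])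
    show "g t p + h t p = (\<Sum>k\<in>S \<union> R. t powi k * (G k p + H k p))" if "t \<noteq> 0" for t p
      using S(3)[of "S \<union> R" t p] R(3)[of "S \<union> R" t p] S(1) R(1) that
      by (simp add: distrib_left sum.distrib)
  qed (use S R in auto)
qed

lemma laurent_mult_fun:
  assumes "laurent g G"
  shows "laurent (\<lambda>t p. h p * g t p) (\<lambda>k p. h p * G k p)"
  using assms unfolding laurent_def
  by (elim exE conjE, intro exI conjI) (auto simp: sum_distrib_left mult_ac)

lemma laurent_zero: "laurent (\<lambda>_ _. 0) (\<lambda>_ _. 0)"
  by (rule laurentI[of "{}"]) auto

lemma laurent_sum:
  assumes "\<And>i. i \<in> S \<Longrightarrow> laurent (g i) (G i)"
  shows "laurent (\<lambda>t p. \<Sum>i\<in>S. g i t p) (\<lambda>k p. \<Sum>i\<in>S. G i k p)"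
  using assms
  by (induction S rule: infinite_finite_induct) (auto intro: laurent_add laurent_zero)

lemma laurent_shift:
  assumes "laurent g G"
  shows "laurent (\<lambda>t p. t powi e * g t p) (\<lambda>k. G (k - e))"
proof -
  obtain S where S: "finite S" "\<And>k. k \<notin> S \<Longrightarrow> G k = (\<lambda>_. 0)"
    "\<And>T t p. finite T \<Longrightarrow> S \<subseteq> T \<Longrightarrow> t \<noteq> 0 \<Longrightarrow> g t p = (\<Sum>k\<in>T. t powi k * G k p)"
    using laurentE[OF assms(1)] by blast
  show ?thesis
  proof (rule laurentI[of "(\<lambda>k. k + e) ` S"])
    show "t powi e * g t p = (\<Sum>k\<in>(\<lambda>k. k + e) ` S. t powi k * G (k - e) p)" if "t \<noteq> 0" for t p
      using S(3)[of S t p] S(1) that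
      by (subst sum.reindex) (auto simp: inj_on_def sum_distrib_left power_int_add mult_ac)
    fix k assume "k \<notin> (\<lambda>k. k + e) ` S"
    then have "k - e \<notin> S" by (metis diff_add_cancel image_eqI)
    then show "G (k - e) = (\<lambda>_. 0)" by (rule S(2))
  qed (use S in auto)
qed

lemma laurent_mult:
  assumes "laurent g G" "laurent h H" "\<And>k. G k \<in> coord_algebra V X" "\<And>k. H k \<in> coord_algebra V X"
  shows "\<exists>F. laurent (\<lambda>t p. g t p * h t p) F \<and> (\<forall>k. F k \<in> coord_algebra V X)"
proof -
  obtain S where S: "finite S" "\<And>k. k \<notin> S \<Longrightarrow> G k = (\<lambda>_. 0)"
    "\<And>T t p. finite T \<Longrightarrow> S \<subseteq> T \<Longrightarrow> t \<noteq> 0 \<Longrightarrow> g t p = (\<Sum>k\<in>T. t powi k * G k p)"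
    using laurentE[OF assms(1)] by blast
  have "laurent (\<lambda>t p. \<Sum>i\<in>S. t powi i * (G i p * h t p)) (\<lambda>k p. \<Sum>i\<in>S. G i p * H (k - i) p)"
    by (intro laurent_sum laurent_shift[of _ "\<lambda>k p. G _ p * H k p"] laurent_mult_fun assms)
  then have "laurent (\<lambda>t p. g t p * h t p) (\<lambda>k p. \<Sum>i\<in>S. G i p * H (k - i) p)"
    by (rule laurent_cong[rotated]) (simp add: S(3)[OF S(1) order_refl] sum_distrib_left mult_ac)
  then show ?thesis
    by (intro exI[of _ "\<lambda>k p. \<Sum>i\<in>S. G i p * H (k - i) p"]) (auto intro!: coord_algebra_sum coord_algebra_mult assms)
qed

subsection \<open>Diagonal symmetries\<close>

definition scale :: "'v set \<Rightarrow> ('v \<Rightarrow> 'a::field) \<Rightarrow> ('v \<Rightarrow> 'a) \<Rightarrow> 'v \<Rightarrow> 'a"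
  where "scale I \<sigma> p = (\<lambda>v\<in>I. \<sigma> v * p v)"

definition diag_sym :: "'v set \<Rightarrow> ('v \<Rightarrow> 'a::field) set \<Rightarrow> ('v \<Rightarrow> 'a) set"
  where "diag_sym I X = {\<sigma>. (\<forall>v\<in>I. \<sigma> v \<noteq> 0) \<and> (\<forall>p\<in>X. scale I \<sigma> p \<in> X)}"

definition pull :: "'v set \<Rightarrow> ('v \<Rightarrow> 'a::field) set \<Rightarrow> ('v \<Rightarrow> 'a) \<Rightarrow> (('v \<Rightarrow> 'a) \<Rightarrow> 'a) \<Rightarrow> ('v \<Rightarrow> 'a) \<Rightarrow> 'a"
  where "pull I X \<sigma> f = res X (\<lambda>p. f (scale I \<sigma> p))"

text \<open>Conjugation by the symmetry multiplies D by \<chi>. Geometrically the symmetry carries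
  flow lines to flow lines and multiplies the time by \<chi>, see
  \<open>flow_normalized\<close>.\<close>

definition normalizes ::
    "'v set \<Rightarrow> ('v \<Rightarrow> 'a::field) set \<Rightarrow> ((('v \<Rightarrow> 'a) \<Rightarrow> 'a) \<Rightarrow> (('v \<Rightarrow> 'a) \<Rightarrow> 'a)) \<Rightarrow> ('v \<Rightarrow> 'a) \<Rightarrow> 'a \<Rightarrow> bool"
  where "normalizes I X D \<sigma> \<chi> \<longleftrightarrow>
    (\<forall>f\<in>coord_algebra I X. D (pull I X \<sigma> f) = (\<lambda>p. \<chi> * pull I X \<sigma> (D f) p))"

lemma scale_scale: "scale I \<sigma> (scale I \<tau> p) = scale I (\<lambda>v. \<sigma> v * \<tau> v) p"
  by (auto simp: scale_def mult_ac)

lemma diag_sym_scale: "\<sigma> \<in> diag_sym I X \<Longrightarrow> p \<in> X \<Longrightarrow> scale I \<sigma> p \<in> X"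
  by (auto simp: diag_sym_def)

lemma pull_in:
  assumes "\<sigma> \<in> diag_sym I X" "f \<in> coord_algebra I X"
  shows "pull I X \<sigma> f \<in> coord_algebra I X"
proof -
  obtain F where F: "F \<in> poly_functions I" "f = res X F" using assms(2) by (auto simp: coord_algebra_eq)
  have "pull I X \<sigma> f = res X (\<lambda>p. F (scale I \<sigma> p))"
    using assms(1) by (auto simp: pull_def res_def F diag_sym_def)
  moreover have "(\<lambda>p. F (scale I \<sigma> p)) \<in> poly_functions I"
    by (rule poly_functions_subst[OF F(1)]) (auto simp: scale_def intro!: poly_functions.intros)
  ultimately show ?thesis by (auto simp: coord_algebra_eq)
qed

lemma pull_pull:
  "\<sigma> \<in> diag_sym I X \<Longrightarrow> pull I X \<sigma> (pull I X \<tau> f) = pull I X (\<lambda>v. \<tau> v * \<sigma> v) f"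
  by (auto simp: pull_def res_def scale_scale diag_sym_def)

lemma pull_commute:
  "\<sigma> \<in> diag_sym I X \<Longrightarrow> \<tau> \<in> diag_sym I X \<Longrightarrow> pull I X \<sigma> (pull I X \<tau> f) = pull I X \<tau> (pull I X \<sigma> f)"
  by (simp add: pull_pull mult.commute)

lemma pull_add: "pull I X \<sigma> (\<lambda>p. f p + g p) = (\<lambda>p. pull I X \<sigma> f p + pull I X \<sigma> g p)"
  and pull_mult: "pull I X \<sigma> (\<lambda>p. f p * g p) = (\<lambda>p. pull I X \<sigma> f p * pull I X \<sigma> g p)"
  and pull_scale: "pull I X \<sigma> (\<lambda>p. c * f p) = (\<lambda>p. c * pull I X \<sigma> f p)"
  and pull_sum: "pull I X \<sigma> (\<lambda>p. \<Sum>i\<in>S. F i p) = (\<lambda>p. \<Sum>i\<in>S. pull I X \<sigma> (F i) p)"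
  and pull_zero: "pull I X \<sigma> (\<lambda>_. 0) = (\<lambda>_. 0)"
  by (auto simp: pull_def res_def fun_eq_iff)

lemma pull_const: "\<sigma> \<in> diag_sym I X \<Longrightarrow> pull I X \<sigma> (res X (\<lambda>_. c)) = res X (\<lambda>_. c)"
  by (auto simp: pull_def res_def diag_sym_def)

lemma pull_crd:
  "\<sigma> \<in> diag_sym I X \<Longrightarrow> v \<in> I \<Longrightarrow> pull I X \<sigma> (res X (\<lambda>p. p v)) = (\<lambda>p. \<sigma> v * res X (\<lambda>p. p v) p)"
  by (auto simp: pull_def res_def diag_sym_def scale_def)

lemma laurent_pull:
  "laurent g G \<Longrightarrow> laurent (\<lambda>t. pull I X \<sigma> (g t)) (\<lambda>k. pull I X \<sigma> (G k))"
  unfolding laurent_def pull_def res_def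
  by (elim exE conjE, intro exI conjI) auto

lemma normalizes_mult:
  assumes "\<sigma> \<in> diag_sym I X" "\<tau> \<in> diag_sym I X" "normalizes I X D \<sigma> \<chi>" "normalizes I X D \<tau> \<psi>"
  shows "normalizes I X D (\<lambda>v. \<sigma> v * \<tau> v) (\<chi> * \<psi>)"
  unfolding normalizes_def
proof
  fix f assume f: "f \<in> coord_algebra I X"
  have "D (pull I X \<tau> (pull I X \<sigma> f)) = (\<lambda>p. \<psi> * pull I X \<tau> (D (pull I X \<sigma> f)) p)"
    using assms(4) pull_in[OF assms(1) f] unfolding normalizes_def by blast
  also have "D (pull I X \<sigma> f) = (\<lambda>p. \<chi> * pull I X \<sigma> (D f) p)"
    using assms f by (auto simp: normalizes_def)
  finally show "D (pull I X (\<lambda>v. \<sigma> v * \<tau> v) f) = (\<lambda>p. \<chi> * \<psi> * pull I X (\<lambda>v. \<sigma> v * \<tau> v) (D f) p)"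
    by (simp add: pull_pull assms pull_scale mult_ac)
qed

subsection \<open>Gradings and the leading component of a derivation\<close>

text \<open>A grading of K[X] is encoded by its one-parameter group t -> diag(t^\<omega>): weight e
  means that pulling back multiplies by t^e. Homogeneity thus concerns functions on X and not the
  polynomials representing them.\<close>

locale weighted_set = coordinate_ring I X
  for I :: "'v set" and X :: "('v \<Rightarrow> 'a::field_char_0) set" +
  fixes \<omega> :: "'v \<Rightarrow> int"
  assumes X_ext: "X \<subseteq> I \<rightarrow>\<^sub>E UNIV"
    and finI: "finite I"
    and \<omega>_sym: "t \<noteq> 0 \<Longrightarrow> (\<lambda>v. t powi \<omega> v) \<in> diag_sym I X"
begin

abbreviation "act t \<equiv> pull I X (\<lambda>v. t powi \<omega> v)"

definition graded :: "int \<Rightarrow> (('v \<Rightarrow> 'a) \<Rightarrow> 'a) \<Rightarrow> bool"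
  where "graded e f \<longleftrightarrow> f \<in> A \<and> (\<forall>t. t \<noteq> 0 \<longrightarrow> act t f = (\<lambda>p. t powi e * f p))"

lemma graded_in: "graded e f \<Longrightarrow> f \<in> A"
  and graded_act: "graded e f \<Longrightarrow> t \<noteq> 0 \<Longrightarrow> act t f = (\<lambda>p. t powi e * f p)"
  by (auto simp: graded_def)

lemma graded_crd: "v \<in> I \<Longrightarrow> graded (\<omega> v) (crd v)"
  by (auto simp: graded_def pull_crd \<omega>_sym intro!: res_in_coord_algebra poly_functions.intros)

lemma graded_laurent:
  assumes "graded e f" shows "laurent (\<lambda>t. act t f) (\<lambda>k p. if k = e then f p else 0)"
  by (rule laurentI[of "{e}"]) (use assms in \<open>auto simp: graded_def\<close>)

lemma act_inverse_graded:
  assumes "graded e f" "t \<noteq> 0" shows "act (inverse t) f = (\<lambda>p. t powi (- e) * f p)"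
proof -
  have "inverse t powi e = t powi (- e)" by (simp add: power_int_minus power_int_inverse)
  then show ?thesis using graded_act[OF assms(1), of "inverse t"] assms(2) by (simp only: inverse_nonzero_iff_nonzero not_False_eq_True)
qed

lemma act_act: "s \<noteq> 0 \<Longrightarrow> t \<noteq> 0 \<Longrightarrow> act s (act t f) = act (s * t) f"
  by (simp add: pull_pull \<omega>_sym power_int_mult_distrib mult.commute)

lemma scale_one: "p \<in> X \<Longrightarrow> scale I (\<lambda>v. 1 powi \<omega> v) p = p"
  using X_ext by (fastforce simp: scale_def)

lemma act_one: "f \<in> A \<Longrightarrow> act 1 f = f"
  by (auto simp: pull_def res_def scale_one fun_eq_iff simp: coord_algebra_zero_outside simp del: power_int_1_left)

lemma pull_one: "f \<in> A \<Longrightarrow> pull I X (\<lambda>v. 1) f = f"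
  using act_one by simp

lemma act_in: "t \<noteq> 0 \<Longrightarrow> f \<in> A \<Longrightarrow> act t f \<in> A"
  by (simp add: pull_in \<omega>_sym)

lemma graded_ex_components:
  assumes "graded e f" shows "\<exists>F. laurent (\<lambda>t. act t f) F \<and> (\<forall>k. F k \<in> A)"
proof (intro exI conjI allI)
  show "laurent (\<lambda>t. act t f) (\<lambda>k p. if k = e then f p else 0)" by (rule graded_laurent[OF assms])
  show "(\<lambda>p. if k = e then f p else 0) \<in> A" for k
    by (cases "k = e") (simp_all add: graded_in[OF assms] coord_algebra_zero)
qed

lemma ex_components:
  assumes "f \<in> A" shows "\<exists>F. laurent (\<lambda>t. act t f) F \<and> (\<forall>e. F e \<in> A)"
  using assms
proof (induction rule: coord_algebra_induct)
  case (const c)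
  have "graded 0 (res X (\<lambda>_. c))"
    by (auto simp: graded_def pull_const \<omega>_sym intro!: res_in_coord_algebra poly_functions.intros)
  then show ?case by (rule graded_ex_components)
next
  case (coord v)
  then show ?case by (rule graded_ex_components[OF graded_crd])
next
  case (add f g)
  then obtain F G where F: "laurent (\<lambda>t. act t f) F" "\<forall>e. F e \<in> A"
    and G: "laurent (\<lambda>t. act t g) G" "\<forall>e. G e \<in> A" by blast
  then show ?case using laurent_add[OF F(1) G(1)]
    by (intro exI[of _ "\<lambda>k p. F k p + G k p"]) (auto simp: pull_add intro: coord_algebra_add)
next
  case (mult f g)
  then obtain F G where "laurent (\<lambda>t. act t f) F" "\<forall>e. F e \<in> A" "laurent (\<lambda>t. act t g) G" "\<forall>e. G e \<in> A" by blast
  then show ?case using laurent_mult[of "\<lambda>t. act t f" F "\<lambda>t. act t g" G I X] by (simp add: pull_mult)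
qed

text \<open>Apply \<open>act s\<close> to the expansion of \<open>act t f\<close>. Since the result
  is \<open>act (s * t) f\<close>, uniqueness of the Laurent coefficients gives the weight of each
  of them.\<close>

lemma components_graded:
  assumes "laurent (\<lambda>t. act t f) F" "\<And>e. F e \<in> A"
  shows "graded e (F e)"
proof -
  have "act s (F e) = (\<lambda>p. s powi e * F e p)" if s: "s \<noteq> 0" for s
  proof -
    have 1: "laurent (\<lambda>t. act s (act t f)) (\<lambda>k. act s (F k))"
      by (rule laurent_pull[OF assms(1)])
    obtain S where S: "finite S" "\<And>k. k \<notin> S \<Longrightarrow> F k = (\<lambda>_. 0)"
      "\<And>T t p. finite T \<Longrightarrow> S \<subseteq> T \<Longrightarrow> t \<noteq> 0 \<Longrightarrow> act t f p = (\<Sum>k\<in>T. t powi k * F k p)"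
      using laurentE[OF assms(1)] by blast
    have 2: "laurent (\<lambda>t. act s (act t f)) (\<lambda>k p. s powi k * F k p)"
    proof (rule laurentI[OF S(1)])
      fix t p assume t: "t \<noteq> (0::'a)"
      show "act s (act t f) p = (\<Sum>k\<in>S. t powi k * (s powi k * F k p))"
        unfolding act_act[OF s t] using s t
        by (subst S(3)[OF S(1) order_refl]) (simp_all add: power_int_mult_distrib mult_ac)
    qed (use S(2) in auto)
    show ?thesis using laurent_unique[OF 1 2] by (rule fun_cong)
  qed
  then show ?thesis using assms by (simp add: graded_def)
qed

lemma decomposition:
  assumes "f \<in> A"
  obtains S F where "finite S" "\<And>e. graded e (F e)" "f = (\<lambda>p. \<Sum>e\<in>S. F e p)"
    "laurent (\<lambda>t. act t f) F" "\<And>e. e \<notin> S \<Longrightarrow> F e = (\<lambda>_. 0)"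
proof -
  obtain F where F: "laurent (\<lambda>t. act t f) F" "\<And>e. F e \<in> A" using ex_components[OF assms] by blast
  obtain S where S: "finite S" "\<And>k. k \<notin> S \<Longrightarrow> F k = (\<lambda>_. 0)"
    "\<And>T t p. finite T \<Longrightarrow> S \<subseteq> T \<Longrightarrow> t \<noteq> 0 \<Longrightarrow> act t f p = (\<Sum>k\<in>T. t powi k * F k p)"
    using laurentE[OF F(1)] by blast
  have "f = (\<lambda>p. \<Sum>e\<in>S. F e p)"
    using S(3)[of S 1] S(1) act_one[OF assms] by auto
  then show ?thesis using that S F components_graded[OF F] by blast
qed

text \<open>The filtration by weight: all homogeneous components of f have weight less than c. It
  serves to compare D with its leading component.\<close>

definition below :: "int \<Rightarrow> (('v \<Rightarrow> 'a) \<Rightarrow> 'a) \<Rightarrow> bool"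
  where "below c f \<longleftrightarrow> f \<in> A \<and> (\<exists>F. laurent (\<lambda>t. act t f) F \<and> (\<forall>e\<ge>c. F e = (\<lambda>_. 0)))"

lemma below_in: "below c f \<Longrightarrow> f \<in> A"
  by (simp add: below_def)

lemma below_zero: "below c (\<lambda>_. 0)"
  by (auto simp: below_def coord_algebra_zero pull_zero intro!: exI[of _ "\<lambda>_ _. 0"] laurent_zero)

lemma below_add:
  assumes "below c f" "below c g" shows "below c (\<lambda>p. f p + g p)"
proof -
  obtain F G where "laurent (\<lambda>t. act t f) F" "\<forall>e\<ge>c. F e = (\<lambda>_. 0)"
    "laurent (\<lambda>t. act t g) G" "\<forall>e\<ge>c. G e = (\<lambda>_. 0)" using assms by (auto simp: below_def)
  then show ?thesis using assms laurent_add[of "\<lambda>t. act t f" F "\<lambda>t. act t g" G]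
    by (auto simp: below_def coord_algebra_add pull_add intro!: exI[of _ "\<lambda>k p. F k p + G k p"])
qed

lemma below_sum: "(\<And>i. i \<in> S \<Longrightarrow> below c (f i)) \<Longrightarrow> below c (\<lambda>p. \<Sum>i\<in>S. f i p)"
  by (induction S rule: infinite_finite_induct) (auto intro: below_add below_zero)

lemma graded_below: "graded e f \<Longrightarrow> e < c \<Longrightarrow> below c f"
  by (auto simp: below_def graded_in intro!: exI[of _ "\<lambda>k p. if k = e then f p else 0"] graded_laurent)

lemma graded_below_zero:
  assumes "graded c f" "below c f" shows "f = (\<lambda>_. 0)"
proof -
  obtain F where F: "laurent (\<lambda>t. act t f) F" "\<forall>e\<ge>c. F e = (\<lambda>_. 0)" using assms by (auto simp: below_def)
  have "F c = (\<lambda>k p. if k = c then f p else 0) c"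
    using laurent_unique[OF F(1) graded_laurent[OF assms(1)]] by (rule fun_cong)
  then show ?thesis using F(2) by auto
qed

lemma below_decomposition:
  assumes "below c f"
  obtains S F where "finite S" "\<And>e. graded e (F e)" "f = (\<lambda>p. \<Sum>e\<in>S. F e p)" "\<And>e. e \<in> S \<Longrightarrow> e < c"
proof -
  obtain G where G: "laurent (\<lambda>t. act t f) G" "\<forall>e\<ge>c. G e = (\<lambda>_. 0)" using assms by (auto simp: below_def)
  obtain S F where F: "finite S" "\<And>e. graded e (F e)" "f = (\<lambda>p. \<Sum>e\<in>S. F e p)"
    "laurent (\<lambda>t. act t f) F" "\<And>e. e \<notin> S \<Longrightarrow> F e = (\<lambda>_. 0)"
    using decomposition[OF below_in[OF assms]] by blast
  have "F = G" by (rule laurent_unique[OF F(4) G(1)])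
  then have "f p = (\<Sum>e\<in>{e\<in>S. e < c}. F e p)" for p
    unfolding F(3) using F(1) G(2) by (intro sum.mono_neutral_right) (auto simp: not_less)
  then have f: "f = (\<lambda>p. \<Sum>e\<in>{e\<in>S. e < c}. F e p)" by blast
  show ?thesis by (rule that[OF _ F(2) f]) (use F(1) in auto)
qed

end

section \<open>Homogeneous components of a derivation\<close>

locale weighted_derivation = weighted_set I X \<omega> + derivation_on I X D
  for I :: "'v set" and X :: "('v \<Rightarrow> 'a::field_char_0) set" and \<omega> D
begin

text \<open>The Laurent coefficients in t of this conjugate of D are the homogeneous components of
  D: on f of weight e the conjugate is t^(-e) times \<open>act t (D f)\<close>, so t^k collects the
  part of D f of weight e + k.\<close>

definition conj_by :: "'a \<Rightarrow> (('v \<Rightarrow> 'a) \<Rightarrow> 'a) \<Rightarrow> ('v \<Rightarrow> 'a) \<Rightarrow> 'a"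
  where "conj_by t f = act t (D (act (inverse t) f))"

lemma ex_conj_expansion:
  assumes f: "f \<in> A" shows "\<exists>G. laurent (\<lambda>t. conj_by t f) G \<and> (\<forall>k. G k \<in> A)"
proof -
  obtain S F where F: "finite S" "\<And>e. graded e (F e)" "f = (\<lambda>p. \<Sum>e\<in>S. F e p)"
    using decomposition[OF f] by blast
  have "\<forall>e. \<exists>H. laurent (\<lambda>t. act t (D (F e))) H \<and> (\<forall>k. H k \<in> A)"
    using ex_components D_closed graded_in[OF F(2)] by blast
  then obtain H where H: "\<And>e. laurent (\<lambda>t. act t (D (F e))) (H e)" "\<And>e k. H e k \<in> A" by metis
  have "laurent (\<lambda>t p. \<Sum>e\<in>S. t powi (-e) * act t (D (F e)) p) (\<lambda>k p. \<Sum>e\<in>S. H e (k - (- e)) p)"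
    by (intro laurent_sum laurent_shift H)
  moreover have "conj_by t f p = (\<Sum>e\<in>S. t powi (-e) * act t (D (F e)) p)" if t: "t \<noteq> 0" for t p
  proof -
    have "act (inverse t) f = (\<lambda>p. \<Sum>e\<in>S. act (inverse t) (F e) p)"
      by (subst F(3)) (simp add: pull_sum)
    also have "\<dots> = (\<lambda>p. \<Sum>e\<in>S. t powi (-e) * F e p)"
      by (simp only: act_inverse_graded[OF F(2) t])
    finally have a: "act (inverse t) f = (\<lambda>p. \<Sum>e\<in>S. t powi (-e) * F e p)" .
    have "D (\<lambda>p. \<Sum>e\<in>S. t powi (-e) * F e p) = (\<lambda>p. \<Sum>e\<in>S. t powi (-e) * D (F e) p)"
      using graded_in[OF F(2)] by (simp add: D_sum D_scale coord_algebra_scale)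
    then show ?thesis by (simp only: conj_by_def a pull_sum pull_scale)
  qed
  ultimately have "laurent (\<lambda>t. conj_by t f) (\<lambda>k p. \<Sum>e\<in>S. H e (k - (- e)) p)"
    by (intro laurent_cong[of "\<lambda>t p. \<Sum>e\<in>S. t powi (-e) * act t (D (F e)) p" "\<lambda>t. conj_by t f"]) auto
  then show ?thesis using H(2)
    by (intro exI[of _ "\<lambda>k p. \<Sum>e\<in>S. H e (k - (- e)) p"]) (auto intro!: coord_algebra_sum)
qed

definition component :: "int \<Rightarrow> (('v \<Rightarrow> 'a) \<Rightarrow> 'a) \<Rightarrow> ('v \<Rightarrow> 'a) \<Rightarrow> 'a"
  where "component k f = (SOME G. laurent (\<lambda>t. conj_by t f) G \<and> (\<forall>k. G k \<in> A)) k"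

lemma component_in: "f \<in> A \<Longrightarrow> component k f \<in> A"
  and laurent_component: "f \<in> A \<Longrightarrow> laurent (\<lambda>t. conj_by t f) (\<lambda>k. component k f)"
  unfolding component_def using someI_ex[OF ex_conj_expansion] by simp_all

lemma component_eqI:
  "f \<in> A \<Longrightarrow> laurent (\<lambda>t. conj_by t f) G \<Longrightarrow> component k f = G k"
  using laurent_unique[OF laurent_component] by (metis (no_types))

text \<open>Each conjugate is a derivation, and the laws pass to the coefficients by uniqueness of
  the expansion. In the Leibniz rule f and g appear as factors independent of t, because
  \<open>act t\<close> undoes \<open>act (inverse t)\<close>.\<close>

lemma component_derivation: "derivation A (component k)"
  unfolding derivation_def
proof (intro conjI ballI allI)
  show "component k \<in> A \<rightarrow> A" using component_in by blast
next
  fix f g assume fg: "f \<in> A" "g \<in> A"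
  have "laurent (\<lambda>t p. conj_by t f p + conj_by t g p) (\<lambda>k p. component k f p + component k g p)"
    by (intro laurent_add laurent_component fg)
  then have "laurent (\<lambda>t. conj_by t (\<lambda>p. f p + g p)) (\<lambda>k p. component k f p + component k g p)"
    by (rule laurent_cong[rotated]) (use fg in \<open>auto simp: conj_by_def pull_add D_add act_in\<close>)
  then show "component k (\<lambda>p. f p + g p) = (\<lambda>p. component k f p + component k g p)"
    by (rule component_eqI[OF coord_algebra_add[OF fg]])
next
  fix c f assume f: "f \<in> A"
  have "laurent (\<lambda>t p. c * conj_by t f p) (\<lambda>k p. c * component k f p)"
    by (intro laurent_mult_fun laurent_component f)
  then have "laurent (\<lambda>t. conj_by t (\<lambda>p. c * f p)) (\<lambda>k p. c * component k f p)"
    by (rule laurent_cong[rotated]) (use f in \<open>auto simp: conj_by_def pull_scale D_scale act_in\<close>)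
  then show "component k (\<lambda>p. c * f p) = (\<lambda>p. c * component k f p)"
    by (rule component_eqI[OF coord_algebra_scale[OF f]])
next
  fix f g assume fg: "f \<in> A" "g \<in> A"
  have "laurent (\<lambda>t p. g p * conj_by t f p + f p * conj_by t g p) (\<lambda>k p. g p * component k f p + f p * component k g p)"
    by (intro laurent_add laurent_mult_fun laurent_component fg)
  then have "laurent (\<lambda>t. conj_by t (\<lambda>p. f p * g p)) (\<lambda>k p. g p * component k f p + f p * component k g p)"
    by (rule laurent_cong[rotated])
      (use fg in \<open>auto simp: conj_by_def pull_mult pull_add D_mult act_in act_act pull_one mult_ac\<close>)
  then show "component k (\<lambda>p. f p * g p) = (\<lambda>p. component k f p * g p + f p * component k g p)"
    by (subst component_eqI[OF coord_algebra_mult[OF fg]]) (simp_all add: mult_ac)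
qed

lemma component_graded:
  assumes "graded e f" shows "graded (e + k) (component k f)"
proof -
  note f = graded_in[OF assms]
  obtain F where H: "laurent (\<lambda>t. act t (D f)) F" "\<And>e. F e \<in> A"
    using ex_components[OF D_closed[OF f]] by blast
  note F = components_graded[OF H] H(1)
  have "laurent (\<lambda>t p. t powi (-e) * act t (D f) p) (\<lambda>k. F (k - (-e)))"
    by (rule laurent_shift[OF F(2)])
  moreover have "t powi (-e) * act t (D f) p = conj_by t f p" if t: "t \<noteq> 0" for t p
    by (simp only: conj_by_def act_inverse_graded[OF assms t] D_scale[OF f] pull_scale)
  ultimately have "laurent (\<lambda>t. conj_by t f) (\<lambda>k. F (k - (-e)))"
    by (rule laurent_cong[rotated])
  then have "component k f = F (k - (-e))" by (rule component_eqI[OF f])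
  then show ?thesis using F(1) by (simp add: add.commute)
qed

text \<open>A component that kills the finitely many coordinates is zero, so the degrees seen on
  coordinates are the only ones. Setting t = 1 writes D as the sum of its components.\<close>

lemma finite_components:
  obtains K where "finite K" "\<And>k f. k \<notin> K \<Longrightarrow> f \<in> A \<Longrightarrow> component k f = (\<lambda>_. 0)"
    "\<And>f. f \<in> A \<Longrightarrow> D f = (\<lambda>p. \<Sum>k\<in>K. component k f p)"
proof -
  have "\<forall>v\<in>I. \<exists>S. finite S \<and> (\<forall>k. k \<notin> S \<longrightarrow> component k (crd v) = (\<lambda>_. 0))"
    using laurentE[OF laurent_component[OF crd_in]] by metis
  then obtain S where S: "\<And>v. v \<in> I \<Longrightarrow> finite (S v)"
    "\<And>v k. v \<in> I \<Longrightarrow> k \<notin> S v \<Longrightarrow> component k (crd v) = (\<lambda>_. 0)" by metis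
  define K where "K = (\<Union>v\<in>I. S v)"
  have K: "finite K" using S finI by (auto simp: K_def)
  have z: "component k f = (\<lambda>_. 0)" if "k \<notin> K" "f \<in> A" for k f
  proof -
    interpret C: derivation_on I X "component k" by unfold_locales (rule component_derivation)
    show ?thesis by (rule C.D_eq_zeroI) (use that S in \<open>auto simp: K_def\<close>)
  qed
  have "D f = (\<lambda>p. \<Sum>k\<in>K. component k f p)" if f: "f \<in> A" for f
  proof
    fix p
    obtain S where S: "finite S" "\<And>k. k \<notin> S \<Longrightarrow> component k f = (\<lambda>_. 0)"
      "\<And>T t p. finite T \<Longrightarrow> S \<subseteq> T \<Longrightarrow> t \<noteq> 0 \<Longrightarrow> conj_by t f p = (\<Sum>k\<in>T. t powi k * component k f p)"
      using laurentE[OF laurent_component[OF f]] by blast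
    have "D f p = conj_by 1 f p" using f D_closed by (simp add: conj_by_def pull_one)
    also have "\<dots> = (\<Sum>k\<in>S \<union> K. component k f p)" using S(3)[of "S \<union> K" 1 p] S(1) K by simp
    also have "\<dots> = (\<Sum>k\<in>K. component k f p)"
      using S(1) K z f by (intro sum.mono_neutral_right) auto
    finally show "D f p = (\<Sum>k\<in>K. component k f p)" .
  qed
  then show ?thesis using that K z by blast
qed

text \<open>Diagonal maps commute, so conjugating D inside the expansion preserves its character
  under \<sigma>. This lets leading components be taken for several gradings in succession.\<close>

lemma component_normalizes:
  assumes s: "\<sigma> \<in> diag_sym I X" and n: "normalizes I X D \<sigma> \<chi>"
  shows "normalizes I X (component k) \<sigma> \<chi>"
  unfolding normalizes_def
proof
  fix f assume f: "f \<in> A"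
  have "laurent (\<lambda>t p. \<chi> * pull I X \<sigma> (conj_by t f) p) (\<lambda>k p. \<chi> * pull I X \<sigma> (component k f) p)"
    by (intro laurent_mult_fun laurent_pull laurent_component f)
  moreover have "conj_by t (pull I X \<sigma> f) p = \<chi> * pull I X \<sigma> (conj_by t f) p" if t: "t \<noteq> 0" for t p
  proof -
    have "D (pull I X \<sigma> (act (inverse t) f)) = (\<lambda>p. \<chi> * pull I X \<sigma> (D (act (inverse t) f)) p)"
      using n act_in[of "inverse t" f] f t unfolding normalizes_def by simp
    moreover have "act (inverse t) (pull I X \<sigma> f) = pull I X \<sigma> (act (inverse t) f)"
      using \<omega>_sym[of "inverse t"] s t by (intro pull_commute) auto
    moreover have "act t (pull I X \<sigma> g) = pull I X \<sigma> (act t g)" for g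
      using \<omega>_sym[of t] s t by (intro pull_commute) auto
    ultimately show ?thesis by (simp add: conj_by_def pull_scale)
  qed
  ultimately have "laurent (\<lambda>t. conj_by t (pull I X \<sigma> f)) (\<lambda>k p. \<chi> * pull I X \<sigma> (component k f) p)"
    by (intro laurent_cong[of "\<lambda>t p. \<chi> * pull I X \<sigma> (conj_by t f) p" "\<lambda>t. conj_by t (pull I X \<sigma> f)"]) auto
  then show "component k (pull I X \<sigma> f) = (\<lambda>p. \<chi> * pull I X \<sigma> (component k f) p)"
    by (rule component_eqI[OF pull_in[OF s f]])
qed

text \<open>On weight e one has E (\<open>act t f\<close>) = t^e E f, whereas
  \<open>act t (E f)\<close> = t^(e + k) E f; the quotient is the character t^(-k).\<close>

lemma graded_map_normalizes:
  assumes E: "derivation A E" "\<And>e f. graded e f \<Longrightarrow> graded (e + k) (E f)" and t: "t \<noteq> 0"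
  shows "normalizes I X E (\<lambda>v. t powi \<omega> v) (t powi (- k))"
  unfolding normalizes_def
proof
  fix f assume f: "f \<in> A"
  interpret E: derivation_on I X E by unfold_locales (rule E(1))
  obtain S F where F: "finite S" "\<And>e. graded e (F e)" "f = (\<lambda>p. \<Sum>e\<in>S. F e p)"
    using decomposition[OF f] by blast
  have "E (act t f) = E (\<lambda>p. \<Sum>e\<in>S. t powi e * F e p)"
    by (subst F(3)) (simp add: pull_sum graded_act[OF F(2)] t)
  also have "\<dots> = (\<lambda>p. \<Sum>e\<in>S. t powi e * E (F e) p)"
    using graded_in[OF F(2)] by (simp add: E.D_sum E.D_scale coord_algebra_scale)
  finally have 1: "E (act t f) = (\<lambda>p. \<Sum>e\<in>S. t powi e * E (F e) p)" .
  have "E f = (\<lambda>p. \<Sum>e\<in>S. E (F e) p)"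
    by (subst F(3)) (use graded_in[OF F(2)] in \<open>simp add: E.D_sum\<close>)
  then have "act t (E f) = (\<lambda>p. \<Sum>e\<in>S. t powi (e + k) * E (F e) p)"
    by (simp add: pull_sum graded_act[OF E(2)[OF F(2)]] t)
  then have "(\<lambda>p. t powi (- k) * act t (E f) p) = (\<lambda>p. \<Sum>e\<in>S. t powi e * E (F e) p)"
    using t by (simp add: sum_distrib_left power_int_add power_int_minus field_simps)
  then show "E (act t f) = (\<lambda>p. t powi - k * act t (E f) p)" using 1 by simp
qed

text \<open>Let E be the component of largest degree k. On f of weight e, D^m f and E^m f differ by
  terms of weight below e + m k, so D^m f = 0 forces E^m f = 0, the latter being homogeneous of
  exactly that weight. In this way E inherits local nilpotency. The last conclusion says that D
  raises weights by at most k.\<close>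

theorem leading_component:
  assumes nilp: "\<And>f. f \<in> A \<Longrightarrow> \<exists>n. (D ^^ n) f = (\<lambda>_. 0)"
    and nz: "\<exists>f\<in>A. D f \<noteq> (\<lambda>_. 0)"
  obtains k E where "derivation A E" "\<And>f. f \<in> A \<Longrightarrow> \<exists>n. (E ^^ n) f = (\<lambda>_. 0)"
    "\<exists>f\<in>A. E f \<noteq> (\<lambda>_. 0)"
    "\<And>t. t \<noteq> 0 \<Longrightarrow> normalizes I X E (\<lambda>v. t powi \<omega> v) (t powi (- k))"
    "\<And>\<sigma> \<chi>. \<sigma> \<in> diag_sym I X \<Longrightarrow> normalizes I X D \<sigma> \<chi> \<Longrightarrow> normalizes I X E \<sigma> \<chi>"
    "\<And>c f. below c f \<Longrightarrow> below (c + k) (D f)"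
proof -
  obtain K where K: "finite K" "\<And>k f. k \<notin> K \<Longrightarrow> f \<in> A \<Longrightarrow> component k f = (\<lambda>_. 0)"
    "\<And>f. f \<in> A \<Longrightarrow> D f = (\<lambda>p. \<Sum>k\<in>K. component k f p)" using finite_components by blast
  define L where "L = {k\<in>K. \<exists>f\<in>A. component k f \<noteq> (\<lambda>_. 0)}"
  have Lf: "finite L" using K by (simp add: L_def)
  have L: "component k f = (\<lambda>_. 0)" if "k \<notin> L" "f \<in> A" for k f
    using that K(2) by (auto simp: L_def)
  have LD: "D f = (\<lambda>p. \<Sum>k\<in>L. component k f p)" if "f \<in> A" for f
    unfolding K(3)[OF that] using K(1) L that by (intro ext sum.mono_neutral_right) (auto simp: L_def)
  have "L \<noteq> {}"
  proof
    assume "L = {}"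
    then show False using nz LD by auto
  qed
  define k where "k = Max L"
  have kL: "k \<in> L" "\<And>j. j \<in> L \<Longrightarrow> j \<le> k" using Lf \<open>L \<noteq> {}\<close> by (auto simp: k_def)
  let ?E = "component k"
  interpret E: derivation_on I X ?E by unfold_locales (rule component_derivation)
  have D_below: "below (c + k) (D f)" if b: "below c f" for c f
  proof -
    obtain S F where F: "finite S" "\<And>e. graded e (F e)" "f = (\<lambda>p. \<Sum>e\<in>S. F e p)" "\<And>e. e \<in> S \<Longrightarrow> e < c"
      using below_decomposition[OF b] by blast
    have "below (c + k) (D (F e))" if e: "e \<in> S" for e
    proof -
      have "below (c + k) (component j (F e))" if "j \<in> L" for j
        using F(4)[OF e] kL(2)[OF that] by (intro graded_below[OF component_graded[OF F(2)]]) simp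
      then have "below (c + k) (\<lambda>p. \<Sum>j\<in>L. component j (F e) p)" by (rule below_sum)
      then show ?thesis using LD graded_in[OF F(2)] by simp
    qed
    then have "below (c + k) (\<lambda>p. \<Sum>e\<in>S. D (F e) p)" by (rule below_sum)
    moreover have "D f = (\<lambda>p. \<Sum>e\<in>S. D (F e) p)"
      by (subst F(3)) (use graded_in[OF F(2)] in \<open>simp add: D_sum\<close>)
    ultimately show ?thesis by simp
  qed
  have E_graded: "graded (e + int m * k) ((?E ^^ m) f)" if "graded e f" for e f m
    using that by (induction m) (auto simp: algebra_simps dest: component_graded[of _ _ k])
  have lead: "below (e + int m * k) (\<lambda>p. (D ^^ m) f p - (?E ^^ m) f p)" if f: "graded e f" for e f m
  proof (induction m)
    case 0
    then show ?case by (simp add: below_zero)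
  next
    case (Suc m)
    let ?g = "(?E ^^ m) f" let ?r = "\<lambda>p. (D ^^ m) f p - ?g p"
    have g: "graded (e + int m * k) ?g" by (rule E_graded[OF f])
    have rA: "?r \<in> A" using below_in[OF Suc.IH] .
    have "(D ^^ m) f = (\<lambda>p. ?g p + ?r p)" by auto
    then have "(D ^^ Suc m) f = D (\<lambda>p. ?g p + ?r p)" by simp
    also have "\<dots> = (\<lambda>p. D ?g p + D ?r p)" using graded_in[OF g] rA by (rule D_add)
    finally have 1: "(D ^^ Suc m) f = (\<lambda>p. D ?g p + D ?r p)" .
    have "D ?g = (\<lambda>p. component k ?g p + (\<Sum>j\<in>L - {k}. component j ?g p))"
      unfolding LD[OF graded_in[OF g]] using Lf kL(1) by (subst sum.remove[of _ k]) auto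
    then have 2: "(\<lambda>p. (D ^^ Suc m) f p - (?E ^^ Suc m) f p) = (\<lambda>p. (\<Sum>j\<in>L - {k}. component j ?g p) + D ?r p)"
      using 1 by auto
    have "below (e + int m * k + k) (D ?r)" by (rule D_below[OF Suc.IH])
    moreover have "below (e + int m * k + k) (component j ?g)" if "j \<in> L - {k}" for j
      using kL(2)[of j] that by (intro graded_below[OF component_graded[OF g]]) auto
    then have "below (e + int m * k + k) (\<lambda>p. \<Sum>j\<in>L - {k}. component j ?g p)" by (rule below_sum)
    ultimately have "below (e + int m * k + k) (\<lambda>p. (\<Sum>j\<in>L - {k}. component j ?g p) + D ?r p)"
      by (intro below_add)
    then show ?case unfolding 2 by (simp add: algebra_simps)
  qed
  have nil_graded: "\<exists>m. (?E ^^ m) f = (\<lambda>_. 0)" if f: "graded e f" for e f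
  proof -
    obtain m where m: "(D ^^ m) f = (\<lambda>_. 0)" using nilp graded_in[OF f] by blast
    then have "below (e + int m * k) (\<lambda>p. - (?E ^^ m) f p)" using lead[OF f, of m] by simp
    moreover have "graded (e + int m * k) (\<lambda>p. - (?E ^^ m) f p)"
      using E_graded[OF f, of m] coord_algebra_scale[of "(?E ^^ m) f" I X "-1"]
        pull_scale[of I X _ "-1" "(?E ^^ m) f"] by (auto simp: graded_def)
    ultimately have "(\<lambda>p. - (?E ^^ m) f p) = (\<lambda>_. 0)" by (intro graded_below_zero)
    then show ?thesis by (auto simp: fun_eq_iff)
  qed
  have nilE: "\<exists>m. (?E ^^ m) f = (\<lambda>_. 0)" if f: "f \<in> A" for f
  proof -
    obtain S F where F: "finite S" "\<And>e. graded e (F e)" "f = (\<lambda>p. \<Sum>e\<in>S. F e p)"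
      using decomposition[OF f] by blast
    have "\<exists>m. (?E ^^ m) (\<lambda>p. \<Sum>e\<in>S. F e p) = (\<lambda>_. 0)" using F(1)
    proof (induction S rule: finite_induct)
      case empty
      show ?case by (rule exI[of _ 0]) simp
    next
      case (insert e S)
      obtain m where m: "(?E ^^ m) (\<lambda>p. \<Sum>e\<in>S. F e p) = (\<lambda>_. 0)" using insert.IH by blast
      obtain m' where m': "(?E ^^ m') (F e) = (\<lambda>_. 0)" using nil_graded[OF F(2)] by blast
      have z: "(?E ^^ (m + m')) (\<lambda>p. \<Sum>e\<in>S. F e p) = (\<lambda>_. 0)" "(?E ^^ (m + m')) (F e) = (\<lambda>_. 0)"
        using E.Dn_zero_mono[OF m] E.Dn_zero_mono[OF m'] by simp_all
      have "(?E ^^ (m + m')) (\<lambda>p. F e p + (\<Sum>e\<in>S. F e p)) = (\<lambda>_. 0)"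
        by (subst E.Dn_add) (auto simp: z intro: coord_algebra_sum graded_in[OF F(2)])
      then show ?case using insert by (intro exI[of _ "m + m'"]) simp
    qed
    then show ?thesis using F(3) by simp
  qed
  have "\<exists>f\<in>A. ?E f \<noteq> (\<lambda>_. 0)" using kL(1) by (simp add: L_def)
  then show ?thesis
    using that[OF component_derivation nilE _ graded_map_normalizes[OF component_derivation component_graded]
        component_normalizes D_below] by blast
qed

end

subsection \<open>The trinomial hypersurface\<close>

text \<open>Values lie in an arbitrary commutative monoid, because p is sometimes a point of X and
  sometimes a family of polynomials that describes a curve.\<close>

definition mval :: "('v \<Rightarrow> nat) \<Rightarrow> 'v set \<Rightarrow> ('v \<Rightarrow> 'b::comm_monoid_mult) \<Rightarrow> 'b"
  where "mval e S p = (\<Prod>v\<in>S. p v ^ e v)"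

lemma mval_cong: "(\<And>v. v \<in> S \<Longrightarrow> p v = q v) \<Longrightarrow> mval e S p = mval e S q"
  by (simp add: mval_def)

lemma mval_mult: "mval e S (\<lambda>v. p v * q v) = mval e S p * mval e S q"
  by (simp add: mval_def power_mult_distrib prod.distrib)

lemma mval_nonzero: "(\<And>v. v \<in> S \<Longrightarrow> p v \<noteq> 0) \<Longrightarrow> mval e S p \<noteq> (0 :: 'b::idom)"
  by (cases "finite S") (auto simp: mval_def)

lemma mval_eq_0_iff:
  "finite S \<Longrightarrow> (\<And>v. v \<in> S \<Longrightarrow> e v > 0) \<Longrightarrow> mval e S p = (0 :: 'b::idom) \<longleftrightarrow> (\<exists>v\<in>S. p v = 0)"
  by (fastforce simp: mval_def)

lemma poly_mval: "poly (mval e S Q) t = mval e S (\<lambda>v. poly (Q v) t)"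
  by (simp add: mval_def poly_prod)

lemma mval_remove: "finite S \<Longrightarrow> v \<in> S \<Longrightarrow> mval e S p = p v ^ e v * mval e (S - {v}) p"
  by (simp add: mval_def prod.remove)

lemma mval_poly_function: "finite S \<Longrightarrow> S \<subseteq> V \<Longrightarrow> mval e S \<in> poly_functions V"
  unfolding mval_def by (intro poly_functions_prod poly_functions_power) (auto intro: poly_functions.coord)

lemma mval_const_poly: "mval e S (\<lambda>v. [:q v:]) = [:mval e S q:]"
  by (induction S rule: infinite_finite_induct) (auto simp: mval_def poly_const_pow mult.commute)

lemma mval_monom: "mval e S (\<lambda>v. monom 1 c) = (monom 1 (c * sum e S) :: 'a::comm_semiring_1 poly)"
  by (induction S rule: infinite_finite_induct)
    (auto simp: mval_def mult_monom monom_power algebra_simps one_pCons monom_0)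

text \<open>\<open>V0\<close>, \<open>V1\<close> and \<open>W\<close> index x, y and w of the
  overview. \<open>V0\<close> may be empty, and the first term is then the empty product 1. The
  parity condition on the exponents is kept out of the locale and assumed where it is used.\<close>

locale trinomial_hypersurface =
  fixes V0 V1 W :: "'v set" and z :: 'v and e :: "'v \<Rightarrow> nat"
    and X :: "('v \<Rightarrow> 'a::{alg_closed_field, field_char_0}) set"
  assumes fin: "finite V0" "finite V1" "finite W"
    and disj: "V0 \<inter> V1 = {}" "V0 \<inter> W = {}" "V1 \<inter> W = {}" "z \<notin> V0" "z \<notin> V1" "z \<notin> W"
    and V1_ne: "V1 \<noteq> {}"
    and e2: "\<And>v. v \<in> V0 \<union> V1 \<union> W \<Longrightarrow> e v \<ge> 2"
    and X_eq: "X = {p \<in> insert z (V0 \<union> V1 \<union> W) \<rightarrow>\<^sub>E UNIV. mval e V0 p + mval e V1 p + p z * mval e W p = 0}"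
begin

abbreviation "I \<equiv> insert z (V0 \<union> V1 \<union> W)"

sublocale coordinate_ring I X .

lemma finI: "finite I"
  using fin by simp

lemma subI: "V0 \<subseteq> I" "V1 \<subseteq> I" "W \<subseteq> I"
  by auto

lemma e_pos: "v \<in> V0 \<union> V1 \<union> W \<Longrightarrow> e v > 0"
  using e2[of v] by simp

lemma in_X: "p \<in> X \<longleftrightarrow> p \<in> extensional I \<and> mval e V0 p + mval e V1 p + p z * mval e W p = 0"
  by (auto simp: X_eq PiE_def)

lemma restrict_in_X:
  "(\<lambda>v\<in>I. p v) \<in> X \<longleftrightarrow> mval e V0 p + mval e V1 p + p z * mval e W p = 0"
proof -
  have *: "mval e S (\<lambda>v\<in>I. p v) = mval e S p" if "S \<subseteq> I" for S
    using that by (intro mval_cong) auto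
  show ?thesis by (simp add: in_X *[OF subI(1)] *[OF subI(2)] *[OF subI(3)])
qed

lemma X_ext: "X \<subseteq> I \<rightarrow>\<^sub>E UNIV"
  by (auto simp: X_eq)

lemma X_closed: "\<exists>E\<subseteq>poly_functions I. X = {p \<in> I \<rightarrow>\<^sub>E UNIV. \<forall>F\<in>E. F p = 0}"
proof (intro exI conjI)
  show "{\<lambda>p. mval e V0 p + mval e V1 p + p z * mval e W p} \<subseteq> poly_functions I"
    using fin by (auto intro!: poly_functions.intros mval_poly_function)
qed (simp add: X_eq)

text \<open>Q is a point of the hypersurface over K[t] with value q at t = 0. For all but finitely
  many t its coordinates vanish exactly where the polynomials \<open>Q v\<close> are zero, so
  vanishing of f on that stratum is carried to q.\<close>

lemma curve_limit:
  assumes f: "f \<in> A" and q: "q \<in> X"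
    and Q: "mval e V0 Q + mval e V1 Q + Q z * mval e W Q = 0" "\<And>v. v \<in> I \<Longrightarrow> poly (Q v) 0 = q v"
    and van: "\<And>p. p \<in> X \<Longrightarrow> (\<And>v. v \<in> I \<Longrightarrow> p v = 0 \<longleftrightarrow> Q v = 0) \<Longrightarrow> f p = 0"
  shows "f q = 0"
proof -
  define c where "c t = (\<lambda>v\<in>I. poly (Q v) t)" for t
  define B where "B = (\<Union>v\<in>{v\<in>I. Q v \<noteq> 0}. {t. poly (Q v) t = 0})"
  have B: "finite B" using finI by (auto simp: B_def poly_roots_finite)
  have cX: "c t \<in> X" for t
  proof -
    have "poly (mval e V0 Q + mval e V1 Q + Q z * mval e W Q) t = 0" using Q(1) by simp
    then show ?thesis by (simp add: c_def restrict_in_X poly_mval)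
  qed
  have "f (c 0) = 0"
  proof (rule coord_algebra_curve_limit[OF f B cX])
    show "\<exists>R. \<forall>t. c t v = poly R t" if "v \<in> I" for v
      using that by (auto simp: c_def)
    show "f (c t) = 0" if "t \<notin> B" for t
      by (rule van[OF cX]) (use that in \<open>auto simp: c_def B_def\<close>)
  qed
  moreover have "c 0 = q"
    using q Q(2) by (auto simp: c_def in_X extensional_def)
  ultimately show ?thesis by simp
qed

section \<open>Dense subsets of the hypersurface and of its divisors w = 0\<close>

definition X0 :: "('v \<Rightarrow> 'a) set"
  where "X0 = {p \<in> X. \<forall>v\<in>I. p v \<noteq> 0}"

lemma X0_in: "p \<in> X0 \<Longrightarrow> p \<in> X"
  and X0_nonzero: "p \<in> X0 \<Longrightarrow> v \<in> I \<Longrightarrow> p v \<noteq> 0"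
  by (auto simp: X0_def)

text \<open>Where P is nonzero, z is determined by the other coordinates: move every x and y by t,
  keep w and solve for z.\<close>

lemma dense_X0_U:
  assumes f: "f \<in> A" "\<And>p. p \<in> X0 \<Longrightarrow> f p = 0" and q: "q \<in> X" "mval e W q \<noteq> 0"
  shows "f q = 0"
proof -
  define R where "R v = (if v \<in> W then [:q v:] else [:q v, 1:])" for v
  define h where "h = mval e V0 R + mval e V1 R"
  define Q where "Q = R(z := smult (- inverse (mval e W q)) h)"
  have QR: "mval e S Q = mval e S R" if "S \<subseteq> I" "z \<notin> S" for S
    using that by (intro mval_cong) (auto simp: Q_def)
  have "lead_coeff (mval e S R) = 1" if "S \<inter> W = {}" for S
    using that unfolding mval_def lead_coeff_prod lead_coeff_power
    by (intro prod.neutral) (auto simp: R_def)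
  then have lc: "lead_coeff (mval e V0 R) = 1" "lead_coeff (mval e V1 R) = 1" using disj by auto
  \<comment> \<open>Both monomials are monic in t, also when \<open>V0\<close> is empty, so they
    cannot cancel. Hence z is not identically zero on the curve.\<close>
  have h0: "h \<noteq> 0"
  proof
    assume "h = 0"
    then have "mval e V0 R = - mval e V1 R" by (simp add: h_def eq_neg_iff_add_eq_0)
    then have "(1::'a) = - 1" using lc by (metis lead_coeff_minus)
    then show False by simp
  qed
  have "mval e W R = [:mval e W q:]"
    unfolding mval_const_poly[symmetric] by (intro mval_cong) (auto simp: R_def)
  then have WR: "mval e W Q = [:mval e W q:]" using QR[OF subI(3) disj(6)] by simp
  have R0: "mval e S (\<lambda>v. poly (R v) 0) = mval e S q" for S
    by (intro mval_cong) (auto simp: R_def)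
  show ?thesis
  proof (rule curve_limit[OF f(1) q(1)])
    show "mval e V0 Q + mval e V1 Q + Q z * mval e W Q = 0"
      using QR[OF subI(1) disj(4)] QR[OF subI(2) disj(5)] q(2) unfolding WR by (simp add: Q_def h_def)
    show "poly (Q v) 0 = q v" if "v \<in> I" for v
    proof (cases "v = z")
      case True
      have "mval e V0 q + mval e V1 q = - (q z * mval e W q)"
        using q(1) by (simp add: in_X eq_neg_iff_add_eq_0)
      then show ?thesis using True q(2) by (simp add: Q_def h_def poly_mval R0)
    qed (auto simp: Q_def R_def)
    show "f p = 0" if p: "p \<in> X" "\<And>v. v \<in> I \<Longrightarrow> p v = 0 \<longleftrightarrow> Q v = 0" for p
    proof (rule f(2))
      have "q v \<noteq> 0" if "v \<in> W" for v using q(2) that fin mval_eq_0_iff[of W e q] e_pos by auto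
      then have "Q v \<noteq> 0" if "v \<in> I" for v
        using that h0 q(2) by (auto simp: Q_def R_def)
      then show "p \<in> X0" using p by (auto simp: X0_def)
    qed
  qed
qed

text \<open>The expansion in P around a. Of the cofactor R only the value at t = 0 matters, where P
  vanishes and the linear coefficient is left.\<close>

lemma power_perturbation:
  fixes P :: "'b::comm_ring_1 poly"
  assumes "poly P 0 = 0"
  shows "\<exists>R. ([:a:] + smult \<eta> P) ^ k = [:a ^ k:] + P * R \<and> poly R 0 = of_nat k * a ^ (k - 1) * \<eta>"
proof (induction k)
  case 0
  show ?case by (rule exI[of _ 0]) simp
next
  case (Suc k)
  then obtain R where R: "([:a:] + smult \<eta> P) ^ k = [:a ^ k:] + P * R"
    "poly R 0 = of_nat k * a ^ (k - 1) * \<eta>" by blast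
  have sm: "smult c r = [:c:] * r" for c and r :: "'b poly" by simp
  have "([:a:] + smult \<eta> P) ^ Suc k = ([:a:] + [:\<eta>:] * P) * ([:a ^ k:] + P * R)"
    unfolding power_Suc R(1) by (simp only: sm)
  also have "\<dots> = [:a:] * [:a ^ k:] + P * ([:a:] * R + [:\<eta>:] * [:a ^ k:] + [:\<eta>:] * (P * R))"
    by (simp only: algebra_simps)
  also have "[:a:] * [:a ^ k:] = [:a ^ Suc k:]" by simp
  finally have "([:a:] + smult \<eta> P) ^ Suc k = [:a ^ Suc k:] + P * ([:a:] * R + [:\<eta>:] * [:a ^ k:] + [:\<eta>:] * (P * R))" .
  moreover have "poly ([:a:] * R + [:\<eta>:] * [:a ^ k:] + [:\<eta>:] * (P * R)) 0 = of_nat (Suc k) * a ^ (Suc k - 1) * \<eta>"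
    using assms R(2) by (cases k) (simp_all add: algebra_simps)
  ultimately show ?case by blast
qed

text \<open>A point with w as its only zero coordinate is a limit of points with P nonzero. Put w =
  t and move one y by \<eta> P; the change of b is divisible by P, and z absorbs the
  quotient.\<close>

lemma dense_U_divisor:
  assumes f: "f \<in> A" "\<And>p. p \<in> X \<Longrightarrow> mval e W p \<noteq> 0 \<Longrightarrow> f p = 0"
    and w: "w \<in> W" and q: "q \<in> X" "q w = 0" "\<And>v. v \<in> I \<Longrightarrow> v \<noteq> w \<Longrightarrow> q v \<noteq> 0"
  shows "f q = 0"
proof -
  obtain y where y: "y \<in> V1" using V1_ne by blast
  have wW: "mval e W q = 0" using w fin q(2) e_pos by (subst mval_eq_0_iff) auto
  define C where "C = (\<lambda>v. [:q v:])(w := [:0, 1:])"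
  define P where "P = mval e W C"
  have P0: "poly P 0 = 0"
    using w fin e_pos by (simp add: P_def poly_mval, subst mval_eq_0_iff) (auto simp: C_def)
  define b where "b = mval e (V1 - {y}) q"
  have yw: "y \<noteq> w" "y \<noteq> z" "w \<noteq> z" "y \<notin> W" "y \<notin> V0" "w \<notin> V0" "w \<notin> V1" using y w disj by auto
  have b0: "b \<noteq> 0" unfolding b_def using q(3) yw by (intro mval_nonzero) auto
  have y0: "q y \<noteq> 0" using q(3)[of y] y yw by auto
  define d where "d = b * (of_nat (e y) * q y ^ (e y - 1))"
  have d0: "d \<noteq> 0" using b0 y0 e_pos[of y] y by (simp add: d_def)
  \<comment> \<open>Chosen so that z has the value \<open>q z\<close> at t = 0: there z is -d
    \<eta>, where d is the derivative of b with respect to y, nonzero in characteristic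
    zero.\<close>
  define \<eta> where "\<eta> = - q z / d"
  obtain R where R: "([:q y:] + smult \<eta> P) ^ e y = [:q y ^ e y:] + P * R"
    "poly R 0 = of_nat (e y) * q y ^ (e y - 1) * \<eta>" using power_perturbation[OF P0] by blast
  define Q where "Q = C(y := [:q y:] + smult \<eta> P, z := - ([:b:] * R))"
  have Q0: "mval e V0 Q = [:mval e V0 q:]"
    unfolding mval_const_poly[symmetric] using yw disj by (intro mval_cong) (auto simp: Q_def C_def)
  have "mval e (V1 - {y}) Q = [:b:]"
    unfolding b_def mval_const_poly[symmetric] using yw disj by (intro mval_cong) (auto simp: Q_def C_def)
  then have Q1: "mval e V1 Q = ([:q y ^ e y:] + P * R) * [:b:]"
    using mval_remove[OF fin(2) y, of e Q] yw R(1) by (simp add: Q_def)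
  have Q2: "mval e W Q = P"
    unfolding P_def using yw disj by (intro mval_cong) (auto simp: Q_def)
  have ab: "mval e V0 q + q y ^ e y * b = 0"
    using q(1) wW mval_remove[OF fin(2) y, of e q] by (simp add: in_X b_def)
  show ?thesis
  proof (rule curve_limit[OF f(1) q(1)])
    have "mval e V0 Q + mval e V1 Q + Q z * mval e W Q = [:mval e V0 q:] + [:q y ^ e y:] * [:b:]"
      unfolding Q0 Q1 Q2 by (simp add: Q_def algebra_simps)
    also have "\<dots> = [:mval e V0 q + q y ^ e y * b:]" by (simp add: mult.commute)
    finally show "mval e V0 Q + mval e V1 Q + Q z * mval e W Q = 0" using ab by simp
    show "poly (Q v) 0 = q v" if "v \<in> I" for v
    proof (cases "v = z")
      case True
      have "poly (Q z) 0 = - (d * \<eta>)" using R(2) by (simp add: Q_def d_def)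
      then show ?thesis using True d0 by (simp add: \<eta>_def)
    qed (use P0 q(2) in \<open>auto simp: Q_def C_def\<close>)
    show "f p = 0" if p: "p \<in> X" "\<And>v. v \<in> I \<Longrightarrow> p v = 0 \<longleftrightarrow> Q v = 0" for p
    proof (rule f(2)[OF p(1)])
      have "Q v \<noteq> 0" if "v \<in> W" for v
        using that q(3)[of v] yw disj by (auto simp: Q_def C_def)
      then show "mval e W p \<noteq> 0" using p(2) by (intro mval_nonzero) auto
    qed
  qed
qed

text \<open>On w = 0 the equation reads a + b = 0, while z and the other w are free. If a and b are
  nonzero at q, all x and y are, and only the free coordinates have to be moved. If both are zero,
  the vanishing x and y are replaced by multiples of powers of t for which a and b still
  cancel.\<close>

lemma dense_divisor:
  assumes f: "f \<in> A" and w: "w \<in> W"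
    and van: "\<And>p. p \<in> X \<Longrightarrow> p w = 0 \<Longrightarrow> (\<And>v. v \<in> I \<Longrightarrow> v \<noteq> w \<Longrightarrow> p v \<noteq> 0) \<Longrightarrow> f p = 0"
    and q: "q \<in> X" "q w = 0"
  shows "f q = 0"
proof -
  have W0: "mval e W p = 0" if "p w = 0" for p :: "'v \<Rightarrow> 'b::idom"
    using w fin that e_pos by (subst mval_eq_0_iff) auto
  have ab: "mval e V0 q + mval e V1 q = 0" using q W0[of q] by (simp add: in_X)
  have wz: "w \<noteq> z" "w \<notin> V0" "w \<notin> V1" using w disj by auto
  show ?thesis
  proof (cases "mval e V0 q = 0")
    case False
    define Q where "Q v = (if v = w then 0 else if v \<in> V0 \<union> V1 then [:q v:] else [:q v, 1:])" for v
    have "mval e V1 q \<noteq> 0" using False ab by auto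
    then have qn: "q v \<noteq> 0" if "v \<in> V0 \<union> V1" for v
      using that False fin mval_eq_0_iff[of V0 e q] mval_eq_0_iff[of V1 e q] e_pos by auto
    have "mval e V0 Q = [:mval e V0 q:]" "mval e V1 Q = [:mval e V1 q:]"
      unfolding mval_const_poly[symmetric] using wz by (auto intro!: mval_cong simp: Q_def)
    then have "mval e V0 Q + mval e V1 Q + Q z * mval e W Q = 0"
      using ab W0[of Q] by (simp add: Q_def)
    then show ?thesis
    proof (rule curve_limit[OF f q(1)])
      show "poly (Q v) 0 = q v" if "v \<in> I" for v using q(2) by (auto simp: Q_def)
      show "f p = 0" if p: "p \<in> X" "\<And>v. v \<in> I \<Longrightarrow> p v = 0 \<longleftrightarrow> Q v = 0" for p
        by (rule van[OF p(1)]) (use p(2) w qn in \<open>auto simp: Q_def\<close>)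
    qed
  next
    case True
    then have b0: "mval e V1 q = 0" using ab by simp
    define Z0 where "Z0 = {v\<in>V0. q v = 0}"
    define Z1 where "Z1 = {v\<in>V1. q v = 0}"
    have Z: "finite Z0" "finite Z1" "Z0 \<subseteq> V0" "Z1 \<subseteq> V1" using fin by (auto simp: Z0_def Z1_def)
    obtain x where x: "x \<in> Z0" using True mval_eq_0_iff[OF fin(1), of e q] e_pos by (auto simp: Z0_def)
    obtain y where y: "y \<in> Z1" using b0 mval_eq_0_iff[OF fin(2), of e q] e_pos by (auto simp: Z1_def)
    \<comment> \<open>The zero coordinates in \<open>V0\<close> become multiples of t^\<beta> and
      those in \<open>V1\<close> become t^\<alpha>, so both monomials acquire the same degree
      \<alpha> \<beta> in t.\<close>
    define \<alpha> where "\<alpha> = sum e Z0"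
    define \<beta> where "\<beta> = sum e Z1"
    have pos: "\<alpha> > 0" "\<beta> > 0"
      using x y Z e_pos[of x] e_pos[of y] member_le_sum[of x Z0 e] member_le_sum[of y Z1 e]
      by (auto simp: \<alpha>_def \<beta>_def)
    define k0 where "k0 = mval e (V0 - Z0) q"
    define k1 where "k1 = mval e (V1 - Z1) q"
    have k: "k0 \<noteq> 0" "k1 \<noteq> 0" unfolding k0_def k1_def by (auto intro!: mval_nonzero simp: Z0_def Z1_def)
    have ex: "e x > 0" using e_pos[of x] x Z by blast
    \<comment> \<open>\<gamma> rescales the single coordinate x so that the coefficients of the two
      monomials cancel.\<close>
    then obtain \<gamma> where \<gamma>: "\<gamma> ^ e x = - k1 / k0"
      using nth_root_exists by blast
    have \<gamma>0: "\<gamma> \<noteq> 0" using \<gamma> k ex by (auto simp: power_0_left)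
    define g where "g v = (if v = x then \<gamma> else 1)" for v
    define Q where "Q v = (if v = w then 0 else if v \<in> Z0 then monom (g v) \<beta> else if v \<in> Z1 then monom 1 \<alpha>
      else if v \<in> V0 \<union> V1 then [:q v:] else [:q v, 1:])" for v
    have split0: "mval e S p = mval e (S - Z) p * mval e Z p" if "finite S" "Z \<subseteq> S" for S Z and p :: "'v \<Rightarrow> 'a poly"
      unfolding mval_def by (rule prod.subset_diff[OF that(2,1)])
    have "mval e (V0 - Z0) Q = [:k0:]" "mval e (V1 - Z1) Q = [:k1:]"
      unfolding k0_def k1_def mval_const_poly[symmetric] using wz Z disj by (auto intro!: mval_cong simp: Q_def)
    moreover have "mval e Z0 Q = monom (\<gamma> ^ e x) (\<alpha> * \<beta>)"
    proof -
      have "mval e Z0 Q = mval e Z0 (\<lambda>v. monom (g v) \<beta>)"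
        using wz Z by (intro mval_cong) (auto simp: Q_def)
      also have "\<dots> = mval e Z0 (\<lambda>v. [:g v:]) * mval e Z0 (\<lambda>v. monom 1 \<beta>)"
        unfolding mval_mult[symmetric] by (simp add: smult_monom)
      also have "mval e Z0 (\<lambda>v. [:g v:]) = [:\<gamma> ^ e x:]"
        unfolding mval_const_poly using mval_remove[OF Z(1) x, of e g]
        by (simp add: g_def mval_def)
      also have "mval e Z0 (\<lambda>v. monom 1 \<beta>) = (monom 1 (\<alpha> * \<beta>) :: 'a poly)"
        by (simp add: mval_monom \<alpha>_def mult.commute)
      finally show ?thesis by (simp add: smult_monom)
    qed
    moreover have "mval e Z1 Q = monom 1 (\<alpha> * \<beta>)"
    proof -
      have "mval e Z1 Q = mval e Z1 (\<lambda>v. monom 1 \<alpha>)"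
        using wz Z disj by (intro mval_cong) (auto simp: Q_def)
      then show ?thesis by (simp add: mval_monom \<beta>_def)
    qed
    ultimately have "mval e V0 Q = monom (k0 * \<gamma> ^ e x) (\<alpha> * \<beta>)" "mval e V1 Q = monom k1 (\<alpha> * \<beta>)"
      using split0[OF fin(1) Z(3), of Q] split0[OF fin(2) Z(4), of Q] by (simp_all add: smult_monom)
    then have "mval e V0 Q + mval e V1 Q + Q z * mval e W Q = 0"
      using W0[of Q] k by (simp add: Q_def \<gamma> add_monom)
    then show ?thesis
    proof (rule curve_limit[OF f q(1)])
      show "poly (Q v) 0 = q v" if "v \<in> I" for v
        using q(2) pos Z by (auto simp: Q_def poly_monom Z0_def Z1_def power_0_left)
      show "f p = 0" if p: "p \<in> X" "\<And>v. v \<in> I \<Longrightarrow> p v = 0 \<longleftrightarrow> Q v = 0" for p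
        by (rule van[OF p(1)]) (use p(2) w \<gamma>0 in \<open>auto simp: Q_def Z0_def Z1_def g_def\<close>)
    qed
  qed
qed

text \<open>A point with P = 0 lies on some divisor w = 0. The general points of that divisor are
  limits of points with P nonzero, and its other points are limits of general ones.\<close>

lemma dense_U:
  assumes f: "f \<in> A" "\<And>p. p \<in> X \<Longrightarrow> mval e W p \<noteq> 0 \<Longrightarrow> f p = 0"
  shows "f = (\<lambda>_. 0)"
proof
  fix q show "f q = 0"
  proof (cases "q \<in> X")
    case True
    show ?thesis
    proof (cases "mval e W q = 0")
      case z: True
      then obtain w where w: "w \<in> W" "q w = 0" using fin e_pos by (auto simp: mval_eq_0_iff)
      show ?thesis
        by (rule dense_divisor[OF f(1) w(1) _ True w(2)]) (rule dense_U_divisor[OF f w(1)])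
    qed (use f True in auto)
  next
    case False
    then show ?thesis by (rule coord_algebra_zero_outside[OF f(1)])
  qed
qed

lemma dense_X0:
  assumes f: "f \<in> A" "\<And>p. p \<in> X0 \<Longrightarrow> f p = 0"
  shows "f = (\<lambda>_. 0)"
  by (rule dense_U[OF f(1)]) (rule dense_X0_U[OF f])

end

subsection \<open>Polynomial curves with affine symmetries\<close>

lemma card_simple_roots:
  fixes p :: "'a::alg_closed_field poly"
  assumes "p \<noteq> 0" "\<And>r. poly p r = 0 \<Longrightarrow> poly (pderiv p) r \<noteq> 0"
  shows "card {r. poly p r = 0} = degree p"
  using assms
proof (induction "degree p" arbitrary: p)
  case 0
  then obtain c where "p = [:c:]" by (metis degree_eq_zeroE)
  then show ?case using 0 by simp
next
  case (Suc k)
  then obtain a where a: "poly p a = 0" using alg_closed_imp_poly_has_root[of p] by auto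
  then obtain q where q: "p = [:-a, 1:] * q" by (auto simp: poly_eq_0_iff_dvd)
  have q0: "q \<noteq> 0" using q Suc.prems by auto
  have dp: "poly (pderiv p) r = (r - a) * poly (pderiv q) r + poly q r" for r
    unfolding q pderiv_mult by (simp add: pderiv_pCons algebra_simps)
  have qa: "poly q a \<noteq> 0" using Suc.prems(2)[OF a] dp[of a] by simp
  have deg: "degree p = Suc (degree q)" unfolding q using q0 by (subst degree_mult_eq) auto
  have "card {r. poly q r = 0} = degree q"
  proof (rule Suc.hyps(1))
    show "poly (pderiv q) r \<noteq> 0" if "poly q r = 0" for r
      using Suc.prems(2)[of r] dp[of r] that by (auto simp: q)
  qed (use Suc.hyps deg q0 in auto)
  moreover have "{r. poly p r = 0} = insert a {r. poly q r = 0}" by (auto simp: q)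
  ultimately show ?case using qa deg q0 by (simp add: poly_roots_finite)
qed

lemma only_root_zero_monom:
  fixes p :: "'a::alg_closed_field poly"
  assumes "p \<noteq> 0" "\<And>r. poly p r = 0 \<Longrightarrow> r = 0"
  shows "\<exists>c k. c \<noteq> 0 \<and> p = monom c k"
  using assms
proof (induction "degree p" arbitrary: p)
  case 0
  then obtain c where c: "p = [:c:]" by (metis degree_eq_zeroE)
  then have "p = monom c 0" by (simp add: monom_0)
  then show ?case using 0 c by auto
next
  case (Suc k)
  have "degree p > 0" using Suc.hyps(2) by simp
  then obtain a where a: "poly p a = 0" using alg_closed_imp_poly_has_root by blast
  then have "poly p 0 = 0" using Suc.prems(2) by auto
  then obtain q where q: "p = [:0, 1:] * q" by (auto simp: poly_eq_0_iff_dvd)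
  have q0: "q \<noteq> 0" using q Suc.prems by auto
  have "degree p = Suc (degree q)" unfolding q using q0 by (subst degree_mult_eq) auto
  then have "k = degree q" using Suc.hyps(2) by simp
  moreover have "r = 0" if "poly q r = 0" for r using Suc.prems(2)[of r] that q by simp
  ultimately obtain c k where "c \<noteq> 0" "q = monom c k" using Suc.hyps(1)[of q] q0 by blast
  then have "p = monom c (Suc k)" by (simp add: q monom_Suc)
  then show ?case using \<open>c \<noteq> 0\<close> by auto
qed

lemma pcompose_power: "pcompose (p ^ k) q = pcompose p q ^ k"
  by (induction k) (simp_all add: pcompose_1 pcompose_mult)

section \<open>Wronskians and relations between monomials\<close>

lemma wronskian_proportional:
  fixes p q :: "'a::field poly"
  assumes "smult a p = smult b q" "a \<noteq> 0 \<or> b \<noteq> 0"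
  shows "pderiv p * q = p * pderiv q"
proof -
  have *: "pderiv p * q = p * pderiv q" if "smult a p = smult b q" "a \<noteq> 0" for a b and p q :: "'a poly"
  proof -
    have "p = smult (b / a) q"
      using that by (metis (no_types) left_inverse mult.commute divide_inverse smult_1_left smult_smult)
    then show ?thesis by (simp add: pderiv_smult mult.commute)
  qed
  show ?thesis using assms *[of a p b q] *[of b q a p] by (auto simp: mult.commute)
qed

text \<open>Subtract the multiple of q that makes the difference r vanish at a point t with q(t)
  nonzero. The relation persists for r and q, but differentiation lowers the order of r at t by one,
  so r must be zero.\<close>

lemma wronskian_zero_imp_proportional:
  fixes p q :: "'a::field_char_0 poly"
  assumes "pderiv p * q = p * pderiv q" "q \<noteq> 0"
  shows "\<exists>c. p = smult c q"
proof -
  obtain t where t: "poly q t \<noteq> 0" using assms(2) poly_all_0_iff_0 by blast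
  define c where "c = poly p t / poly q t"
  define r where "r = p - smult c q"
  have rt: "poly r t = 0" using t by (simp add: r_def c_def)
  have w: "pderiv r * q = r * pderiv q"
    using assms(1) by (simp add: r_def pderiv_diff pderiv_smult algebra_simps)
  have "r = 0"
  proof (rule ccontr)
    assume r0: "r \<noteq> 0"
    have "Polynomial.order t r \<noteq> 0" using rt r0 by (simp add: order_root)
    moreover have dr: "pderiv r \<noteq> 0"
    proof
      assume "pderiv r = 0"
      then obtain c where "r = [:c:]" by (metis degree_eq_zeroE pderiv_eq_0_iff)
      then show False using rt r0 by simp
    qed
    ultimately have o: "Polynomial.order t r = Suc (Polynomial.order t (pderiv r))"
      using rt r0 by (intro order_pderiv)
    have nz: "pderiv r * q \<noteq> 0" using dr assms(2) by simp
    then have nz': "r * pderiv q \<noteq> 0" using w by simp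
    have "Polynomial.order t (pderiv r) = Polynomial.order t (pderiv r * q)" using t nz by (simp add: order_mult order_0I)
    also have "\<dots> = Polynomial.order t (r * pderiv q)" using w by simp
    also have "\<dots> \<ge> Polynomial.order t r" using nz' by (simp add: order_mult)
    finally show False using o by simp
  qed
  then show ?thesis by (auto simp: r_def)
qed

lemma wronskian_power:
  fixes p q :: "'a::field_char_0 poly"
  assumes "pderiv p * q = p * pderiv q"
  shows "pderiv (p ^ k) * q ^ k = p ^ k * pderiv (q ^ k)"
proof (cases k)
  case (Suc m)
  have "pderiv (p ^ k) * q ^ k = smult (of_nat k) (p ^ m * q ^ m * (pderiv p * q))"
    unfolding Suc pderiv_power_Suc by (simp add: mult_ac del: of_nat_Suc)
  also have "\<dots> = p ^ k * pderiv (q ^ k)"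
    unfolding assms Suc pderiv_power_Suc by (simp add: mult_ac del: of_nat_Suc)
  finally show ?thesis .
qed simp

lemma mval_power:
  fixes p :: "'v \<Rightarrow> 'b::comm_semiring_1"
  shows "mval (\<lambda>v. E v * d) S p = mval E S p ^ d"
  by (simp add: mval_def power_mult prod_power_distrib)

lemma mval_monomials:
  fixes N :: "'v \<Rightarrow> 'a::idom poly"
  assumes "\<And>v. v \<in> S \<Longrightarrow> \<exists>c k. c \<noteq> 0 \<and> N v = monom c k"
  shows "\<exists>c k. c \<noteq> 0 \<and> mval e S N = monom c k"
  using assms
proof (induction S rule: infinite_finite_induct)
  case (insert v S)
  obtain c k where c: "c \<noteq> 0" "mval e S N = monom c k" using insert by auto
  obtain c' k' where c': "c' \<noteq> 0" "N v = monom c' k'" using insert.prems[of v] by auto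
  have "mval e (insert v S) N = monom (c' ^ e v * c) (k' * e v + k)"
    using insert(1,2) c c' by (simp add: mval_def monom_power mult_monom)
  then show ?case using c c' by (intro exI[of _ "c' ^ e v * c"] exI[of _ "k' * e v + k"]) auto
qed (rule exI[of _ 1], rule exI[of _ 0], simp add: mval_def monom_0 one_pCons)+

text \<open>If the first two degrees differed, each of these terms would have to be cancelled by the
  single third monomial. Equal degrees make the two monomials proportional.\<close>

lemma monomial_trinomial_wronskian:
  fixes a b c :: "'a::field_char_0"
  assumes "monom a i ^ d + monom b j ^ d + monom c k = 0" "a \<noteq> 0" "b \<noteq> 0" "c \<noteq> 0" "d > 0"
  shows "pderiv (monom a i) * monom b j = monom a i * pderiv (monom b j)"
proof -
  have h: "(if i * d = m then a ^ d else 0) + (if j * d = m then b ^ d else 0) + (if k = m then c else 0) = 0" for m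
    using arg_cong[OF assms(1), of "\<lambda>p. coeff p m"] by (simp add: monom_power)
  have "i * d = j * d"
  proof (rule ccontr)
    assume ne: "i * d \<noteq> j * d"
    have "i * d = k" using h[of "i * d"] ne assms(2,5) by (cases "i * d = k") auto
    moreover have "j * d = k" using h[of "j * d"] ne assms(3,5) by (cases "j * d = k") auto
    ultimately show False using ne by simp
  qed
  then have "i = j" using assms by simp
  then have "smult b (monom a i) = smult a (monom b j)" by (simp add: smult_monom mult.commute)
  then show ?thesis using assms by (intro wronskian_proportional) auto
qed

lemma mval_double_root:
  fixes N :: "'v \<Rightarrow> 'a::field poly"
  assumes "\<And>v. v \<in> S \<Longrightarrow> e v \<ge> 2" "poly (mval e S N) r = 0"
  shows "poly (pderiv (mval e S N)) r = 0"
proof -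
  have fS: "finite S" using assms(2) by (cases "finite S") (auto simp: mval_def)
  then obtain v where v: "v \<in> S" "poly (N v) r = 0"
    using assms(2) by (auto simp: mval_def poly_prod)
  obtain k where k: "e v = Suc (Suc k)" using assms(1)[OF v(1)] by (metis Suc_le_D numeral_2_eq_2 Suc_le_mono)
  have "mval e S N = N v ^ Suc (Suc k) * mval e (S - {v}) N" using mval_remove[OF fS v(1), of e N] k by simp
  then show ?thesis using v(2) by (simp only: pderiv_mult pderiv_power_Suc) simp
qed

text \<open>The map (\<alpha> : \<beta>) to the projective line has degree \<delta>, the larger of
  the two degrees, so a general fibre has \<delta> points. By \<open>sym\<close> they are multiples
  \<chi> s1 with factors \<chi> preserving \<alpha> and \<beta>. A term of degree i > 0 in \<alpha>
  or \<beta> forces \<chi>^i = 1, which has at most i solutions, so no i strictly between 0 and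
  \<delta> occurs.\<close>

lemma binomial_of_symmetry:
  fixes \<alpha> \<beta> Q :: "'a::{alg_closed_field, field_char_0} poly"
  assumes Q: "Q \<noteq> 0" and cop: "\<And>s. \<not> (poly \<alpha> s = 0 \<and> poly \<beta> s = 0)"
    and wr: "pderiv \<alpha> * \<beta> \<noteq> \<alpha> * pderiv \<beta>"
    and sym: "\<And>s1 s2. poly Q s1 \<noteq> 0 \<Longrightarrow> poly Q s2 \<noteq> 0 \<Longrightarrow> poly \<alpha> s1 * poly \<beta> s2 = poly \<alpha> s2 * poly \<beta> s1 \<Longrightarrow>
      \<exists>\<chi>. s2 = \<chi> * s1 \<and> (\<forall>s. poly \<alpha> (\<chi> * s) = poly \<alpha> s) \<and> (\<forall>s. poly \<beta> (\<chi> * s) = poly \<beta> s)"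
  shows "\<exists>\<delta> a0 a1 b0 b1. \<delta> > 0 \<and> \<alpha> = [:a0:] + monom a1 \<delta> \<and> \<beta> = [:b0:] + monom b1 \<delta> \<and> (a1 \<noteq> 0 \<or> b1 \<noteq> 0)"
proof -
  define \<delta> where "\<delta> = max (degree \<alpha>) (degree \<beta>)"
  have \<delta>0: "\<delta> > 0"
  proof (rule ccontr)
    assume "\<not> \<delta> > 0"
    then have "degree \<alpha> = 0" "degree \<beta> = 0" by (auto simp: \<delta>_def)
    then show False using wr by (metis mult_zero_left mult_zero_right pderiv_eq_0_iff)
  qed
  have \<delta>c: "coeff \<alpha> \<delta> \<noteq> 0 \<or> coeff \<beta> \<delta> \<noteq> 0"
  proof (cases "degree \<alpha> \<ge> degree \<beta>")
    case True
    then have "degree \<alpha> = \<delta>" by (simp add: \<delta>_def)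
    then show ?thesis using \<delta>0 by (metis degree_0 leading_coeff_0_iff less_irrefl)
  next
    case False
    then have "degree \<beta> = \<delta>" by (simp add: \<delta>_def)
    then show ?thesis using \<delta>0 by (metis degree_0 leading_coeff_0_iff less_irrefl)
  qed
  define wp where "wp = pderiv \<alpha> * \<beta> - \<alpha> * pderiv \<beta>"
  have wp0: "wp \<noteq> 0" using wr by (simp add: wp_def)
  have indep: "smult a \<alpha> - smult b \<beta> \<noteq> 0" if "a \<noteq> 0 \<or> b \<noteq> 0" for a b
    using wronskian_proportional[of a \<alpha> b \<beta>] that wr by auto
  \<comment> \<open>At s1 this is minus the coefficient of degree \<delta> of the fibre polynomial
    \<open>F\<close>; avoiding its roots gives \<open>F\<close> full degree.\<close>
  define G where "G = smult (coeff \<beta> \<delta>) \<alpha> - smult (coeff \<alpha> \<delta>) \<beta>"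
  have G0: "G \<noteq> 0" unfolding G_def using \<delta>c by (intro indep) auto
  define Rt where "Rt = {r. poly (Q * wp) r = 0}"
  have Rt: "finite Rt" unfolding Rt_def using Q wp0 by (intro poly_roots_finite) simp
  \<comment> \<open>The fibre through s1 contains r exactly when \<open>H r\<close> vanishes at s1,
    so all but finitely many s1 keep the fibre away from \<open>Rt\<close>.\<close>
  define H where "H r = smult (poly \<beta> r) \<alpha> - smult (poly \<alpha> r) \<beta>" for r
  have H0: "H r \<noteq> 0" for r unfolding H_def using cop[of r] by (intro indep) auto
  define Bad where "Bad = insert 0 (Rt \<union> {s. poly G s = 0} \<union> (\<Union>r\<in>Rt. {s. poly (H r) s = 0}))"
  have "finite Bad" unfolding Bad_def using Rt G0 H0 by (simp add: poly_roots_finite)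
  then obtain s1 where s1: "s1 \<notin> Bad" using ex_not_in_finite by blast
  \<comment> \<open>The roots of F are the points of the fibre through s1.\<close>
  define F where "F = smult (poly \<beta> s1) \<alpha> - smult (poly \<alpha> s1) \<beta>"
  have Fr: "poly F r = - poly (H r) s1" for r by (simp add: F_def H_def mult.commute)
  have "coeff F \<delta> \<noteq> 0" using s1 by (auto simp: Bad_def F_def G_def mult.commute)
  moreover have "degree F \<le> \<delta>"
    unfolding F_def by (intro degree_diff_le) (auto simp: \<delta>_def intro: order_trans[OF degree_smult_le])
  ultimately have dF: "degree F = \<delta>" using le_degree[of F \<delta>] by simp
  have F0: "F \<noteq> 0" using \<open>coeff F \<delta> \<noteq> 0\<close> by auto
  have goodroot: "s2 \<notin> Rt" if "poly F s2 = 0" for s2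
  proof
    assume "s2 \<in> Rt"
    then have "poly (H s2) s1 \<noteq> 0" using s1 by (auto simp: Bad_def)
    then show False using Fr that by simp
  qed
  \<comment> \<open>A multiple root of F is a root of the Wronskian \<open>wp\<close>, which the
    choice of s1 excludes.\<close>
  have card: "card {r. poly F r = 0} = \<delta>"
    unfolding dF[symmetric]
  proof (rule card_simple_roots[OF F0])
    fix r assume r: "poly F r = 0"
    show "poly (pderiv F) r \<noteq> 0"
    proof
      assume "poly (pderiv F) r = 0"
      then have 1: "poly \<beta> s1 * poly (pderiv \<alpha>) r = poly \<alpha> s1 * poly (pderiv \<beta>) r"
        by (simp add: F_def pderiv_diff pderiv_smult)
      have 2: "poly \<beta> s1 * poly \<alpha> r = poly \<alpha> s1 * poly \<beta> r" using r by (simp add: F_def)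
      have "poly \<beta> s1 * poly wp r = 0" "poly \<alpha> s1 * poly wp r = 0"
        using 1 2 by (simp_all add: wp_def) (algebra, algebra)
      then have "poly wp r = 0" using cop[of s1] by auto
      then show False using goodroot[OF r] by (simp add: Rt_def)
    qed
  qed
  define \<Xi> where "\<Xi> = {\<chi>. (\<forall>s. poly \<alpha> (\<chi> * s) = poly \<alpha> s) \<and> (\<forall>s. poly \<beta> (\<chi> * s) = poly \<beta> s)}"
  have sub: "{r. poly F r = 0} \<subseteq> (\<lambda>\<chi>. \<chi> * s1) ` \<Xi>"
  proof
    fix s2 assume "s2 \<in> {r. poly F r = 0}"
    then have s2: "poly F s2 = 0" by simp
    have "poly Q s1 \<noteq> 0" "poly Q s2 \<noteq> 0" using s1 goodroot[OF s2] by (auto simp: Bad_def Rt_def)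
    moreover have "poly \<alpha> s1 * poly \<beta> s2 = poly \<alpha> s2 * poly \<beta> s1" using s2 by (simp add: F_def mult.commute)
    ultimately show "s2 \<in> (\<lambda>\<chi>. \<chi> * s1) ` \<Xi>" using sym unfolding \<Xi>_def by blast
  qed
  have root_unity: "\<chi> ^ i = 1" if "\<And>s. poly p (\<chi> * s) = poly p s" "coeff p i \<noteq> 0" for \<chi> i and p :: "'a poly"
  proof -
    have "pcompose p [:0, \<chi>:] = p"
      by (rule poly_eqI_infinite[of "{}"]) (use that(1) in \<open>auto simp: poly_pcompose mult.commute\<close>)
    then have "\<chi> ^ i * coeff p i = coeff p i" by (metis coeff_pcompose_linear)
    then show ?thesis using that(2) by simp
  qed
  have exps: "i = 0 \<or> i \<ge> \<delta>" if "coeff \<alpha> i \<noteq> 0 \<or> coeff \<beta> i \<noteq> 0" for i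
  proof (rule ccontr)
    assume "\<not> (i = 0 \<or> i \<ge> \<delta>)"
    then have i: "i > 0" "i < \<delta>" by auto
    let ?u = "monom 1 i - 1 :: 'a poly"
    have u0: "?u \<noteq> 0"
    proof
      assume "?u = 0"
      then have "coeff ?u i = 0" by simp
      then show False using i by simp
    qed
    have "\<Xi> \<subseteq> {\<chi>. poly ?u \<chi> = 0}"
      using that root_unity unfolding \<Xi>_def by (auto simp: poly_monom)
    moreover have "finite {\<chi>. poly ?u \<chi> = 0}" by (rule poly_roots_finite[OF u0])
    ultimately have fin\<Xi>: "finite \<Xi>" and "card \<Xi> \<le> card {\<chi>. poly ?u \<chi> = 0}"
      by (rule finite_subset, intro card_mono)
    note this(2)
    also have "\<dots> \<le> degree ?u" by (rule card_poly_roots_bound[OF u0])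
    also have "\<dots> \<le> i" by (intro degree_diff_le) (auto simp: degree_monom_le)
    finally have "card \<Xi> \<le> i" .
    moreover have "\<delta> \<le> card ((\<lambda>\<chi>. \<chi> * s1) ` \<Xi>)"
      unfolding card[symmetric] using sub fin\<Xi> by (intro card_mono) auto
    moreover have "card ((\<lambda>\<chi>. \<chi> * s1) ` \<Xi>) \<le> card \<Xi>" by (rule card_image_le[OF fin\<Xi>])
    ultimately show False using i by simp
  qed
  have shape: "p = [:coeff p 0:] + monom (coeff p \<delta>) \<delta>"
    if "degree p \<le> \<delta>" "\<And>i. coeff p i \<noteq> 0 \<Longrightarrow> i = 0 \<or> i \<ge> \<delta>" for p :: "'a poly"
  proof (rule poly_eqI)
    fix i
    show "coeff p i = coeff ([:coeff p 0:] + monom (coeff p \<delta>) \<delta>) i"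
      using that(2)[of i] that(1) \<delta>0 by (cases "i > \<delta>") (auto simp: coeff_pCons coeff_eq_0 split: nat.splits)
  qed
  have dle: "degree \<alpha> \<le> \<delta>" "degree \<beta> \<le> \<delta>" by (simp_all add: \<delta>_def)
  have "\<alpha> = [:coeff \<alpha> 0:] + monom (coeff \<alpha> \<delta>) \<delta>" "\<beta> = [:coeff \<beta> 0:] + monom (coeff \<beta> \<delta>) \<delta>"
    using exps dle by (blast intro: shape)+
  then show ?thesis using \<delta>0 \<delta>c by blast
qed

lemma binomial_simple_root:
  fixes a :: "'a::{alg_closed_field, field_char_0}"
  assumes "\<delta> > 0" "a \<noteq> 0" "b \<noteq> 0"
  shows "\<exists>r. poly ([:a:] + monom b \<delta>) r = 0 \<and> poly (pderiv ([:a:] + monom b \<delta>)) r \<noteq> 0"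
proof -
  obtain r where r: "r ^ \<delta> = - a / b" using nth_root_exists[OF assms(1)] by blast
  then have "r \<noteq> 0" using assms by (auto simp: power_0_left)
  then show ?thesis using r assms
    by (intro exI[of _ r]) (simp add: poly_monom pderiv_add pderiv_monom pderiv_pCons)
qed

text \<open>For each \<epsilon> with \<epsilon>^d = -1, the factor \<alpha> - \<epsilon> \<beta> of
  a + b must lose its constant or its leading term. Each of the two terms can vanish for one
  \<epsilon> only, so d is at most 2, and both remaining values of d are excluded by the
  exponents.\<close>

lemma binomial_contradiction:
  fixes N :: "'v \<Rightarrow> 'a::{alg_closed_field, field_char_0} poly"
  assumes e2: "\<And>v. v \<in> V0 \<union> V1 \<union> W \<Longrightarrow> e v \<ge> 2"
    and d: "d > 0" "\<And>v. v \<in> V0 \<union> V1 \<Longrightarrow> e v = E v * d"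
    and \<zeta>: "\<zeta> \<noteq> 0" and eq: "mval e V0 N + mval e V1 N + smult \<zeta> (mval e W N) = 0"
    and a: "mval E V0 N = [:a0:] + monom a1 \<delta>" and b: "mval E V1 N = [:b0:] + monom b1 \<delta>"
    and \<delta>: "\<delta> > 0" and ab: "a0 \<noteq> 0 \<or> b0 \<noteq> 0" "a1 \<noteq> 0 \<or> b1 \<noteq> 0"
    and cop: "\<And>s. \<not> (poly (mval E V0 N) s = 0 \<and> poly (mval E V1 N) s = 0)"
    and parity: "\<not> ((\<forall>v\<in>V0. even (e v)) \<and> (\<exists>v\<in>V0. e v = 2))"
  shows False
proof -
  define \<alpha> where "\<alpha> = mval E V0 N"
  define \<beta> where "\<beta> = mval E V1 N"
  have pw: "mval e V0 N = \<alpha> ^ d" "mval e V1 N = \<beta> ^ d"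
    unfolding \<alpha>_def \<beta>_def mval_power[symmetric] using d(2) by (simp_all add: mval_def cong: prod.cong)
  obtain d' where d': "d = Suc d'" using d(1) by (cases d) auto
  \<comment> \<open>With both terms present the factor has a simple root r. It stays simple in
    \<alpha>^d + \<beta>^d because \<beta> is nonzero at r, whereas every root of the monomial in w
    is multiple.\<close>
  have forms: "(a0 - \<epsilon> * b0) * (a1 - \<epsilon> * b1) = 0" if \<epsilon>: "\<epsilon> ^ d = - 1" for \<epsilon>
  proof (rule ccontr)
    let ?g = "[:a0 - \<epsilon> * b0:] + monom (a1 - \<epsilon> * b1) \<delta>"
    have g: "?g = \<alpha> - smult \<epsilon> \<beta>" by (simp add: \<alpha>_def \<beta>_def a b smult_add_right smult_monom flip: diff_monom)
    assume "(a0 - \<epsilon> * b0) * (a1 - \<epsilon> * b1) \<noteq> 0"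
    then obtain r where r: "poly ?g r = 0" "poly (pderiv ?g) r \<noteq> 0"
      using binomial_simple_root[OF \<delta>, of "a0 - \<epsilon> * b0" "a1 - \<epsilon> * b1"] by auto
    have r1: "poly \<alpha> r = \<epsilon> * poly \<beta> r" using r(1) by (simp add: g)
    have r2: "poly (pderiv \<alpha>) r - \<epsilon> * poly (pderiv \<beta>) r \<noteq> 0" using r(2) by (simp add: g pderiv_diff pderiv_smult)
    have \<beta>r: "poly \<beta> r \<noteq> 0" using cop[of r] r1 by (auto simp: \<alpha>_def \<beta>_def)
    have \<epsilon>0: "\<epsilon> \<noteq> 0" using \<epsilon> d(1) by (auto simp: power_0_left)
    have "\<alpha> ^ d + \<beta> ^ d = - smult \<zeta> (mval e W N)"
      using eq unfolding pw by (simp only: eq_neg_iff_add_eq_0)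
    then have M: "mval e W N = smult (- inverse \<zeta>) (\<alpha> ^ d + \<beta> ^ d)" using \<zeta> by simp
    have "poly (\<alpha> ^ d + \<beta> ^ d) r = 0" using \<epsilon> by (simp add: r1 power_mult_distrib)
    then have "poly (mval e W N) r = 0" by (simp add: M)
    then have "poly (pderiv (mval e W N)) r = 0" using e2 by (intro mval_double_root) auto
    then have "poly (pderiv (\<alpha> ^ d + \<beta> ^ d)) r = 0" using \<zeta> by (simp add: M pderiv_smult pderiv_minus)
    then have "of_nat d * (poly \<alpha> r ^ d' * poly (pderiv \<alpha>) r + poly \<beta> r ^ d' * poly (pderiv \<beta>) r) = 0"
      unfolding d' pderiv_add pderiv_power_Suc by (simp add: algebra_simps del: of_nat_Suc)
    then have "poly \<alpha> r ^ d' * poly (pderiv \<alpha>) r + poly \<beta> r ^ d' * poly (pderiv \<beta>) r = 0"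
      using d(1) by simp
    then have "poly \<beta> r ^ d' * (\<epsilon> ^ d' * poly (pderiv \<alpha>) r + poly (pderiv \<beta>) r) = 0"
      by (simp add: r1 power_mult_distrib algebra_simps)
    then have "\<epsilon> ^ d' * poly (pderiv \<alpha>) r + poly (pderiv \<beta>) r = 0" using \<beta>r by simp
    then have "\<epsilon> * (\<epsilon> ^ d' * poly (pderiv \<alpha>) r) + \<epsilon> * poly (pderiv \<beta>) r = 0"
      by (metis distrib_left mult_zero_right)
    moreover have "\<epsilon> * (\<epsilon> ^ d' * poly (pderiv \<alpha>) r) = - poly (pderiv \<alpha>) r"
      using \<epsilon> by (simp add: d' mult.assoc[symmetric])
    ultimately show False using r2 by (simp add: algebra_simps)
  qed
  \<comment> \<open>With both terms present there is a simple root, and a monomial with all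
    exponents at least 2 has none.\<close>
  have simple: "\<not> (\<forall>v\<in>S. E v \<ge> 2)" if "mval E S N = [:c0:] + monom c1 \<delta>" "c0 \<noteq> 0" "c1 \<noteq> 0" for S c0 c1
  proof
    assume "\<forall>v\<in>S. E v \<ge> 2"
    then show False using binomial_simple_root[OF \<delta> that(2,3)] mval_double_root[of S E N] that(1) by auto
  qed
  define Eps where "Eps = {\<epsilon> :: 'a. \<epsilon> ^ d = - 1}"
  have "card Eps = d"
  proof -
    let ?u = "monom 1 d + 1 :: 'a poly"
    have cu: "coeff ?u d = 1" using d(1) by (simp add: coeff_1)
    then have u0: "?u \<noteq> 0" by (metis coeff_0 zero_neq_one)
    have "degree ?u = d"
      using cu by (intro antisym degree_add_le degree_monom_le le_degree) auto
    moreover have "card {r. poly ?u r = 0} = degree ?u"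
    proof (rule card_simple_roots[OF u0])
      fix r assume "poly ?u r = 0"
      then have "r ^ d + 1 = 0" by (simp add: poly_monom)
      then have "r \<noteq> 0" using d(1) by (auto simp: power_0_left)
      then show "poly (pderiv ?u) r \<noteq> 0" using d(1) by (simp add: pderiv_add pderiv_monom poly_monom)
    qed
    moreover have "{r. poly ?u r = 0} = Eps" by (auto simp: Eps_def poly_monom eq_neg_iff_add_eq_0)
    ultimately show ?thesis by simp
  qed
  moreover have "card Eps \<le> 2"
  proof -
    define E0 where "E0 = {\<epsilon>. a0 = \<epsilon> * b0}"
    define E1 where "E1 = {\<epsilon>. a1 = \<epsilon> * b1}"
    \<comment> \<open>If \<open>b0\<close> is zero then \<open>a0\<close> is not and
      \<open>E0\<close> is empty, so the default value of the quotient does no harm; likewise for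
      \<open>E1\<close>.\<close>
    have "E0 \<subseteq> {a0 / b0}" "E1 \<subseteq> {a1 / b1}" using ab by (auto simp: E0_def E1_def)
    moreover have "Eps \<subseteq> E0 \<union> E1" using forms by (auto simp: Eps_def E0_def E1_def)
    ultimately have "Eps \<subseteq> {a0 / b0, a1 / b1}" by blast
    then have "card Eps \<le> card {a0 / b0, a1 / b1}" by (intro card_mono) auto
    also have "\<dots> \<le> 2" by (simp add: card_insert_if)
    finally show ?thesis .
  qed
  ultimately have "d = 1 \<or> d = 2" using d(1) by linarith
  then show False
  proof
    \<comment> \<open>Here E = e, so neither x' nor y' has a simple root, and each is constant or a
      multiple of s^\<delta>. The vanishing of a0 + b0 or of a1 + b1 then contradicts
      \<open>ab\<close>.\<close>
    assume d1: "d = 1"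
    then have EE: "E v \<ge> 2" if "v \<in> V0 \<union> V1" for v using that e2[of v] d(2)[OF that] by simp
    have "a0 = 0 \<or> a1 = 0" "b0 = 0 \<or> b1 = 0" using simple[OF a] simple[OF b] EE by auto
    moreover have "(a0 + b0) * (a1 + b1) = 0" using forms[of "-1"] d1 by simp
    ultimately show False using ab by (auto simp: add_eq_0_iff)
  next
    assume d2: "d = 2"
    obtain i :: 'a where i: "i ^ 2 = - 1" using nth_root_exists[of 2 "-1"] by auto
    have i0: "i \<noteq> 0" using i by auto
    have "(a0 - i * b0) * (a1 - i * b1) = 0" "(a0 - (- i) * b0) * (a1 - (- i) * b1) = 0"
      using forms[of i] forms[of "- i"] d2 i by simp_all
    then have "a0 \<noteq> 0 \<and> a1 \<noteq> 0"
      using ab i0 by (auto simp: add_eq_0_iff)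
    then have "\<not> (\<forall>v\<in>V0. E v \<ge> 2)" using simple[OF a] by auto
    then obtain v where v: "v \<in> V0" "E v < 2" by auto
    then have "e v = 2" using d(2)[of v] d2 e2[of v] by auto
    moreover have "\<forall>v\<in>V0. even (e v)" using d(2) d2 by auto
    ultimately show False using parity v(1) by blast
  qed
qed

text \<open>The symmetries given by \<open>sym\<close> are affine maps of the parameter line, in the
  form that \<open>flow_translate_symmetry\<close> supplies. The barycentre of the zeros of all
  coordinates as new origin makes them linear, as \<open>binomial_of_symmetry\<close>
  requires.\<close>

lemma no_transversal_curve:
  fixes C :: "'v \<Rightarrow> 'a::{alg_closed_field, field_char_0} poly"
  assumes J: "finite J" "V0 \<union> V1 \<union> W \<subseteq> J" and e2: "\<And>v. v \<in> V0 \<union> V1 \<union> W \<Longrightarrow> e v \<ge> 2"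
    and d: "d > 0" "\<And>v. v \<in> V0 \<union> V1 \<Longrightarrow> e v = E v * d"
    and C0: "\<And>v. v \<in> J \<Longrightarrow> C v \<noteq> 0"
    and \<zeta>: "\<zeta> \<noteq> 0" and eq: "mval e V0 C + mval e V1 C + smult \<zeta> (mval e W C) = 0"
    and cop: "\<And>s. \<not> (poly (mval E V0 C) s = 0 \<and> poly (mval E V1 C) s = 0)"
    and wr: "pderiv (mval E V0 C) * mval E V1 C \<noteq> mval E V0 C * pderiv (mval E V1 C)"
    and sym: "\<And>s1 s2. (\<And>v. v \<in> J \<Longrightarrow> poly (C v) s1 \<noteq> 0) \<Longrightarrow> (\<And>v. v \<in> J \<Longrightarrow> poly (C v) s2 \<noteq> 0) \<Longrightarrow>
      poly (mval E V0 C) s1 * poly (mval E V1 C) s2 = poly (mval E V0 C) s2 * poly (mval E V1 C) s1 \<Longrightarrow>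
      \<exists>\<chi> \<sigma>. \<chi> \<noteq> 0 \<and> (\<forall>v\<in>J. \<sigma> v \<noteq> 0) \<and> mval E V0 \<sigma> = mval E V1 \<sigma> \<and>
        (\<forall>v\<in>J. \<forall>s. poly (C v) (s2 + \<chi> * s) = \<sigma> v * poly (C v) (s1 + s))"
    and parity: "\<not> ((\<forall>v\<in>V0. even (e v)) \<and> (\<exists>v\<in>V0. e v = 2))"
  shows False
proof -
  define Q where "Q = (\<Prod>v\<in>J. C v)"
  have Q0: "Q \<noteq> 0" using J(1) C0 by (simp add: Q_def)
  have Qr: "poly Q s = 0 \<longleftrightarrow> (\<exists>v\<in>J. poly (C v) s = 0)" for s
    using J(1) by (simp add: Q_def poly_prod)
  define Rt where "Rt = {r. poly Q r = 0}"
  have Rt: "finite Rt" using Q0 by (simp add: Rt_def poly_roots_finite)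
  \<comment> \<open>Without zeros all coordinates would be constant on the curve, against
    \<open>wr\<close>; so the barycentre exists.\<close>
  have Rne: "Rt \<noteq> {}"
  proof
    assume "Rt = {}"
    then have "degree (C v) = 0" if "v \<in> J" for v
      using that alg_closed_imp_poly_has_root[of "C v"] Qr by (auto simp: Rt_def)
    then have c: "C v = [:poly (C v) 0:]" if "v \<in> J" for v
      using that by (metis degree_eq_zeroE poly_pCons mult_zero_left add_0_right)
    have "mval E S C = [:mval E S (\<lambda>v. poly (C v) 0):]" if "S \<subseteq> J" for S
      unfolding mval_const_poly[symmetric] using that c by (intro mval_cong) auto
    then have "mval E V0 C = [:mval E V0 (\<lambda>v. poly (C v) 0):]" "mval E V1 C = [:mval E V1 (\<lambda>v. poly (C v) 0):]"
      using J(2) by auto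
    then show False using wr by (simp add: pderiv_pCons)
  qed
  define b where "b = (\<Sum>r\<in>Rt. r) / of_nat (card Rt)"
  have cR: "of_nat (card Rt) \<noteq> (0 :: 'a)" using Rt Rne by simp
  define N where "N v = pcompose (C v) [:b, 1:]" for v
  have Np: "poly (N v) s = poly (C v) (b + s)" for v s by (simp add: N_def poly_pcompose)
  have mN: "mval k S N = pcompose (mval k S C) [:b, 1:]" for k S
    by (simp add: mval_def N_def pcompose_prod pcompose_power)
  have symN: "\<exists>\<chi>. s2 = \<chi> * s1 \<and> (\<forall>s. poly (mval E V0 N) (\<chi> * s) = poly (mval E V0 N) s)
      \<and> (\<forall>s. poly (mval E V1 N) (\<chi> * s) = poly (mval E V1 N) s)"
    if Q1: "poly (pcompose Q [:b, 1:]) s1 \<noteq> 0" "poly (pcompose Q [:b, 1:]) s2 \<noteq> 0"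
      and AB: "poly (mval E V0 N) s1 * poly (mval E V1 N) s2 = poly (mval E V0 N) s2 * poly (mval E V1 N) s1" for s1 s2
  proof -
    have "\<exists>\<chi> \<sigma>. \<chi> \<noteq> 0 \<and> (\<forall>v\<in>J. \<sigma> v \<noteq> 0) \<and> mval E V0 \<sigma> = mval E V1 \<sigma> \<and>
        (\<forall>v\<in>J. \<forall>s. poly (C v) (b + s2 + \<chi> * s) = \<sigma> v * poly (C v) (b + s1 + s))"
    proof (rule sym)
      show "poly (C v) (b + s1) \<noteq> 0" if "v \<in> J" for v using Q1(1) Qr that by (auto simp: poly_pcompose)
      show "poly (C v) (b + s2) \<noteq> 0" if "v \<in> J" for v using Q1(2) Qr that by (auto simp: poly_pcompose)
    qed (use AB in \<open>simp add: mN poly_pcompose\<close>)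
    then obtain \<chi> \<sigma> where \<chi>: "\<chi> \<noteq> 0" "\<And>v. v \<in> J \<Longrightarrow> \<sigma> v \<noteq> 0" "mval E V0 \<sigma> = mval E V1 \<sigma>"
      "\<And>v s. v \<in> J \<Longrightarrow> poly (C v) (b + s2 + \<chi> * s) = \<sigma> v * poly (C v) (b + s1 + s)" by blast
    \<comment> \<open>The symmetry in the original parameter; it sends b + s1 to b + s2. As it
      rescales every coordinate, it permutes the finite set \<open>Rt\<close> and fixes its
      barycentre.\<close>
    define g where "g s = b + s2 + \<chi> * (s - b - s1)" for s
    have Cg: "poly (C v) (g s) = \<sigma> v * poly (C v) s" if "v \<in> J" for v s
      using \<chi>(4)[OF that, of "s - b - s1"] by (simp add: g_def)
    have ginj: "inj_on g Rt" using \<chi>(1) by (auto simp: inj_on_def g_def)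
    have "g ` Rt \<subseteq> Rt" using Cg by (auto simp: Rt_def Qr)
    then have gR: "g ` Rt = Rt" using ginj Rt by (simp add: endo_inj_surj)
    have "(\<Sum>r\<in>Rt. r) = (\<Sum>r\<in>Rt. g r)" using sum.reindex[OF ginj, of "\<lambda>r. r"] gR by simp
    also have "\<dots> = of_nat (card Rt) * (b + s2 - \<chi> * (b + s1)) + \<chi> * (\<Sum>r\<in>Rt. r)"
      by (simp add: g_def sum.distrib sum_subtractf sum_distrib_left algebra_simps)
    finally have "of_nat (card Rt) * b = of_nat (card Rt) * (b + s2 - \<chi> * (b + s1)) + \<chi> * (of_nat (card Rt) * b)"
      using cR by (simp add: b_def)
    then have "of_nat (card Rt) * (s2 - \<chi> * s1) = 0" by (auto simp: algebra_simps)
    then have s2: "s2 = \<chi> * s1" using cR by simp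
    have NN: "poly (N v) (\<chi> * s) = \<sigma> v * poly (N v) s" if "v \<in> J" for v s
      using Cg[OF that, of "b + s"] by (simp add: g_def s2 Np algebra_simps)
    have AN: "poly (mval E S N) (\<chi> * s) = mval E S \<sigma> * poly (mval E S N) s" if "S \<subseteq> J" for S s
      unfolding poly_mval mval_mult[symmetric] using that NN by (intro mval_cong) auto
    have A0: "poly (mval E V0 N) (\<chi> * s) = mval E V0 \<sigma> * poly (mval E V0 N) s"
      and A1: "poly (mval E V1 N) (\<chi> * s) = mval E V0 \<sigma> * poly (mval E V1 N) s" for s
      using AN[of V0] AN[of V1] J(2) \<chi>(3) by auto
    \<comment> \<open>At the new origin x' and y' do not both vanish, so their common factor under
      \<sigma> is 1: both are invariant and not merely rescaled.\<close>
    have "poly (mval E V0 N) 0 \<noteq> 0 \<or> poly (mval E V1 N) 0 \<noteq> 0" using cop[of b] by (auto simp: mN poly_pcompose)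
    then have "mval E V0 \<sigma> = 1" using A0[of 0] A1[of 0] by auto
    then show ?thesis using s2 A0 A1 by auto
  qed
  have pd: "pderiv (pcompose p [:b, 1:]) = pcompose (pderiv p) [:b, 1:]" for p :: "'a poly"
    by (simp add: pderiv_pcompose pderiv_pCons)
  have wrN: "pderiv (mval E V0 N) * mval E V1 N \<noteq> mval E V0 N * pderiv (mval E V1 N)"
  proof
    assume "pderiv (mval E V0 N) * mval E V1 N = mval E V0 N * pderiv (mval E V1 N)"
    then have "pcompose (pderiv (mval E V0 C) * mval E V1 C - mval E V0 C * pderiv (mval E V1 C)) [:b, 1:] = 0"
      unfolding mN pd by (simp add: pcompose_mult pcompose_diff)
    then have "pderiv (mval E V0 C) * mval E V1 C - mval E V0 C * pderiv (mval E V1 C) = 0"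
      by (rule pcompose_eq_0) simp
    then show False using wr by simp
  qed
  have copN: "\<not> (poly (mval E V0 N) s = 0 \<and> poly (mval E V1 N) s = 0)" for s
    using cop[of "b + s"] by (simp add: mN poly_pcompose)
  have "pcompose Q [:b, 1:] \<noteq> 0" using Q0 pcompose_eq_0[of Q "[:b, 1:]"] by auto
  from binomial_of_symmetry[OF this copN wrN symN] obtain \<delta> a0 a1 b0 b1 where
    bin: "\<delta> > 0" "mval E V0 N = [:a0:] + monom a1 \<delta>" "mval E V1 N = [:b0:] + monom b1 \<delta>" "a1 \<noteq> 0 \<or> b1 \<noteq> 0"
    by blast
  have "a0 \<noteq> 0 \<or> b0 \<noteq> 0" using copN[of 0] bin(1) by (auto simp: bin(2,3) poly_monom power_0_left)
  moreover have "mval e V0 N + mval e V1 N + smult \<zeta> (mval e W N) = 0"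
    using arg_cong[OF eq, of "\<lambda>p. pcompose p [:b, 1:]"] by (simp add: mN pcompose_add pcompose_smult)
  ultimately show False
    using binomial_contradiction[OF e2 d \<zeta> _ bin(2,3,1) _ bin(4) copN parity] by blast
qed

subsection \<open>The torus of the trinomial hypersurface\<close>

text \<open>Iterating the relation, D^k of a pullback is \<chi>^k times the pullback of D^k. Hence
  \<sigma> exp(s D) p = exp(\<chi> s D) (\<sigma> p), read here in one coordinate.\<close>

lemma (in lnd_on_affine) flow_normalized:
  assumes v: "v \<in> I" and s: "\<sigma> \<in> diag_sym I X" and n: "normalizes I X D \<sigma> \<chi>" and p: "p \<in> X"
  shows "\<sigma> v * poly (flow p (crd v)) s = poly (flow (scale I \<sigma> p) (crd v)) (\<chi> * s)"
proof -
  have Dk: "(D ^^ k) (pull I X \<sigma> f) = (\<lambda>p. \<chi> ^ k * pull I X \<sigma> ((D ^^ k) f) p)" if "f \<in> A" for f k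
  proof (induction k)
    case (Suc k)
    have g: "(D ^^ k) f \<in> A" by (rule Dn_closed[OF that])
    have "(D ^^ Suc k) (pull I X \<sigma> f) = D (\<lambda>p. \<chi> ^ k * pull I X \<sigma> ((D ^^ k) f) p)"
      using Suc.IH by simp
    also have "\<dots> = (\<lambda>p. \<chi> ^ k * D (pull I X \<sigma> ((D ^^ k) f)) p)" by (rule D_scale[OF pull_in[OF s g]])
    also have "D (pull I X \<sigma> ((D ^^ k) f)) = (\<lambda>p. \<chi> * pull I X \<sigma> (D ((D ^^ k) f)) p)"
      using n g unfolding normalizes_def by blast
    finally show ?case by (simp add: mult_ac)
  qed simp
  have "smult (\<sigma> v) (flow p (crd v)) = pcompose (flow (scale I \<sigma> p) (crd v)) [:0, \<chi>:]"
  proof (rule poly_eqI)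
    fix k
    have "\<sigma> v * (D ^^ k) (crd v) p = (D ^^ k) (pull I X \<sigma> (crd v)) p"
      using Dn_scale[OF crd_in[OF v], of k "\<sigma> v"] by (simp add: pull_crd[OF s v])
    also have "\<dots> = \<chi> ^ k * (D ^^ k) (crd v) (scale I \<sigma> p)"
      using Dk[OF crd_in[OF v], of k] p by (simp add: pull_def res_def)
    finally show "coeff (smult (\<sigma> v) (flow p (crd v))) k = coeff (pcompose (flow (scale I \<sigma> p) (crd v)) [:0, \<chi>:]) k"
      by (simp add: coeff_pcompose_linear coeff_flow crd_in v)
  qed
  then have "poly (smult (\<sigma> v) (flow p (crd v))) s = poly (pcompose (flow (scale I \<sigma> p) (crd v)) [:0, \<chi>:]) s" by simp
  then show ?thesis by (simp add: poly_pcompose mult.commute)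
qed

text \<open>A symmetry that carries one point of a flow line to another maps the line into itself;
  in the time parameter it is the affine map s1 + s -> s2 + \<chi> s.\<close>

lemma (in lnd_on_affine) flow_translate_symmetry:
  assumes v: "v \<in> I" and s: "\<sigma> \<in> diag_sym I X" and n: "normalizes I X D \<sigma> \<chi>" and p: "p \<in> X"
    and c: "curve p s2 = scale I \<sigma> (curve p s1)"
  shows "poly (flow p (crd v)) (s2 + \<chi> * s) = \<sigma> v * poly (flow p (crd v)) (s1 + s)"
proof -
  have *: "poly (flow (curve p s0) (crd v)) s = poly (flow p (crd v)) (s0 + s)" for s0 s
    using flow_curve[OF crd_in[OF v] p, of s0] by (simp add: poly_pcompose)
  show ?thesis
    using flow_normalized[OF v s n curve_in[OF p], of s1 s] unfolding c[symmetric] * by simp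
qed

lemma int_bezout:
  fixes e :: "'v \<Rightarrow> nat"
  assumes "finite S"
  shows "\<exists>k :: 'v \<Rightarrow> int. (\<Sum>u\<in>S. k u * int (e u)) = int (Gcd (e ` S))"
  using assms
proof (induction S rule: finite_induct)
  case (insert v S)
  then obtain k :: "'v \<Rightarrow> int" where k: "(\<Sum>u\<in>S. k u * int (e u)) = int (Gcd (e ` S))" by blast
  obtain a b where ab: "a * int (e v) + b * int (Gcd (e ` S)) = gcd (int (e v)) (int (Gcd (e ` S)))"
    using bezout_int by blast
  have "(\<Sum>u\<in>insert v S. (if u = v then a else b * k u) * int (e u)) = a * int (e v) + (\<Sum>u\<in>S. b * (k u * int (e u)))"
    using insert(1,2) by (subst sum.insert) (auto intro!: sum.cong simp: mult.assoc)
  also have "\<dots> = int (Gcd (e ` insert v S))"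
    using ab k by (simp flip: sum_distrib_left add: gcd_int_int_eq)
  finally show ?case by (rule exI[of _ "\<lambda>u. if u = v then a else b * k u"])
qed simp

lemma mval_powi:
  assumes "t \<noteq> 0" shows "mval e S (\<lambda>v. t powi \<omega> v) = (t :: 'a::field) powi (\<Sum>v\<in>S. int (e v) * \<omega> v)"
  using assms
  by (induction S rule: infinite_finite_induct)
    (auto simp: mval_def power_int_add power_int_mult mult.commute[of "int _"])

context trinomial_hypersurface
begin

text \<open>The gcd is taken over x and y together, so that \<open>mval E V0\<close> and
  \<open>mval E V1\<close> are the d-th roots x' and y' of the overview.\<close>

definition d :: nat where "d = Gcd (e ` (V0 \<union> V1))"
definition E :: "'v \<Rightarrow> nat" where "E v = e v div d"

lemma e_eq: "v \<in> V0 \<union> V1 \<Longrightarrow> e v = E v * d"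
  by (simp add: E_def d_def Gcd_dvd)

lemma d_pos: "d > 0"
  using V1_ne e_pos e_eq by (metis UnCI ex_in_conv mult_0_right not_gr0)

lemma E_pos: "v \<in> V0 \<union> V1 \<Longrightarrow> E v > 0"
  using e_pos[of v] e_eq[of v] by (metis UnI1 gr0I mult_0 nat_less_le)

lemma mval_e_E:
  fixes p :: "'v \<Rightarrow> 'b::comm_semiring_1"
  assumes "S \<subseteq> V0 \<union> V1" shows "mval e S p = mval E S p ^ d"
proof -
  have "mval e S p = mval (\<lambda>v. E v * d) S p"
    using assms e_eq by (auto simp: mval_def intro!: prod.cong)
  then show ?thesis by (simp only: mval_power)
qed

definition tor' :: "('v \<Rightarrow> 'a) set"
  where "tor' = {\<sigma>. (\<forall>v\<in>I. \<sigma> v \<noteq> 0) \<and> mval e V0 \<sigma> = mval e V1 \<sigma> \<and> mval e V0 \<sigma> = \<sigma> z * mval e W \<sigma>}"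

text \<open>Dividing the exponents by their gcd selects the connected component of tor', which is the part
  generated by one-parameter subgroups.\<close>
definition tor :: "('v \<Rightarrow> 'a) set"
  where "tor = {\<sigma>\<in>tor'. mval E V0 \<sigma> = mval E V1 \<sigma>}"

lemma tor'_diag_sym:
  assumes "\<sigma> \<in> tor'" shows "\<sigma> \<in> diag_sym I X"
proof -
  have m: "mval e V1 \<sigma> = mval e V0 \<sigma>" "\<sigma> z * mval e W \<sigma> = mval e V0 \<sigma>"
    using assms by (auto simp: tor'_def)
  have "scale I \<sigma> p \<in> X" if p: "p \<in> X" for p
  proof -
    have "mval e V0 (\<lambda>v. \<sigma> v * p v) + mval e V1 (\<lambda>v. \<sigma> v * p v) + \<sigma> z * p z * mval e W (\<lambda>v. \<sigma> v * p v)
        = mval e V0 \<sigma> * mval e V0 p + mval e V1 \<sigma> * mval e V1 p + (\<sigma> z * mval e W \<sigma>) * (p z * mval e W p)"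
      by (simp add: mval_mult mult_ac)
    also have "\<dots> = mval e V0 \<sigma> * (mval e V0 p + mval e V1 p + p z * mval e W p)"
      by (simp only: m distrib_left)
    finally show ?thesis using p unfolding scale_def restrict_in_X by (simp add: in_X)
  qed
  then show ?thesis using assms by (auto simp: diag_sym_def tor'_def)
qed

lemma tor'_mult: "\<sigma> \<in> tor' \<Longrightarrow> \<tau> \<in> tor' \<Longrightarrow> (\<lambda>v. \<sigma> v * \<tau> v) \<in> tor'"
proof -
  assume s: "\<sigma> \<in> tor'" and t: "\<tau> \<in> tor'"
  have "mval e V0 \<sigma> = \<sigma> z * mval e W \<sigma>" "mval e V0 \<tau> = \<tau> z * mval e W \<tau>"
    using s t unfolding tor'_def by blast+
  then have "mval e V0 \<sigma> * mval e V0 \<tau> = (\<sigma> z * mval e W \<sigma>) * (\<tau> z * mval e W \<tau>)"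
    by (simp only:)
  then have "mval e V0 \<sigma> * mval e V0 \<tau> = (\<sigma> z * \<tau> z) * (mval e W \<sigma> * mval e W \<tau>)"
    by (simp only: mult_ac)
  then show ?thesis using s t by (simp add: tor'_def mval_mult)
qed

lemma weight_tor':
  assumes "(\<Sum>v\<in>V0. int (e v) * \<omega> v) = c" "(\<Sum>v\<in>V1. int (e v) * \<omega> v) = c"
    "\<omega> z + (\<Sum>v\<in>W. int (e v) * \<omega> v) = c" "t \<noteq> 0"
  shows "(\<lambda>v. t powi \<omega> v) \<in> tor'"
  using assms by (auto simp: tor'_def mval_powi simp flip: power_int_add)

definition wt_W :: "'v \<Rightarrow> 'v \<Rightarrow> int"
  where "wt_W w = (\<lambda>_. 0)(w := - 1, z := int (e w))"

text \<open>A one-parameter group that moves v and compensates at a fixed y in \<open>V1\<close>.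
  For v in \<open>V1\<close> the two moves cancel inside b. For v in \<open>V0\<close> both a and b
  get the weight -e_v E_y = -E_v e_y, and z gets the same. With the reduced exponents E these groups
  and those of \<open>wt_W\<close> generate \<open>tor\<close>.\<close>

definition wt_V :: "'v \<Rightarrow> 'v \<Rightarrow> 'v \<Rightarrow> int"
  where "wt_V y v = (\<lambda>_. 0)(v := - int (E y), y := (if v \<in> V0 then - int (E v) else int (E v)),
    z := (if v \<in> V0 then - int (e v * E y) else 0))"

lemma wt_W_tor':
  assumes "w \<in> W" "t \<noteq> 0" shows "(\<lambda>v. t powi wt_W w v) \<in> tor'"
proof (rule weight_tor'[where c = 0])
  have "w \<noteq> z" "w \<notin> V0" "w \<notin> V1" using assms disj by auto
  then show "(\<Sum>v\<in>V0. int (e v) * wt_W w v) = 0" "(\<Sum>v\<in>V1. int (e v) * wt_W w v) = 0"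
    using disj by (auto simp: wt_W_def intro!: sum.neutral)
  have "(\<Sum>v\<in>W. int (e v) * wt_W w v) = (\<Sum>v\<in>W. if v = w then - int (e w) else 0)"
    using disj by (intro sum.cong) (auto simp: wt_W_def)
  then show "wt_W w z + (\<Sum>v\<in>W. int (e v) * wt_W w v) = 0" using assms fin \<open>w \<noteq> z\<close> by (simp add: wt_W_def)
qed fact

lemma wt_V_tor':
  assumes y: "y \<in> V1" and v: "v \<in> V0 \<union> V1 - {y}" and t: "t \<noteq> 0"
  shows "(\<lambda>u. t powi wt_V y v u) \<in> tor'"
proof (rule weight_tor'[where c = "if v \<in> V0 then - int (e v * E y) else 0"])
  have ne: "y \<noteq> z" "v \<noteq> z" "y \<noteq> v" "y \<notin> V0" "y \<notin> W" "v \<notin> W" using y v disj by auto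
  have "(\<Sum>u\<in>V0. int (e u) * wt_V y v u) = (\<Sum>u\<in>V0. if u = v then - int (e v * E y) else 0)"
    using disj ne by (intro sum.cong) (auto simp: wt_V_def)
  then show "(\<Sum>u\<in>V0. int (e u) * wt_V y v u) = (if v \<in> V0 then - int (e v * E y) else 0)"
    using fin by simp
  have "(\<Sum>u\<in>V1. int (e u) * wt_V y v u) = (\<Sum>u\<in>V1. (if u = v then - int (e v * E y) else 0)
      + (if u = y then int (e y) * (if v \<in> V0 then - int (E v) else int (E v)) else 0))"
    using disj ne by (intro sum.cong) (auto simp: wt_V_def)
  also have "\<dots> = (if v \<in> V0 then - int (e v * E y) else 0)"
    using fin y v disj e_eq[of v] e_eq[of y] by (auto simp: sum.distrib)
  finally show "(\<Sum>u\<in>V1. int (e u) * wt_V y v u) = (if v \<in> V0 then - int (e v * E y) else 0)" .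
  have "(\<Sum>u\<in>W. int (e u) * wt_V y v u) = 0"
    using disj ne by (intro sum.neutral) (auto simp: wt_V_def)
  then show "wt_V y v z + (\<Sum>u\<in>W. int (e u) * wt_V y v u) = (if v \<in> V0 then - int (e v * E y) else 0)"
    using ne by (simp add: wt_V_def)
qed fact

lemma weighted_setI:
  assumes "\<And>t. t \<noteq> 0 \<Longrightarrow> (\<lambda>v. t powi \<omega> v) \<in> tor'"
  shows "weighted_set I X \<omega>"
  by unfold_locales (rule X_ext, rule finI, rule tor'_diag_sym[OF assms])

section \<open>Torus elements that normalize a derivation\<close>

definition normal :: "((('v \<Rightarrow> 'a) \<Rightarrow> 'a) \<Rightarrow> ('v \<Rightarrow> 'a) \<Rightarrow> 'a) \<Rightarrow> ('v \<Rightarrow> 'a) \<Rightarrow> bool"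
  where "normal D \<sigma> \<longleftrightarrow> \<sigma> \<in> tor' \<and> (\<exists>\<chi>. \<chi> \<noteq> 0 \<and> normalizes I X D \<sigma> \<chi>)"

lemma normal_mult: "normal D \<sigma> \<Longrightarrow> normal D \<tau> \<Longrightarrow> normal D (\<lambda>v. \<sigma> v * \<tau> v)"
proof -
  assume n: "normal D \<sigma>" "normal D \<tau>"
  then obtain \<chi> \<psi> where *: "\<sigma> \<in> tor'" "\<tau> \<in> tor'" "\<chi> \<noteq> 0" "\<psi> \<noteq> 0"
    "normalizes I X D \<sigma> \<chi>" "normalizes I X D \<tau> \<psi>" unfolding normal_def by blast
  have "normalizes I X D (\<lambda>v. \<sigma> v * \<tau> v) (\<chi> * \<psi>)"
    by (rule normalizes_mult[OF tor'_diag_sym[OF *(1)] tor'_diag_sym[OF *(2)] *(5,6)])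
  then show ?thesis unfolding normal_def using tor'_mult[OF *(1,2)] *(3,4)
    by (intro conjI exI[of _ "\<chi> * \<psi>"]) auto
qed

lemma normal_one: 
  assumes "derivation A D" shows "normal D (\<lambda>_. 1)"
proof -
  have t: "(\<lambda>_. 1) \<in> tor'" by (auto simp: tor'_def mval_def)
  interpret weighted_set I X "\<lambda>_. 0" by (rule weighted_setI) (use t in simp)
  interpret derivation_on I X D by unfold_locales fact
  have "normalizes I X D (\<lambda>_. 1) 1"
    by (auto simp: normalizes_def pull_one D_closed)
  then show ?thesis using t by (auto simp: normal_def intro!: exI[of _ 1])
qed

lemma normal_prod:
  assumes "derivation A D" "finite S" "\<And>i. i \<in> S \<Longrightarrow> normal D (\<tau> i)"
  shows "normal D (\<lambda>v. \<Prod>i\<in>S. \<tau> i v)"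
  using assms(2,3)
  by (induction S rule: finite_induct) (auto simp: normal_one assms(1) intro: normal_mult)

lemma normal_cong:
  assumes "normal D \<sigma>" "\<And>v. v \<in> I \<Longrightarrow> \<sigma> v = \<tau> v" shows "normal D \<tau>"
proof -
  have "scale I \<sigma> = scale I \<tau>" using assms(2) by (auto simp: scale_def fun_eq_iff)
  then have "pull I X \<sigma> = pull I X \<tau>" by (intro ext) (simp add: pull_def)
  moreover have "mval k S \<sigma> = mval k S \<tau>" if "S \<subseteq> I" for S k
    using that assms(2) by (intro mval_cong) auto
  then have "mval e V0 \<sigma> = mval e V0 \<tau>" "mval e V1 \<sigma> = mval e V1 \<tau>" "mval e W \<sigma> = mval e W \<tau>"
    using subI by auto
  ultimately show ?thesis using assms unfolding normal_def tor'_def normalizes_def by auto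
qed

text \<open>Every element of \<open>tor\<close> is a product of elements of the one-parameter
  groups. The coordinates other than y and z are prescribed separately by extracting roots of order
  E_y; y then comes out right up to a root of unity, and z is forced by the relation defining
  \<open>tor'\<close>.\<close>

lemma tor_generated:
  assumes D: "derivation A D" and y: "y \<in> V1"
    and nV: "\<And>v t. v \<in> V0 \<union> V1 - {y} \<Longrightarrow> t \<noteq> 0 \<Longrightarrow> normal D (\<lambda>u. t powi wt_V y v u)"
    and nW: "\<And>w t. w \<in> W \<Longrightarrow> t \<noteq> 0 \<Longrightarrow> normal D (\<lambda>u. t powi wt_W w u)"
    and \<sigma>: "\<sigma> \<in> tor"
  shows "normal D \<sigma>"
proof -
  define S where "S = V0 \<union> V1 - {y}"
  have S: "finite S" "y \<notin> S" "insert y S = V0 \<union> V1" using fin y by (auto simp: S_def)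
  have \<sigma>0: "\<sigma> v \<noteq> 0" if "v \<in> I" for v using \<sigma> that by (auto simp: tor_def tor'_def)
  have Ey: "E y > 0" using E_pos[of y] y by simp
  obtain k where k: "(\<Sum>u\<in>V0 \<union> V1. k u * int (e u)) = int d"
    using int_bezout[of "V0 \<union> V1" e] fin by (auto simp: d_def)
  have "(\<Sum>u\<in>V0 \<union> V1. k u * int (e u)) = (\<Sum>u\<in>V0 \<union> V1. k u * int (E u)) * int d"
    unfolding sum_distrib_right using e_eq by (intro sum.cong) auto
  then have "(\<Sum>u\<in>V0 \<union> V1. k u * int (E u)) = 1" using k d_pos by simp
  then have kE: "(\<Sum>u\<in>S. k u * int (E u)) = 1 - k y * int (E y)"
    unfolding S(3)[symmetric] using S(1,2) by simp
  define sg :: "'v \<Rightarrow> int" where "sg v = (if v \<in> V0 then 1 else - 1)" for v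
  have sg: "sg v * sg v = 1" for v by (simp add: sg_def)
  \<comment> \<open>The inverse enters because \<open>wt_V y v\<close> gives v the weight -E_y: the
    element with parameter \<open>t0 v\<close> has v-coordinate \<open>\<sigma> v\<close>.\<close>
  have "\<forall>v. \<exists>t. t ^ E y = inverse (\<sigma> v)" using nth_root_exists[OF Ey] by blast
  then obtain t0 where t0: "\<And>v. t0 v ^ E y = inverse (\<sigma> v)" by metis
  have t00: "t0 v \<noteq> 0" if "v \<in> S" for v
    using t0[of v] \<sigma>0[of v] that Ey by (auto simp: S_def power_0_left)
  \<comment> \<open>The y-coordinate of the product of these elements. The relation that cuts out
    \<open>tor\<close> inside \<open>tor'\<close> shows that it has the same power of order E_y as
    \<open>\<sigma> y\<close>.\<close>
  define \<tau>y where "\<tau>y = (\<Prod>v\<in>S. t0 v powi (- (sg v * int (E v))))"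
  have \<tau>y0: "\<tau>y \<noteq> 0" using t00 S(1) by (simp add: \<tau>y_def)
  define \<zeta> where "\<zeta> = \<sigma> y / \<tau>y"
  have \<zeta>0: "\<zeta> \<noteq> 0" using \<tau>y0 \<sigma>0[of y] y by (simp add: \<zeta>_def)
  have "\<tau>y ^ E y = (\<Prod>v\<in>S. \<sigma> v powi (sg v * int (E v)))"
    unfolding \<tau>y_def prod_power_distrib
  proof (rule prod.cong)
    fix v assume v: "v \<in> S"
    have "(t0 v powi (- (sg v * int (E v)))) ^ E y = (t0 v ^ E y) powi (- (sg v * int (E v)))"
      by (simp add: mult.commute flip: power_int_of_nat power_int_mult)
    also have "\<dots> = \<sigma> v powi (sg v * int (E v))"
      unfolding t0 by (simp add: power_int_minus power_int_inverse)
    finally show "(t0 v powi (- (sg v * int (E v)))) ^ E y = \<sigma> v powi (sg v * int (E v))" .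
  qed simp
  also have "\<dots> = (\<Prod>v\<in>V0. \<sigma> v powi (sg v * int (E v))) * (\<Prod>v\<in>V1 - {y}. \<sigma> v powi (sg v * int (E v)))"
  proof -
    have "S = V0 \<union> (V1 - {y})" using y disj by (auto simp: S_def)
    moreover have "V0 \<inter> (V1 - {y}) = {}" using disj by auto
    ultimately show ?thesis using fin by (simp add: prod.union_disjoint)
  qed
  also have "(\<Prod>v\<in>V0. \<sigma> v powi (sg v * int (E v))) = mval E V0 \<sigma>"
    unfolding mval_def by (intro prod.cong) (auto simp: sg_def power_int_of_nat)
  also have "(\<Prod>v\<in>V1 - {y}. \<sigma> v powi (sg v * int (E v))) = inverse (mval E (V1 - {y}) \<sigma>)"
    unfolding mval_def prod_inversef[symmetric] comp_def
    using disj by (intro prod.cong) (auto simp: sg_def power_int_of_nat power_int_minus)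
  also have "mval E V0 \<sigma> = \<sigma> y ^ E y * mval E (V1 - {y}) \<sigma>"
    using \<sigma> mval_remove[OF fin(2) y, of E \<sigma>] by (simp add: tor_def)
  finally have "\<tau>y ^ E y = \<sigma> y ^ E y"
    using mval_nonzero[of "V1 - {y}" \<sigma> E] \<sigma>0 by auto
  then have \<zeta>1: "\<zeta> ^ E y = 1" using \<sigma>0[of y] y by (simp add: \<zeta>_def power_divide)
  (* The roots t0 v give the right coordinates except at y, where they are off by the root of unity \<zeta>;
     the Bezout coefficients k correct this without changing the other coordinates. *)
  define t where "t v = t0 v * \<zeta> powi (- (sg v * k v))" for v
  have tn: "t v \<noteq> 0" if "v \<in> S" for v using t00[OF that] \<zeta>0 by (simp add: t_def)
  have "(\<zeta> powi m) ^ E y = 1" for m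
  proof -
    have "(\<zeta> powi m) ^ E y = (\<zeta> ^ E y) powi m"
      by (simp add: mult.commute flip: power_int_of_nat power_int_mult)
    then show ?thesis using \<zeta>1 by simp
  qed
  then have tE: "t v ^ E y = inverse (\<sigma> v)" for v by (simp add: t_def power_mult_distrib t0)
  have "(\<Prod>v\<in>S. t v powi (- (sg v * int (E v)))) = \<tau>y * (\<Prod>v\<in>S. \<zeta> powi (k v * int (E v)))"
    unfolding \<tau>y_def prod.distrib[symmetric]
  proof (rule prod.cong)
    fix v
    have "(\<zeta> powi (- (sg v * k v))) powi (- (sg v * int (E v))) = \<zeta> powi ((sg v * sg v) * (k v * int (E v)))"
      by (simp add: mult_ac flip: power_int_mult)
    then show "t v powi (- (sg v * int (E v))) = t0 v powi (- (sg v * int (E v))) * \<zeta> powi (k v * int (E v))"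
      by (simp add: t_def power_int_mult_distrib sg)
  qed simp
  also have "(\<Prod>v\<in>S. \<zeta> powi (k v * int (E v))) = \<zeta> powi (\<Sum>v\<in>S. k v * int (E v))"
    using S(1) \<zeta>0 by (induction S rule: finite_induct) (auto simp: power_int_add)
  also have "\<dots> = \<zeta>"
  proof -
    have "\<zeta> powi (k y * int (E y)) = (\<zeta> ^ E y) powi k y"
      by (simp add: mult.commute flip: power_int_of_nat power_int_mult)
    then show ?thesis unfolding kE using \<zeta>0 \<zeta>1 by (simp add: power_int_diff)
  qed
  finally have ty: "(\<Prod>v\<in>S. t v powi (- (sg v * int (E v)))) = \<sigma> y" using \<tau>y0 by (simp add: \<zeta>_def)
  define \<tau> where "\<tau> u = (\<Prod>v\<in>S. t v powi wt_V y v u) * (\<Prod>w\<in>W. inverse (\<sigma> w) powi wt_W w u)" for u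
  have n\<tau>: "normal D \<tau>"
    unfolding \<tau>_def using nV nW tn \<sigma>0 S(1) fin
    by (intro normal_mult normal_prod D) (auto simp: S_def)
  have eqS: "\<tau> u = \<sigma> u" if u: "u \<in> S" for u
  proof -
    have "(\<Prod>v\<in>S. t v powi wt_V y v u) = (\<Prod>v\<in>S. if v = u then t u powi (- int (E y)) else 1)"
      using u disj by (intro prod.cong) (auto simp: wt_V_def S_def)
    also have "\<dots> = \<sigma> u" using u S(1) tE by (simp add: power_int_minus power_int_of_nat)
    finally have "(\<Prod>v\<in>S. t v powi wt_V y v u) = \<sigma> u" .
    moreover have "(\<Prod>w\<in>W. inverse (\<sigma> w) powi wt_W w u) = 1"
      using u disj by (intro prod.neutral) (auto simp: wt_W_def S_def)
    ultimately show ?thesis by (simp add: \<tau>_def)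
  qed
  have eqy: "\<tau> y = \<sigma> y"
  proof -
    have "(\<Prod>v\<in>S. t v powi wt_V y v y) = (\<Prod>v\<in>S. t v powi (- (sg v * int (E v))))"
      using y disj by (intro prod.cong) (auto simp: wt_V_def S_def sg_def)
    moreover have "(\<Prod>w\<in>W. inverse (\<sigma> w) powi wt_W w y) = 1"
      using y disj by (intro prod.neutral) (auto simp: wt_W_def)
    ultimately show ?thesis by (simp add: \<tau>_def ty)
  qed
  have eqW: "\<tau> w = \<sigma> w" if w: "w \<in> W" for w
  proof -
    have "(\<Prod>v\<in>S. t v powi wt_V y v w) = 1"
      using w y disj by (intro prod.neutral) (auto simp: wt_V_def S_def)
    moreover have "(\<Prod>w'\<in>W. inverse (\<sigma> w') powi wt_W w' w) = (\<Prod>w'\<in>W. if w' = w then \<sigma> w else 1)"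
      using w disj by (intro prod.cong) (auto simp: wt_W_def power_int_minus)
    ultimately show ?thesis using w fin by (simp add: \<tau>_def)
  qed
  have eq: "\<tau> u = \<sigma> u" if "u \<in> V0 \<union> V1 \<union> W" for u
  proof -
    have "u = y \<or> u \<in> S \<or> u \<in> W" using that S(3) by blast
    then show ?thesis using eqS eqy eqW by auto
  qed
  have "mval e V0 \<tau> = \<tau> z * mval e W \<tau>" "mval e V0 \<sigma> = \<sigma> z * mval e W \<sigma>"
    using n\<tau> \<sigma> by (auto simp: normal_def tor_def tor'_def)
  moreover have "mval e V0 \<tau> = mval e V0 \<sigma>" "mval e W \<tau> = mval e W \<sigma>" using eq by (auto intro!: mval_cong)
  moreover have "mval e W \<sigma> \<noteq> 0" using \<sigma>0 by (intro mval_nonzero) auto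
  ultimately have "\<tau> z = \<sigma> z" by simp
  then show ?thesis using eq by (intro normal_cong[OF n\<tau>]) auto
qed

end

subsection \<open>Derivations normalized by the torus\<close>

context trinomial_hypersurface
begin

text \<open>A flow line through a point with f nonzero never meets the zeros of f, so f is a
  rootless polynomial on it and hence constant. In the applications f is a coordinate, and
  \<open>van\<close> comes from weights or from density.\<close>

lemma lnd_kernel_of_zeros:
  assumes D: "lnd_on_affine I X D" and f: "f \<in> A"
    and van: "\<And>q m. q \<in> X \<Longrightarrow> f q = 0 \<Longrightarrow> (D ^^ m) f q = 0"
  shows "D f = (\<lambda>_. 0)"
proof
  interpret lnd_on_affine I X D by (rule D)
  fix p show "D f p = 0"
  proof (cases "p \<in> X \<and> f p \<noteq> 0")
    case True
    then have "poly (flow p f) r \<noteq> 0" for r using flow_rootless[OF f _ _ van] by blast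
    then have "degree (flow p f) = 0" using alg_closed_imp_poly_has_root[of "flow p f"] by blast
    then show ?thesis by (rule degree_flow_D[OF f])
  next
    case False
    then show ?thesis using van[of p 1] coord_algebra_zero_outside[OF D_closed[OF f]] by auto
  qed
qed

theorem torus_normalized_lnd_zero:
  assumes D: "lnd_on_affine I X D" and Dz: "D (crd z) = (\<lambda>_. 0)"
    and norm: "\<And>\<sigma>. \<sigma> \<in> tor \<Longrightarrow> normal D \<sigma>"
    and parity: "\<not> ((\<forall>v\<in>V0. even (e v)) \<and> (\<exists>v\<in>V0. e v = 2))"
    and f: "f \<in> A"
  shows "D f = (\<lambda>_. 0)"
proof -
  interpret lnd_on_affine I X D by (rule D)
  define C where "C p v = flow p (crd v)" for p v
  define \<alpha> where "\<alpha> p = mval E V0 (C p)" for p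
  define \<beta> where "\<beta> p = mval E V1 (C p)" for p
  have Cev: "poly (C p v) s = curve p s v" if "v \<in> I" for p v s
    using that by (simp add: C_def curve_def)
  have C_at: "poly (C p v) 0 = p v" if "v \<in> I" "p \<in> X" for p v
    using that by (simp add: C_def poly_flow_0 crd_in) (simp add: res_def)
  have mC: "poly (mval k S (C p)) s = mval k S (curve p s)" if "S \<subseteq> I" for k S p s
    unfolding poly_mval using that Cev by (intro mval_cong) auto
  have Cz: "C p z = [:p z:]" if p: "p \<in> X" for p
  proof -
    have "pderiv (C p z) = 0" using Dz by (simp add: C_def pderiv_flow crd_in)
    then obtain c where "C p z = [:c:]" by (metis degree_eq_zeroE pderiv_eq_0_iff)
    then show ?thesis using C_at[OF _ p, of z] by simp
  qed
  \<comment> \<open>The equation of X along a flow line. Because z is constant there, it enters only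
    as a scalar.\<close>
  have eqC: "mval e V0 (C p) + mval e V1 (C p) + smult (p z) (mval e W (C p)) = 0" if p: "p \<in> X" for p
  proof (rule poly_eqI_infinite[of "{}"])
    fix s
    have "curve p s z = p z" using Cev[of z p s] Cz[OF p] by simp
    then show "poly (mval e V0 (C p) + mval e V1 (C p) + smult (p z) (mval e W (C p))) s = poly 0 s"
      using curve_in[OF p, of s] mC subI by (simp add: in_X)
  qed simp
  have pw: "mval e V0 (C p) = \<alpha> p ^ d" "mval e V1 (C p) = \<beta> p ^ d" for p
    by (simp_all add: \<alpha>_def \<beta>_def mval_e_E)
  have z0: "p z \<noteq> 0" if "p \<in> X0" for p using X0_nonzero[OF that] by simp
  have C0: "C p v \<noteq> 0" if "p \<in> X0" "v \<in> I" for p v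
    using C_at[OF that(2) X0_in[OF that(1)]] X0_nonzero[OF that] by auto
  \<comment> \<open>A vanishing Wronskian says that x'/y' is constant along the flow line; a line
    where it is not constant is excluded by \<open>no_transversal_curve\<close>.\<close>
  have "\<forall>p\<in>X0. pderiv (\<alpha> p) * \<beta> p = \<alpha> p * pderiv (\<beta> p)"
  proof (rule ccontr)
    assume "\<not> (\<forall>p\<in>X0. pderiv (\<alpha> p) * \<beta> p = \<alpha> p * pderiv (\<beta> p))"
    then obtain p where p: "p \<in> X0" "pderiv (\<alpha> p) * \<beta> p \<noteq> \<alpha> p * pderiv (\<beta> p)" by blast
    note pX = X0_in[OF p(1)]
    have symm: "\<exists>\<chi>. \<chi> \<noteq> 0 \<and> (\<forall>v\<in>I. \<forall>s. poly (C p v) (s2 + \<chi> * s) = \<sigma> v * poly (C p v) (s1 + s))"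
      if \<sigma>: "\<sigma> \<in> tor" and c: "curve p s2 = scale I \<sigma> (curve p s1)" for \<sigma> s1 s2
    proof -
      obtain \<chi> where \<chi>: "\<chi> \<noteq> 0" "normalizes I X D \<sigma> \<chi>" using norm[OF \<sigma>] by (auto simp: normal_def)
      have "\<sigma> \<in> diag_sym I X" using \<sigma> tor'_diag_sym by (auto simp: tor_def)
      then show ?thesis using flow_translate_symmetry[OF _ _ \<chi>(2) pX c] \<chi>(1) unfolding C_def by blast
    qed
    show False
    proof (rule no_transversal_curve[OF finI _ e2 d_pos e_eq C0[OF p(1)] z0[OF p(1)] eqC[OF pX] _ _ _ parity])
      show "V0 \<union> V1 \<union> W \<subseteq> I" by auto
      show "pderiv (mval E V0 (C p)) * mval E V1 (C p) \<noteq> mval E V0 (C p) * pderiv (mval E V1 (C p))"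
        using p(2) by (simp add: \<alpha>_def \<beta>_def)
    next
      fix s1 s2
      assume n1: "\<And>v. v \<in> I \<Longrightarrow> poly (C p v) s1 \<noteq> 0" and n2: "\<And>v. v \<in> I \<Longrightarrow> poly (C p v) s2 \<noteq> 0"
        and ab: "poly (mval E V0 (C p)) s1 * poly (mval E V1 (C p)) s2
          = poly (mval E V0 (C p)) s2 * poly (mval E V1 (C p)) s1"
      let ?p1 = "curve p s1" and ?p2 = "curve p s2"
      \<comment> \<open>The only diagonal map that carries one point to the other. Equality of the
        ratios x'/y' gives the relation between a and b, and the equation of X at both points takes
        care of the third term.\<close>
      define \<sigma> where "\<sigma> v = ?p2 v / ?p1 v" for v
      have nz: "?p1 v \<noteq> 0" "?p2 v \<noteq> 0" if "v \<in> I" for v using n1 n2 that Cev by metis+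
      have mnz: "mval k S ?p1 \<noteq> 0" if "S \<subseteq> I" for k S using that nz by (intro mval_nonzero) auto
      have m\<sigma>: "mval k S \<sigma> = mval k S ?p2 / mval k S ?p1" for k S
        by (simp add: mval_def \<sigma>_def power_divide prod_dividef)
      have E01: "mval E V0 \<sigma> = mval E V1 \<sigma>"
        using ab mnz subI by (simp add: m\<sigma> mC field_simps)
      then have e01: "mval e V0 \<sigma> = mval e V1 \<sigma>" by (simp add: mval_e_E)
      have "mval e S ?p2 = mval e S \<sigma> * mval e S ?p1" if "S \<subseteq> I" for S
        using mnz[OF that, of e] by (simp add: m\<sigma>)
      from this[OF subI(1)] this[OF subI(2)]
      have "mval e V0 ?p2 = mval e V0 \<sigma> * mval e V0 ?p1" "mval e V1 ?p2 = mval e V0 \<sigma> * mval e V1 ?p1"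
        using e01 by simp_all
      moreover have "mval e V0 ?p1 + mval e V1 ?p1 + ?p1 z * mval e W ?p1 = 0"
        "mval e V0 ?p2 + mval e V1 ?p2 + ?p2 z * mval e W ?p2 = 0"
        using curve_in[OF pX] by (auto simp: in_X)
      ultimately have "?p2 z * mval e W ?p2 = mval e V0 \<sigma> * (?p1 z * mval e W ?p1)" by algebra
      then have "\<sigma> z * mval e W \<sigma> = mval e V0 \<sigma>"
        using nz[of z] mnz[of W e] subI by (simp add: m\<sigma>[of e W] \<sigma>_def[of z] field_simps)
      then have \<sigma>: "\<sigma> \<in> tor" using E01 e01 nz by (auto simp: tor_def tor'_def \<sigma>_def)
      have "?p2 = scale I \<sigma> ?p1"
        using nz by (auto simp: scale_def \<sigma>_def curve_def fun_eq_iff)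
      from symm[OF \<sigma> this] show "\<exists>\<chi> \<sigma>. \<chi> \<noteq> 0 \<and> (\<forall>v\<in>I. \<sigma> v \<noteq> 0) \<and> mval E V0 \<sigma> = mval E V1 \<sigma> \<and>
        (\<forall>v\<in>I. \<forall>s. poly (C p v) (s2 + \<chi> * s) = \<sigma> v * poly (C p v) (s1 + s))"
        using \<sigma> by (auto simp: tor_def tor'_def)
    next
      fix s0
      show "\<not> (poly (mval E V0 (C p)) s0 = 0 \<and> poly (mval E V1 (C p)) s0 = 0)"
      proof
        assume ab0: "poly (mval E V0 (C p)) s0 = 0 \<and> poly (mval E V1 (C p)) s0 = 0"
        let ?q = "curve p s0"
        obtain x where x: "x \<in> V0" "poly (C p x) s0 = 0"
          using ab0 fin E_pos by (auto simp: poly_mval mval_eq_0_iff)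
        obtain y where y: "y \<in> V1" "poly (C p y) s0 = 0"
          using ab0 fin E_pos by (auto simp: poly_mval mval_eq_0_iff)
        have "poly (mval e V0 (C p) + mval e V1 (C p) + smult (p z) (mval e W (C p))) s0 = 0"
          by (simp add: eqC[OF pX])
        then have "poly (mval e W (C p)) s0 = 0"
          using ab0 z0[OF p(1)] d_pos by (simp add: mval_e_E power_0_left)
        then obtain w where w: "w \<in> W" "poly (C p w) s0 = 0"
          using fin e_pos by (auto simp: poly_mval mval_eq_0_iff)
        have ne: "x \<noteq> y" "x \<noteq> w" "y \<noteq> w" "x \<noteq> z" "y \<noteq> z" "w \<noteq> z" "x \<notin> V1" "x \<notin> W" "y \<notin> V0" "y \<notin> W" "w \<notin> V0" "w \<notin> V1"
          using x y w disj by auto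
        (* The one-parameter group with weights \<omega> fixes ?q, so it acts on the flow line through ?q by infinitely
           many different dilations with centre s0. *)
        define \<omega> :: "'v \<Rightarrow> int" where "\<omega> = (\<lambda>_. 0)(x := int (e y * e w), y := int (e x * e w), w := int (e x * e y))"
        have sum\<omega>: "(\<Sum>v\<in>S. int (k v) * \<omega> v) = int (k u) * \<omega> u"
          if "u \<in> S" "finite S" "\<And>v. v \<in> S \<Longrightarrow> v \<noteq> u \<Longrightarrow> \<omega> v = 0" for S u k
          using that by (subst sum.remove[of S u]) (auto intro!: sum.neutral)
        have \<omega>v: "\<omega> x = int (e y * e w)" "\<omega> y = int (e x * e w)" "\<omega> w = int (e x * e y)" "\<omega> z = 0"
          using ne by (auto simp: \<omega>_def)
        have \<omega>0: "\<omega> v = 0" if "v \<noteq> x" "v \<noteq> y" "v \<noteq> w" for v using that by (simp add: \<omega>_def)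
        have s0: "(\<Sum>v\<in>V0. int (k v) * \<omega> v) = int (k x) * \<omega> x" for k
          by (rule sum\<omega>[OF x(1) fin(1) \<omega>0]) (use ne in auto)
        have s1: "(\<Sum>v\<in>V1. int (k v) * \<omega> v) = int (k y) * \<omega> y" for k
          by (rule sum\<omega>[OF y(1) fin(2) \<omega>0]) (use ne in auto)
        have s2: "(\<Sum>v\<in>W. int (k v) * \<omega> v) = int (k w) * \<omega> w" for k
          by (rule sum\<omega>[OF w(1) fin(3) \<omega>0]) (use ne in auto)
        \<comment> \<open>All three terms of the equation have weight e_x e_y e_w, while z, which is
          nonzero on the line, has weight 0.\<close>
        have t\<omega>: "(\<lambda>v. t powi \<omega> v) \<in> tor" if t: "t \<noteq> 0" for t
        proof -
          have "(\<lambda>v. t powi \<omega> v) \<in> tor'"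
            by (rule weight_tor'[OF s0 _ _ t]) (simp_all only: s1 s2 \<omega>v, simp_all add: mult_ac)
          moreover have "int (E x) * int (e y * e w) = int (E y) * int (e x * e w)"
            using e_eq[of x] e_eq[of y] x(1) y(1) by (simp add: mult_ac)
          then have "mval E V0 (\<lambda>v. t powi \<omega> v) = mval E V1 (\<lambda>v. t powi \<omega> v)"
            by (simp only: mval_powi[OF t] s0 s1 \<omega>v)
          ultimately show ?thesis by (simp add: tor_def)
        qed
        have fixq: "?q = scale I (\<lambda>v. t powi \<omega> v) ?q" for t
          using x y w Cev by (auto simp: scale_def \<omega>_def curve_def C_def fun_eq_iff)
        have "\<forall>t. \<exists>\<chi>. t \<noteq> 0 \<longrightarrow> \<chi> \<noteq> 0 \<and> (\<forall>v\<in>I. \<forall>s. poly (C p v) (s0 + \<chi> * s) = t powi \<omega> v * poly (C p v) (s0 + s))"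
          using symm[OF t\<omega> fixq] by blast
        then obtain \<chi> where \<chi>: "\<And>t. t \<noteq> 0 \<Longrightarrow> \<chi> t \<noteq> 0"
          "\<And>t v s. t \<noteq> 0 \<Longrightarrow> v \<in> I \<Longrightarrow> poly (C p v) (s0 + \<chi> t * s) = t powi \<omega> v * poly (C p v) (s0 + s)"
          by metis
        define N where "N v = pcompose (C p v) [:s0, 1:]" for v
        have Np: "poly (N v) s = poly (C p v) (s0 + s)" for v s by (simp add: N_def poly_pcompose)
        have N0: "N v \<noteq> 0" if "v \<in> I" for v
          unfolding N_def using C0[OF p(1) that] pcompose_eq_0[of "C p v" "[:s0, 1:]"] by auto
        define m where "m = e y * e w"
        have m0: "m > 0" using e_pos[of y] e_pos[of w] y w by (simp add: m_def)
        \<comment> \<open>Comparing leading coefficients of the coordinate x ties \<chi> to t;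
          consequently \<chi> takes infinitely many values.\<close>
        have lead: "\<chi> t ^ degree (N x) = t ^ m" if t: "t \<noteq> 0" for t
        proof -
          have "pcompose (N x) [:0, \<chi> t:] = smult (t ^ m) (N x)"
          proof (rule poly_eqI_infinite[of "{}"])
            fix s
            have "\<omega> x = int m" using ne by (simp add: \<omega>_def m_def)
            then show "poly (pcompose (N x) [:0, \<chi> t:]) s = poly (smult (t ^ m) (N x)) s"
              using \<chi>(2)[OF t, of x s] x(1) by (simp add: poly_pcompose Np mult.commute power_int_of_nat)
          qed simp
          from arg_cong[OF this, of "\<lambda>p. coeff p (degree (N x))"]
          have "\<chi> t ^ degree (N x) * lead_coeff (N x) = t ^ m * lead_coeff (N x)"
            by (simp add: coeff_pcompose_linear)
          then show ?thesis using N0[of x] x(1) by simp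
        qed
        \<comment> \<open>A nonzero root r would put all products \<chi> t * r among the finitely
          many roots of the coordinate, so t^m could take only finitely many values.\<close>
        have only0: "r = 0" if u: "u \<in> I" and r: "poly (N u) r = 0" for u r
        proof (rule ccontr)
          assume r0: "r \<noteq> 0"
          define R where "R = (\<lambda>r'. r' / r) ` {r'. poly (N u) r' = 0}"
          have R: "finite R" unfolding R_def using N0[OF u] by (simp add: poly_roots_finite)
          have "\<chi> t \<in> R" if t: "t \<noteq> 0" for t
          proof -
            have "poly (N u) (\<chi> t * r) = 0" using \<chi>(2)[OF t u, of r] r by (simp add: Np)
            then show ?thesis using r0 unfolding R_def by (intro image_eqI[of _ _ "\<chi> t * r"]) auto
          qed
          then have "t \<in> (\<Union>c\<in>R. {t. poly (monom 1 m - [:c ^ degree (N x):]) t = 0})" if "t \<noteq> 0" for t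
            using lead[OF that] that by (intro UN_I[of "\<chi> t"]) (simp_all add: poly_monom)
          then have "UNIV \<subseteq> insert 0 (\<Union>c\<in>R. {t. poly (monom 1 m - [:c ^ degree (N x):]) t = 0})" by blast
          moreover have "monom 1 m - [:c:] \<noteq> 0" for c :: 'a
          proof
            assume "monom 1 m - [:c:] = 0"
            then have "coeff (monom 1 m - [:c:]) m = 0" by simp
            then show False using m0 by (simp add: coeff_pCons split: nat.splits)
          qed
          then have "finite (insert 0 (\<Union>c\<in>R. {t. poly (monom 1 m - [:c ^ degree (N x):]) t = 0}))"
            using R by (simp only: finite_insert) (intro finite_UN_I poly_roots_finite)
          ultimately show False using infinite_UNIV_char_0[where 'a = 'a] finite_subset by blast
        qed
        have mono: "\<exists>c k. c \<noteq> 0 \<and> N v = monom c k" if "v \<in> I" for v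
          using only_root_zero_monom[OF N0[OF that] only0[OF that]] .
        have mN: "mval k S N = pcompose (mval k S (C p)) [:s0, 1:]" for k S
          by (simp add: mval_def N_def pcompose_prod pcompose_power)
        obtain a i where a: "a \<noteq> 0" "mval E V0 N = monom a i" using mval_monomials[of V0 N E] mono by blast
        obtain b j where b: "b \<noteq> 0" "mval E V1 N = monom b j" using mval_monomials[of V1 N E] mono by blast
        obtain c k where c: "c \<noteq> 0" "mval e W N = monom c k" using mval_monomials[of W N e] mono by blast
        have "mval e V0 N + mval e V1 N + smult (p z) (mval e W N) = 0"
          using arg_cong[OF eqC[OF pX], of "\<lambda>q. pcompose q [:s0, 1:]"]
          by (simp add: mN pcompose_add pcompose_smult)
        then have "monom a i ^ d + monom b j ^ d + monom (p z * c) k = 0"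
          by (simp add: mval_e_E a b c smult_monom)
        then have "pderiv (monom a i) * monom b j = monom a i * pderiv (monom b j)"
          by (rule monomial_trinomial_wronskian) (use a b c z0[OF p(1)] d_pos in auto)
        then have w: "pderiv (pcompose (\<alpha> p) [:s0, 1:]) * pcompose (\<beta> p) [:s0, 1:]
            = pcompose (\<alpha> p) [:s0, 1:] * pderiv (pcompose (\<beta> p) [:s0, 1:])"
          unfolding a(2)[symmetric] b(2)[symmetric] by (simp add: mN \<alpha>_def \<beta>_def)
        have pd: "pderiv (pcompose q [:s0, 1:]) = pcompose (pderiv q) [:s0, 1:]" for q :: "'a poly"
          by (simp add: pderiv_pcompose pderiv_pCons)
        have "pcompose (pderiv (\<alpha> p) * \<beta> p - \<alpha> p * pderiv (\<beta> p)) [:s0, 1:] = 0"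
          using w unfolding pd by (simp add: pcompose_mult pcompose_diff)
        then have "pderiv (\<alpha> p) * \<beta> p - \<alpha> p * pderiv (\<beta> p) = 0"
          by (rule pcompose_eq_0) simp
        then show False using p(2) by simp
      qed
    qed (use e_eq in auto)
  qed
  (* From now on \<alpha> / \<beta> is constant on every flow line. *)
  then have wr0: "pderiv (\<alpha> p) * \<beta> p = \<alpha> p * pderiv (\<beta> p)" if "p \<in> X0" for p using that by blast
  \<comment> \<open>x' and y' as functions on X, with flows \<open>\<alpha>\<close> and
    \<open>\<beta>\<close>. In this form the Wronskian is an element of K[X], and its vanishing
    spreads from \<open>X0\<close> to all of X.\<close>
  define fa where "fa = res X (mval E V0)"
  define fb where "fb = res X (mval E V1)"
  have fab: "fa \<in> A" "fb \<in> A" unfolding fa_def fb_def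
    using fin by (auto intro!: res_in_coord_algebra mval_poly_function)
  have flow_fab: "flow p fa = \<alpha> p" "flow p fb = \<beta> p" if p: "p \<in> X" for p
  proof -
    have "flow p (res X (mval E S)) = mval E S (C p)" if S: "S \<subseteq> I" "finite S" for S
      by (rule poly_eqI_infinite[of "{}"])
        (simp_all add: mC[OF S(1)] poly_flow_poly_function[OF mval_poly_function[OF S(2,1)] p])
    then show "flow p fa = \<alpha> p" "flow p fb = \<beta> p" using fin by (auto simp: fa_def fb_def \<alpha>_def \<beta>_def)
  qed
  have "(\<lambda>q. D fa q * fb q - fa q * D fb q) = (\<lambda>_. 0)"
  proof (rule dense_X0)
    show "(\<lambda>q. D fa q * fb q - fa q * D fb q) \<in> A"
      by (intro coord_algebra_diff coord_algebra_mult D_closed fab)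
    fix p assume p: "p \<in> X0"
    have "poly (pderiv (\<alpha> p) * \<beta> p) 0 = poly (\<alpha> p * pderiv (\<beta> p)) 0" using wr0[OF p] by simp
    then show "D fa p * fb p - fa p * D fb p = 0"
      unfolding flow_fab[OF X0_in[OF p], symmetric] by (simp add: pderiv_flow fab poly_flow_0 D_closed)
  qed
  then have g0: "D fa q * fb q = fa q * D fb q" for q by (simp add: fun_eq_iff)
  have wr: "pderiv (\<alpha> q) * \<beta> q = \<alpha> q * pderiv (\<beta> q)" if q: "q \<in> X" for q
  proof (rule poly_eqI_infinite[of "{}"])
    fix s show "poly (pderiv (\<alpha> q) * \<beta> q) s = poly (\<alpha> q * pderiv (\<beta> q)) s"
      unfolding flow_fab[OF q, symmetric]
      using g0 q by (simp add: pderiv_flow fab poly_flow D_closed)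
  qed simp
  have wre: "pderiv (mval e V0 (C q)) * mval e V1 (C q) = mval e V0 (C q) * pderiv (mval e V1 (C q))"
    if "q \<in> X" for q unfolding pw by (rule wronskian_power[OF wr[OF that]])
  have Dw: "D (crd w) = (\<lambda>_. 0)" if w: "w \<in> W" for w
  proof (rule lnd_kernel_of_zeros[OF D])
    show wA: "crd w \<in> A" using w by (intro crd_in) auto
    have cw: "crd w q = q w" if "q \<in> X" for q using that by (simp add: res_def)
    fix q m assume q: "q \<in> X" "crd w q = 0"
    show "(D ^^ m) (crd w) q = 0"
    proof (rule dense_divisor[OF Dn_closed[OF wA] w _ q(1)])
      show "q w = 0" using q cw by simp
      fix p assume p: "p \<in> X" "p w = 0" "\<And>v. v \<in> I \<Longrightarrow> v \<noteq> w \<Longrightarrow> p v \<noteq> 0"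
      \<comment> \<open>The Wronskian identity passes from a, b to P, b because z is a nonzero
        constant. As b is nonzero at p and P is zero there, P vanishes on the whole flow line; the
        factor responsible can only be w.\<close>
      let ?M = "mval e W (C p)" and ?B = "mval e V1 (C p)"
      have wz: "w \<noteq> z" "w \<notin> V0" "w \<notin> V1" using w disj by auto
      have "p z \<noteq> 0" using p(3)[of z] wz by auto
      have a: "mval e V0 (C p) = - (?B + smult (p z) ?M)"
        using eqC[OF p(1)] by (simp only: eq_neg_iff_add_eq_0 add.assoc)
      have "smult (p z) (pderiv ?M * ?B) = smult (p z) (?M * pderiv ?B)"
        using wre[OF p(1)] unfolding a pderiv_minus pderiv_add pderiv_smult by (simp add: algebra_simps)
      then have MB: "pderiv ?M * ?B = ?M * pderiv ?B" using \<open>p z \<noteq> 0\<close> by (metis smult_eq_iff)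
      have at0: "poly (mval k S (C p)) 0 = mval k S p" if "S \<subseteq> I" for k S
        unfolding poly_mval using that C_at[OF _ p(1)] by (intro mval_cong) auto
      have "mval e V1 p \<noteq> 0" using p(3) wz by (intro mval_nonzero) auto
      then have B0: "poly ?B 0 \<noteq> 0" using at0[OF subI(2), of e] by simp
      then have "?B \<noteq> 0" by (metis poly_0)
      then obtain c where c: "?M = smult c ?B" using wronskian_zero_imp_proportional[OF MB] by blast
      have "poly ?M 0 = 0" using at0[OF subI(3), of e] p(2) w fin e_pos by (auto simp: mval_eq_0_iff)
      then have "c = 0" using B0 unfolding c by simp
      then have "?M = 0" unfolding c by simp
      then obtain u where u: "u \<in> W" "C p u = 0" using fin(3) by (auto simp: mval_def)
      then have "p u = 0" using C_at[of u p] p(1) by auto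
      then have "u = w" using p(3)[of u] u by auto
      then have "flow p (crd w) = 0" using u by (simp add: C_def)
      then show "(D ^^ m) (crd w) p = 0" using coeff_flow[OF wA, of p m] by simp
    qed
  qed
  have Dv: "D (crd v) = (\<lambda>_. 0)" if v: "v \<in> V0 \<union> V1" for v
  proof (rule dense_X0)
    show "D (crd v) \<in> A" using v by (intro D_closed crd_in) auto
    fix p assume p: "p \<in> X0"
    note pX = X0_in[OF p]
    have "degree (C p w) = 0" if "w \<in> W" for w
      using Dw[OF that] that by (simp add: C_def pderiv_flow crd_in flip: pderiv_eq_0_iff)
    then have "C p w = [:p w:]" if "w \<in> W" for w
      using that C_at[OF _ pX, of w] by (metis degree_eq_zeroE poly_pCons mult_zero_left add_0_right UnCI insertCI)
    then have M: "mval e W (C p) = [:mval e W p:]"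
      unfolding mval_const_poly[symmetric] by (intro mval_cong)
    have M0: "mval e W p \<noteq> 0" using X0_nonzero[OF p] by (intro mval_nonzero) auto
    \<comment> \<open>With w and z constant, a + b is a nonzero constant. Together with the
      vanishing Wronskian this gives a' (a + b) = 0, so a and b are constant, and so are the
      coordinates dividing them.\<close>
    let ?a = "mval e V0 (C p)" and ?b = "mval e V1 (C p)" and ?c = "- (p z * mval e W p)"
    have "?a + ?b = - smult (p z) [:mval e W p:]" using eqC[OF pX] unfolding M by (simp only: eq_neg_iff_add_eq_0)
    then have ab: "?a + ?b = [:?c:]" by simp
    have c0: "?c \<noteq> 0" using M0 z0[OF p] by simp
    have "pderiv ?a + pderiv ?b = 0" using arg_cong[OF ab, of pderiv] by (simp add: pderiv_add pderiv_pCons)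
    then have d: "pderiv ?b = - pderiv ?a" by (simp add: add_eq_0_iff)
    have "pderiv ?a * (?a + ?b) = 0"
      using wre[OF pX] unfolding d by (simp add: algebra_simps)
    then have da: "pderiv ?a = 0" using c0 unfolding ab by auto
    then have degs: "degree ?a = 0" "degree ?b = 0" using d by (simp_all flip: pderiv_eq_0_iff)
    have "degree (C p v) = 0" if "v \<in> S" "finite S" "S \<subseteq> V0 \<union> V1 \<union> W" "degree (mval e S (C p)) = 0" for S
    proof -
      have "mval e S (C p) \<noteq> 0" using that(3) C0[OF p] by (intro mval_nonzero) auto
      moreover have "C p v dvd mval e S (C p)"
        using mval_remove[OF that(2,1), of e "C p"] e_pos[of v] that(1,3) by (auto intro: dvd_mult2 dvd_power)
      ultimately show ?thesis using that(4) by (metis dvd_imp_degree_le le_zero_eq)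
    qed
    then have "degree (C p v) = 0" using v fin degs by blast
    then show "D (crd v) p = 0" using v unfolding C_def by (intro degree_flow_D crd_in) auto
  qed
  show ?thesis
    by (rule D_eq_zeroI[OF _ f]) (use Dv Dw Dz in auto)
qed

end

subsection \<open>Locally nilpotent derivations of the trinomial hypersurface\<close>

text \<open>Along c the function f is a polynomial in t, so the equality for nonzero t extends to t
  = 0, where the factor t^m vanishes.\<close>

lemma scaled_limit_zero:
  fixes f :: "('v \<Rightarrow> 'a::field_char_0) \<Rightarrow> 'a"
  assumes f: "f \<in> coord_algebra V X" and c: "\<And>t. t \<noteq> 0 \<Longrightarrow> c t \<in> X" "\<And>v. v \<in> V \<Longrightarrow> \<exists>Q. \<forall>t. c t v = poly Q t"
    and m: "m > 0" "\<And>t. t \<noteq> 0 \<Longrightarrow> a = t ^ m * f (c t)"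
  shows "a = 0"
proof -
  obtain F where F: "F \<in> poly_functions V" "f = res X F" using f by (auto simp: coord_algebra_eq)
  obtain R where R: "\<And>t. F (c t) = poly R t" using poly_functions_curve[OF F(1), of c] c(2) by blast
  have "[:a:] = monom 1 m * R"
  proof (rule poly_eqI_infinite[of "{0}"])
    fix t :: 'a assume "t \<notin> {0}"
    then have t: "t \<noteq> 0" by simp
    have "a = t ^ m * poly R t" using m(2)[OF t] c(1)[OF t] by (simp add: F(2) res_def R)
    then show "poly [:a:] t = poly (monom 1 m * R) t" by (simp add: poly_monom)
  qed simp
  then have "poly [:a:] 0 = poly (monom 1 m * R) 0" by simp
  then show ?thesis using m(1) by (simp add: poly_monom power_0_left)
qed

lemma (in weighted_set) below_mono: "below c f \<Longrightarrow> c \<le> c' \<Longrightarrow> below c' f"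
  unfolding below_def by (meson order_trans)

context trinomial_hypersurface
begin

lemma weighted_W: "w \<in> W \<Longrightarrow> weighted_set I X (wt_W w)"
  by (rule weighted_setI) (rule wt_W_tor')

lemma weighted_V: "y \<in> V1 \<Longrightarrow> v \<in> V0 \<union> V1 - {y} \<Longrightarrow> weighted_set I X (wt_V y v)"
  by (rule weighted_setI) (rule wt_V_tor')

text \<open>On w = 0 the one-parameter group moves only z, by the factor t^(e w), so the orbit of q
  extends to t = 0. Along it f equals t^k f(q) without a pole, which for negative k forces f(q) =
  0.\<close>

lemma negative_weight_vanishes:
  assumes w: "w \<in> W" and f: "weighted_set.graded I X (wt_W w) k f" "k < 0" and q: "q \<in> X" "q w = 0"
  shows "f q = 0"
proof -
  interpret weighted_set I X "wt_W w" by (rule weighted_W[OF w])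
  let ?c = "\<lambda>t. \<lambda>v\<in>I. if v = z then t ^ e w * q z else q v"
  have wz: "w \<noteq> z" using w disj by auto
  have c: "?c t = scale I (\<lambda>v. t powi wt_W w v) q" if "t \<noteq> 0" for t
    using q(2) wz by (auto simp: scale_def wt_W_def power_int_of_nat fun_eq_iff)
  have cX: "?c t \<in> X" if "t \<noteq> 0" for t
    unfolding c[OF that] by (rule diag_sym_scale[OF \<omega>_sym[OF that] q(1)])
  show ?thesis
  proof (rule scaled_limit_zero[OF graded_in[OF f(1)] cX])
    show "\<exists>Q. \<forall>t. ?c t v = poly Q t" if "v \<in> I" for v
    proof (cases "v = z")
      case True
      then show ?thesis by (intro exI[of _ "monom (q z) (e w)"]) (simp add: poly_monom mult.commute)
    next
      case False
      then show ?thesis using that by (intro exI[of _ "[:q v:]"]) simp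
    qed
    show "nat (- k) > 0" using f(2) by simp
    fix t :: 'a assume t: "t \<noteq> 0"
    have "f (?c t) = act t f q" unfolding c[OF t] using q(1) by (simp add: pull_def res_def)
    also have "\<dots> = t powi k * f q" using graded_act[OF f(1) t] by simp
    also have "t powi k = inverse (t ^ nat (- k))" using f(2) by (simp add: power_int_def power_inverse)
    finally have *: "f (?c t) = inverse (t ^ nat (- k)) * f q" .
    show "f q = t ^ nat (- k) * f (?c t)" unfolding * using t by simp
  qed
qed

text \<open>On z = 0 the group moves only w. With the inverse parameter the orbit of q extends to t
  = 0, and a positive weight would give a pole there unless f(q) = 0.\<close>

lemma positive_weight_vanishes:
  assumes w: "w \<in> W" and f: "weighted_set.graded I X (wt_W w) k f" "k > 0" and q: "q \<in> X" "q z = 0"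
  shows "f q = 0"
proof -
  interpret weighted_set I X "wt_W w" by (rule weighted_W[OF w])
  let ?c = "\<lambda>t. \<lambda>v\<in>I. if v = w then t * q w else q v"
  have wz: "w \<noteq> z" using w disj by auto
  have c: "?c t = scale I (\<lambda>v. inverse t powi wt_W w v) q" if "t \<noteq> 0" for t
    using q(2) wz by (auto simp: scale_def wt_W_def power_int_minus fun_eq_iff)
  have cX: "?c t \<in> X" if "t \<noteq> 0" for t
    unfolding c[OF that] using that by (intro diag_sym_scale[OF \<omega>_sym q(1)]) simp
  show ?thesis
  proof (rule scaled_limit_zero[OF graded_in[OF f(1)] cX])
    show "\<exists>Q. \<forall>t. ?c t v = poly Q t" if "v \<in> I" for v
    proof (cases "v = w")
      case True
      then show ?thesis using w by (intro exI[of _ "[:0, q w:]"]) simp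
    next
      case False
      then show ?thesis using that by (intro exI[of _ "[:q v:]"]) simp
    qed
    show "nat k > 0" using f(2) by simp
    fix t :: 'a assume t: "t \<noteq> 0"
    have "f (?c t) = act (inverse t) f q" unfolding c[OF t] using q(1) by (simp add: pull_def res_def)
    also have "\<dots> = inverse t powi k * f q" using graded_act[OF f(1), of "inverse t"] t by simp
    also have "inverse t powi k = inverse (t ^ nat k)" using f(2) by (simp add: power_int_def power_inverse)
    finally have *: "f (?c t) = inverse (t ^ nat k) * f q" .
    show "f q = t ^ nat k * f (?c t)" unfolding * using t by simp
  qed
qed

definition nonzero_lnd :: "((('v \<Rightarrow> 'a) \<Rightarrow> 'a) \<Rightarrow> ('v \<Rightarrow> 'a) \<Rightarrow> 'a) \<Rightarrow> bool"
  where "nonzero_lnd D \<longleftrightarrow> derivation A D \<and> (\<forall>f\<in>A. \<exists>n. (D ^^ n) f = (\<lambda>_. 0)) \<and> (\<exists>f\<in>A. D f \<noteq> (\<lambda>_. 0))"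

lemma lnd_on_affineI:
  assumes "derivation A D" "\<And>f. f \<in> A \<Longrightarrow> \<exists>n. (D ^^ n) f = (\<lambda>_. 0)"
  shows "lnd_on_affine I X D"
  by unfold_locales (use assms X_closed in auto)

lemma leading_component_nonzero_lnd:
  assumes "weighted_set I X \<omega>" "nonzero_lnd D"
  obtains k D' where "nonzero_lnd D'"
    "\<And>t. t \<noteq> 0 \<Longrightarrow> normalizes I X D' (\<lambda>v. t powi \<omega> v) (t powi (- k))"
    "\<And>\<sigma> \<chi>. \<sigma> \<in> diag_sym I X \<Longrightarrow> normalizes I X D \<sigma> \<chi> \<Longrightarrow> normalizes I X D' \<sigma> \<chi>"
    "\<And>c f. weighted_set.below I X \<omega> c f \<Longrightarrow> weighted_set.below I X \<omega> (c + k) (D f)"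
proof -
  interpret weighted_set I X \<omega> by fact
  interpret derivation_on I X D by unfold_locales (use assms(2) in \<open>simp add: nonzero_lnd_def\<close>)
  interpret weighted_derivation I X \<omega> D ..
  have nz: "\<And>f. f \<in> A \<Longrightarrow> \<exists>n. (D ^^ n) f = (\<lambda>_. 0)" "\<exists>f\<in>A. D f \<noteq> (\<lambda>_. 0)"
    using assms(2) by (auto simp: nonzero_lnd_def)
  show ?thesis
  proof (rule leading_component)
    show "\<exists>n. (D ^^ n) f = (\<lambda>_. 0)" if "f \<in> A" for f by (rule nz(1)[OF that])
    show "\<exists>f\<in>A. D f \<noteq> (\<lambda>_. 0)" by (rule nz(2))
    fix k E
    assume E: "derivation A E" "\<And>f. f \<in> A \<Longrightarrow> \<exists>n. (E ^^ n) f = (\<lambda>_. 0)"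
      "\<exists>f\<in>A. E f \<noteq> (\<lambda>_. 0)"
      and E': "\<And>t. t \<noteq> 0 \<Longrightarrow> normalizes I X E (\<lambda>v. t powi \<omega> v) (t powi (- k))"
      "\<And>\<sigma> \<chi>. \<sigma> \<in> diag_sym I X \<Longrightarrow> normalizes I X D \<sigma> \<chi> \<Longrightarrow> normalizes I X E \<sigma> \<chi>"
      "\<And>c f. below c f \<Longrightarrow> below (c + k) (D f)"
    have "nonzero_lnd E" using E by (simp add: nonzero_lnd_def)
    then show thesis using that E' by blast
  qed
qed

text \<open>Leading components are taken for one grading after another. The last conclusion carries
  the normalizations already obtained through the later steps.\<close>

lemma homogenize:
  assumes "finite \<Omega>" "\<And>\<omega>. \<omega> \<in> \<Omega> \<Longrightarrow> weighted_set I X \<omega>" "nonzero_lnd D"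
  obtains D' where "nonzero_lnd D'"
    "\<And>\<omega> t. \<omega> \<in> \<Omega> \<Longrightarrow> t \<noteq> 0 \<Longrightarrow> \<exists>\<chi>. \<chi> \<noteq> 0 \<and> normalizes I X D' (\<lambda>v. t powi \<omega> v) \<chi>"
    "\<And>\<sigma> \<chi>. \<sigma> \<in> diag_sym I X \<Longrightarrow> normalizes I X D \<sigma> \<chi> \<Longrightarrow> normalizes I X D' \<sigma> \<chi>"
  using assms
proof (induction \<Omega> arbitrary: thesis rule: finite_induct)
  case empty
  show ?case by (rule empty(1)[OF empty(3)]) auto
next
  case (insert \<omega> \<Omega>)
  have "\<exists>D'. nonzero_lnd D' \<and>
    (\<forall>\<omega>\<in>\<Omega>. \<forall>t. t \<noteq> 0 \<longrightarrow> (\<exists>\<chi>. \<chi> \<noteq> 0 \<and> normalizes I X D' (\<lambda>v. t powi \<omega> v) \<chi>)) \<and>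
    (\<forall>\<sigma> \<chi>. \<sigma> \<in> diag_sym I X \<longrightarrow> normalizes I X D \<sigma> \<chi> \<longrightarrow> normalizes I X D' \<sigma> \<chi>)"
    by (rule insert.IH) (use insert.prems in auto)
  then obtain D' where D': "nonzero_lnd D'"
    "\<And>\<omega> t. \<omega> \<in> \<Omega> \<Longrightarrow> t \<noteq> 0 \<Longrightarrow> \<exists>\<chi>. \<chi> \<noteq> 0 \<and> normalizes I X D' (\<lambda>v. t powi \<omega> v) \<chi>"
    "\<And>\<sigma> \<chi>. \<sigma> \<in> diag_sym I X \<Longrightarrow> normalizes I X D \<sigma> \<chi> \<Longrightarrow> normalizes I X D' \<sigma> \<chi>" by blast
  have w\<omega>: "weighted_set I X \<omega>" using insert.prems by auto
  obtain k D'' where D'': "nonzero_lnd D''"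
    "\<And>t. t \<noteq> 0 \<Longrightarrow> normalizes I X D'' (\<lambda>v. t powi \<omega> v) (t powi (- k))"
    "\<And>\<sigma> \<chi>. \<sigma> \<in> diag_sym I X \<Longrightarrow> normalizes I X D' \<sigma> \<chi> \<Longrightarrow> normalizes I X D'' \<sigma> \<chi>"
    using leading_component_nonzero_lnd[OF w\<omega> D'(1)] by metis
  show ?case
  proof (rule insert.prems(1)[OF D''(1)])
    fix \<omega>' and t :: 'a assume \<omega>': "\<omega>' \<in> insert \<omega> \<Omega>" and t: "t \<noteq> 0"
    show "\<exists>\<chi>. \<chi> \<noteq> 0 \<and> normalizes I X D'' (\<lambda>v. t powi \<omega>' v) \<chi>"
    proof (cases "\<omega>' = \<omega>")
      case True
      then show ?thesis using D''(2)[OF t] t by (intro exI[of _ "t powi (- k)"]) auto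
    next
      case False
      then have "\<omega>' \<in> \<Omega>" using \<omega>' by auto
      then obtain \<chi> where "\<chi> \<noteq> 0" "normalizes I X D' (\<lambda>v. t powi \<omega>' v) \<chi>" using D'(2) t by blast
      moreover have "(\<lambda>v. t powi \<omega>' v) \<in> diag_sym I X"
        using insert.prems(2)[OF \<omega>'] t by (simp add: weighted_set.\<omega>_sym)
      ultimately show ?thesis using D''(3) by blast
    qed
  qed (use D'(3) D''(3) in blast)
qed

theorem lnd_kernel_W:
  assumes D: "derivation A D" "\<And>f. f \<in> A \<Longrightarrow> \<exists>n. (D ^^ n) f = (\<lambda>_. 0)"
    and parity: "\<not> ((\<forall>v\<in>V0. even (e v)) \<and> (\<exists>v\<in>V0. e v = 2))" and w: "w \<in> W"
  shows "D (crd w) = (\<lambda>_. 0)"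
proof (rule ccontr)
  assume nz: "D (crd w) \<noteq> (\<lambda>_. 0)"
  have wA: "crd w \<in> A" using w by (intro crd_in) auto
  have nD: "nonzero_lnd D" using D nz wA by (auto simp: nonzero_lnd_def)
  interpret weighted_set I X "wt_W w" by (rule weighted_W[OF w])
  obtain k D1 where D1: "nonzero_lnd D1"
    "\<And>t. t \<noteq> 0 \<Longrightarrow> normalizes I X D1 (\<lambda>v. t powi wt_W w v) (t powi (- k))"
    "\<And>c f. below c f \<Longrightarrow> below (c + k) (D f)"
    using leading_component_nonzero_lnd[OF weighted_W[OF w] nD] by metis
  have wz: "wt_W w w = - 1" "wt_W w z = int (e w)" using w disj by (auto simp: wt_W_def)
  show False
  proof (cases "k \<le> 0")
    case True
    \<comment> \<open>For k at most 0 the derivation does not raise weights, and w has weight -1, so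
      all D^m w have only components of negative weight.\<close>
    have b: "below 0 ((D ^^ m) (crd w))" for m
    proof (induction m)
      case 0
      have "graded (- 1) (crd w)" using graded_crd[of w] w wz by auto
      then show ?case by (simp add: graded_below)
    next
      case (Suc m)
      then show ?case using below_mono[OF D1(3)[OF Suc.IH], of 0] True by simp
    qed
    have "D (crd w) = (\<lambda>_. 0)"
    proof (rule lnd_kernel_of_zeros[OF lnd_on_affineI[OF D] wA])
      fix q m assume q: "q \<in> X" "crd w q = 0"
      obtain S F where F: "\<And>k. graded k (F k)" "(D ^^ m) (crd w) = (\<lambda>p. \<Sum>k\<in>S. F k p)" "\<And>k. k \<in> S \<Longrightarrow> k < 0"
        using below_decomposition[OF b[of m]] by metis
      have "F k q = 0" if "k \<in> S" for k
        by (rule negative_weight_vanishes[OF w F(1) F(3)[OF that] q(1)]) (use q in \<open>simp add: res_def\<close>)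
      then show "(D ^^ m) (crd w) q = 0" unfolding F(2) by simp
    qed
    then show False using nz by simp
  next
    case False
    obtain y where y: "y \<in> V1" using V1_ne by blast
    \<comment> \<open>These are the gradings whose one-parameter groups generate
      \<open>tor\<close>.\<close>
    define \<Omega> where "\<Omega> = wt_V y ` (V0 \<union> V1 - {y}) \<union> wt_W ` W"
    have "finite \<Omega>" using fin by (simp add: \<Omega>_def)
    moreover have "weighted_set I X \<omega>" if "\<omega> \<in> \<Omega>" for \<omega>
      using that weighted_V[OF y] weighted_W unfolding \<Omega>_def by blast
    ultimately obtain D2 where D2: "nonzero_lnd D2"
      "\<And>\<omega> t. \<omega> \<in> \<Omega> \<Longrightarrow> t \<noteq> 0 \<Longrightarrow> \<exists>\<chi>. \<chi> \<noteq> 0 \<and> normalizes I X D2 (\<lambda>v. t powi \<omega> v) \<chi>"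
      "\<And>\<sigma> \<chi>. \<sigma> \<in> diag_sym I X \<Longrightarrow> normalizes I X D1 \<sigma> \<chi> \<Longrightarrow> normalizes I X D2 \<sigma> \<chi>"
      using homogenize[OF _ _ D1(1), of \<Omega>] by metis
    have der2: "derivation A D2" and nil2: "\<And>f. f \<in> A \<Longrightarrow> \<exists>n. (D2 ^^ n) f = (\<lambda>_. 0)"
      and nz2: "\<exists>f\<in>A. D2 f \<noteq> (\<lambda>_. 0)" using D2(1) by (auto simp: nonzero_lnd_def)
    note L2 = lnd_on_affineI[OF der2 nil2]
    interpret L2: lnd_on_affine I X D2 by (rule L2)
    have tor2: "normal D2 \<sigma>" if "\<sigma> \<in> tor" for \<sigma>
    proof (rule tor_generated[OF der2 y _ _ that])
      fix t :: 'a assume t: "t \<noteq> 0"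
      show "normal D2 (\<lambda>u. t powi wt_V y v u)" if "v \<in> V0 \<union> V1 - {y}" for v
        using D2(2)[OF _ t, of "wt_V y v"] that wt_V_tor'[OF y that t] by (auto simp: normal_def \<Omega>_def)
      show "normal D2 (\<lambda>u. t powi wt_W w' u)" if "w' \<in> W" for w'
        using D2(2)[OF _ t, of "wt_W w'"] that wt_W_tor'[OF that t] by (auto simp: normal_def \<Omega>_def)
    qed
    \<comment> \<open>D2 inherits the character of D1 under \<open>wt_W w\<close>, so it still has
      the positive degree k. All derivatives of z therefore have positive weight.\<close>
    have n2: "normalizes I X D2 (\<lambda>v. t powi wt_W w v) (t powi (- k))" if "t \<noteq> 0" for t
      by (rule D2(3)[OF \<omega>_sym[OF that] D1(2)[OF that]])
    have gr: "graded (c + k) (D2 f)" if f: "graded c f" for c f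
      unfolding graded_def
    proof (intro conjI allI impI)
      show "D2 f \<in> A" by (rule L2.D_closed[OF graded_in[OF f]])
      fix t :: 'a assume t: "t \<noteq> 0"
      have "D2 (act t f) = (\<lambda>p. t powi c * D2 f p)"
        unfolding graded_act[OF f t] by (rule L2.D_scale[OF graded_in[OF f]])
      moreover have "D2 (act t f) = (\<lambda>p. t powi (- k) * act t (D2 f) p)"
        using n2[OF t] graded_in[OF f] unfolding normalizes_def by blast
      ultimately have "t powi (- k) * act t (D2 f) p = t powi c * D2 f p" for p by metis
      then show "act t (D2 f) = (\<lambda>p. t powi (c + k) * D2 f p)"
        using t by (simp add: fun_eq_iff power_int_add power_int_minus field_simps)
    qed
    have zA: "crd z \<in> A" by (intro crd_in) auto
    have gz: "graded (int (e w) + int m * k) ((D2 ^^ m) (crd z))" for m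
    proof (induction m)
      case 0
      show ?case using graded_crd[of z] wz by simp
    next
      case (Suc m)
      then show ?case using gr[OF Suc.IH] by (simp add: algebra_simps)
    qed
    have "D2 (crd z) = (\<lambda>_. 0)"
    proof (rule lnd_kernel_of_zeros[OF L2 zA])
      fix q m assume q: "q \<in> X" "crd z q = 0"
      have "int (e w) + int m * k > 0" using False e_pos[of w] w by (intro add_pos_nonneg) auto
      then show "(D2 ^^ m) (crd z) q = 0"
        by (rule positive_weight_vanishes[OF w gz _ q(1)]) (use q in \<open>simp add: res_def\<close>)
    qed
    then show False using torus_normalized_lnd_zero[OF L2 _ tor2 parity] nz2 by blast
  qed
qed

end

subsection \<open>Actions of the additive group\<close>

text \<open>The coordinate \<open>None\<close> is the time s. The degree in s is bounded by one N
  for all p; this uniform bound makes the generator of an action locally nilpotent in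
  \<open>lnd_gen\<close>.\<close>

lemma poly_function_expansion:
  fixes G :: "('v option \<Rightarrow> 'a::field) \<Rightarrow> 'a"
  assumes "G \<in> poly_functions (insert None (Some ` I))"
  shows "\<exists>\<Gamma> N. (\<forall>s p. G (case_option s p) = poly (\<Gamma> p) s) \<and>
    (\<forall>k. (\<lambda>p. coeff (\<Gamma> p) k) \<in> poly_functions I) \<and> (\<forall>p. degree (\<Gamma> p) \<le> N)"
  using assms
proof (induction rule: poly_functions.induct)
  case (const c)
  have "(\<lambda>p. coeff [:c:] k) \<in> poly_functions I" for k :: nat
    by (rule poly_functions.const)
  then show ?case by (intro exI[of _ "\<lambda>_. [:c:]"] exI[of _ 0]) simp
next
  case (coord v)
  show ?case
  proof (cases v)
    case None
    have "(\<lambda>p. coeff [:0, 1 :: 'a:] k) \<in> poly_functions I" for k :: nat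
      by (rule poly_functions.const)
    then show ?thesis unfolding None by (intro exI[of _ "\<lambda>_. [:0, 1:]"] exI[of _ 1]) simp
  next
    case (Some i)
    then have i: "i \<in> I" using coord by auto
    have "(\<lambda>p :: 'v \<Rightarrow> 'a. coeff [:p i:] k) \<in> poly_functions I" for k :: nat
      using i by (cases k) (auto intro: poly_functions.intros)
    then show ?thesis unfolding Some by (intro exI[of _ "\<lambda>p. [:p i:]"] exI[of _ 0]) simp
  qed
next
  case (add f g)
  then obtain \<Gamma> N \<Delta> M where \<Gamma>: "\<forall>s p. f (case_option s p) = poly (\<Gamma> p) s"
    "\<forall>k. (\<lambda>p. coeff (\<Gamma> p) k) \<in> poly_functions I" "\<forall>p. degree (\<Gamma> p) \<le> N"
    and \<Delta>: "\<forall>s p. g (case_option s p) = poly (\<Delta> p) s"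
    "\<forall>k. (\<lambda>p. coeff (\<Delta> p) k) \<in> poly_functions I" "\<forall>p. degree (\<Delta> p) \<le> M" by blast
  show ?case
  proof (intro exI[of _ "\<lambda>p. \<Gamma> p + \<Delta> p"] exI[of _ "max N M"] conjI allI)
    show "degree (\<Gamma> p + \<Delta> p) \<le> max N M" for p
      using \<Gamma>(3) \<Delta>(3) by (intro degree_add_le) (auto intro: order_trans max.cobounded1 max.cobounded2)
  qed (use \<Gamma> \<Delta> in \<open>auto intro: poly_functions.intros\<close>)
next
  case (mult f g)
  then obtain \<Gamma> N \<Delta> M where \<Gamma>: "\<forall>s p. f (case_option s p) = poly (\<Gamma> p) s"
    "\<forall>k. (\<lambda>p. coeff (\<Gamma> p) k) \<in> poly_functions I" "\<forall>p. degree (\<Gamma> p) \<le> N"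
    and \<Delta>: "\<forall>s p. g (case_option s p) = poly (\<Delta> p) s"
    "\<forall>k. (\<lambda>p. coeff (\<Delta> p) k) \<in> poly_functions I" "\<forall>p. degree (\<Delta> p) \<le> M" by blast
  show ?case
  proof (intro exI[of _ "\<lambda>p. \<Gamma> p * \<Delta> p"] exI[of _ "N + M"] conjI allI)
    show "degree (\<Gamma> p * \<Delta> p) \<le> N + M" for p
      using \<Gamma>(3) \<Delta>(3) by (intro order_trans[OF degree_mult_le] add_mono) auto
    show "(\<lambda>p. coeff (\<Gamma> p * \<Delta> p) k) \<in> poly_functions I" for k
      unfolding coeff_mult using \<Gamma>(2) \<Delta>(2) by (intro poly_functions_sum poly_functions.mult) auto
  qed (use \<Gamma> \<Delta> in auto)
qed

lemma pderiv_funpow_zero: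
  fixes q :: "'a::field_char_0 poly"
  assumes "degree q \<le> N" shows "(pderiv ^^ Suc N) q = 0"
  using assms
proof (induction N arbitrary: q)
  case 0
  then show ?case by (simp add: pderiv_eq_0_iff)
next
  case (Suc N)
  have "(pderiv ^^ Suc N) (pderiv q) = 0" using Suc.prems by (intro Suc.IH) (simp add: degree_pderiv)
  then show ?case by (simp only: funpow_Suc_right comp_def)
qed

text \<open>The conditions concern points of X only, so the maps \<alpha> s may be arbitrary
  elsewhere.\<close>

locale additive_action = coordinate_ring I X
  for I :: "'v set" and X :: "('v \<Rightarrow> 'a::field_char_0) set" +
  fixes \<alpha> :: "'a \<Rightarrow> ('v \<Rightarrow> 'a) \<Rightarrow> ('v \<Rightarrow> 'a)"
  assumes \<alpha>_in: "p \<in> X \<Longrightarrow> \<alpha> s p \<in> X"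
    and \<alpha>_0: "p \<in> X \<Longrightarrow> \<alpha> 0 p = p"
    and \<alpha>_add: "p \<in> X \<Longrightarrow> \<alpha> (s + s') p = \<alpha> s (\<alpha> s' p)"
    and \<alpha>_poly: "i \<in> I \<Longrightarrow> \<exists>F\<in>poly_functions (insert None (Some ` I)). \<forall>s. \<forall>p\<in>X. \<alpha> s p i = F (case_option s p)"
begin

lemma ex_orbit_poly:
  assumes f: "f \<in> A"
  shows "\<exists>\<Gamma> N. (\<forall>s. \<forall>p\<in>X. f (\<alpha> s p) = poly (\<Gamma> p) s) \<and>
    (\<forall>k. (\<lambda>p. coeff (\<Gamma> p) k) \<in> poly_functions I) \<and> (\<forall>p. degree (\<Gamma> p) \<le> N)"
proof -
  obtain F where F: "F \<in> poly_functions I" "f = res X F" using f by (auto simp: coord_algebra_eq)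
  have "\<forall>i. \<exists>G. i \<in> I \<longrightarrow> G \<in> poly_functions (insert None (Some ` I)) \<and> (\<forall>s. \<forall>p\<in>X. \<alpha> s p i = G (case_option s p))"
    using \<alpha>_poly by blast
  then obtain G where G: "\<And>i. i \<in> I \<Longrightarrow> G i \<in> poly_functions (insert None (Some ` I))"
    "\<And>i s p. i \<in> I \<Longrightarrow> p \<in> X \<Longrightarrow> \<alpha> s p i = G i (case_option s p)" by metis
  have "(\<lambda>q. F (\<lambda>i. G i q)) \<in> poly_functions (insert None (Some ` I))"
    by (rule poly_functions_subst[OF F(1)]) (rule G(1))
  from poly_function_expansion[OF this] obtain \<Gamma> N where
    \<Gamma>: "\<And>s p. F (\<lambda>i. G i (case_option s p)) = poly (\<Gamma> p) s"
    "\<And>k. (\<lambda>p. coeff (\<Gamma> p) k) \<in> poly_functions I" "\<And>p. degree (\<Gamma> p) \<le> N" by blast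
  have "f (\<alpha> s p) = poly (\<Gamma> p) s" if p: "p \<in> X" for s p
  proof -
    have "f (\<alpha> s p) = F (\<alpha> s p)" using \<alpha>_in[OF p] by (simp add: F res_def)
    also have "\<dots> = F (\<lambda>i. G i (case_option s p))"
      using G(2) p by (intro poly_functions_cong[OF F(1)]) auto
    finally show ?thesis by (simp add: \<Gamma>(1))
  qed
  then show ?thesis using \<Gamma>(2,3) by blast
qed

definition orbit_poly :: "('v \<Rightarrow> 'a) \<Rightarrow> (('v \<Rightarrow> 'a) \<Rightarrow> 'a) \<Rightarrow> 'a poly"
  where "orbit_poly p f = (SOME q. \<forall>s. f (\<alpha> s p) = poly q s)"

lemma poly_orbit_poly: "f \<in> A \<Longrightarrow> p \<in> X \<Longrightarrow> poly (orbit_poly p f) s = f (\<alpha> s p)"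
proof -
  assume "f \<in> A" "p \<in> X"
  then have "\<exists>q. \<forall>s. f (\<alpha> s p) = poly q s" using ex_orbit_poly by blast
  then show ?thesis unfolding orbit_poly_def by (rule someI2_ex) simp
qed

lemma orbit_poly_eqI:
  assumes "f \<in> A" "p \<in> X" "\<And>s. f (\<alpha> s p) = poly q s" shows "orbit_poly p f = q"
  by (rule poly_eqI_infinite[of "{}"]) (use assms poly_orbit_poly in auto)

text \<open>The infinitesimal generator of the action: the derivative of f (\<alpha> s p) at s =
  0.\<close>

definition gen :: "(('v \<Rightarrow> 'a) \<Rightarrow> 'a) \<Rightarrow> (('v \<Rightarrow> 'a) \<Rightarrow> 'a)"
  where "gen f = res X (\<lambda>p. coeff (orbit_poly p f) 1)"

lemma gen_in:
  assumes f: "f \<in> A" shows "gen f \<in> A"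
proof -
  obtain \<Gamma> where \<Gamma>: "\<forall>s. \<forall>p\<in>X. f (\<alpha> s p) = poly (\<Gamma> p) s"
    "\<forall>k. (\<lambda>p. coeff (\<Gamma> p) k) \<in> poly_functions I" using ex_orbit_poly[OF f] by blast
  have "gen f = res X (\<lambda>p. coeff (\<Gamma> p) 1)"
    using orbit_poly_eqI[OF f] \<Gamma>(1) by (auto simp: gen_def res_def)
  then show ?thesis using \<Gamma>(2) by (simp add: res_in_coord_algebra)
qed

lemma orbit_poly_translate:
  assumes "f \<in> A" "p \<in> X" shows "orbit_poly (\<alpha> s p) f = pcompose (orbit_poly p f) [:s, 1:]"
  using assms \<alpha>_in
  by (intro orbit_poly_eqI) (auto simp: poly_pcompose poly_orbit_poly add.commute simp flip: \<alpha>_add)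

text \<open>By the group law the derivative at time s is the generator evaluated at \<alpha> s p. So
  the generator acts on orbit polynomials as d/ds, which yields its local nilpotency and the
  invariance of its kernel.\<close>

lemma orbit_poly_gen:
  assumes f: "f \<in> A" and p: "p \<in> X" shows "orbit_poly p (gen f) = pderiv (orbit_poly p f)"
proof (rule orbit_poly_eqI[OF gen_in[OF f] p])
  fix s
  have "coeff q 1 = poly (pderiv q) 0" for q :: "'a poly" by (simp add: poly_0_coeff_0 coeff_pderiv)
  then have "gen f (\<alpha> s p) = poly (pderiv (pcompose (orbit_poly p f) [:s, 1:])) 0"
    using \<alpha>_in[OF p] by (simp add: gen_def res_def orbit_poly_translate[OF f p])
  then show "gen f (\<alpha> s p) = poly (pderiv (orbit_poly p f)) s"
    by (simp add: pderiv_pcompose pderiv_pCons poly_pcompose)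
qed

lemma derivation_gen: "derivation A gen"
  unfolding derivation_def
proof (intro conjI ballI allI)
  show "gen \<in> A \<rightarrow> A" using gen_in by blast
next
  fix f g assume fg: "f \<in> A" "g \<in> A"
  have "orbit_poly p (\<lambda>p. f p + g p) = orbit_poly p f + orbit_poly p g" if "p \<in> X" for p
    by (rule orbit_poly_eqI) (use fg that in \<open>auto simp: coord_algebra_add poly_orbit_poly\<close>)
  then show "gen (\<lambda>p. f p + g p) = (\<lambda>p. gen f p + gen g p)" by (auto simp: gen_def res_def)
  have *: "orbit_poly p (\<lambda>p. f p * g p) = orbit_poly p f * orbit_poly p g" if "p \<in> X" for p
    by (rule orbit_poly_eqI) (use fg that in \<open>auto simp: coord_algebra_mult poly_orbit_poly\<close>)
  have "coeff (orbit_poly p f) 0 = f p" if "f \<in> A" "p \<in> X" for f p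
    using poly_orbit_poly[OF that, of 0] \<alpha>_0[OF that(2)] by (simp add: poly_0_coeff_0)
  then show "gen (\<lambda>p. f p * g p) = (\<lambda>p. gen f p * g p + f p * gen g p)"
    using * fg by (auto simp: gen_def res_def coeff_mult fun_eq_iff coord_algebra_zero_outside)
next
  fix c f assume f: "f \<in> A"
  have "orbit_poly p (\<lambda>p. c * f p) = smult c (orbit_poly p f)" if "p \<in> X" for p
    by (rule orbit_poly_eqI) (use f that in \<open>auto simp: coord_algebra_scale poly_orbit_poly\<close>)
  then show "gen (\<lambda>p. c * f p) = (\<lambda>p. c * gen f p)" by (auto simp: gen_def res_def)
qed

lemma lnd_gen: "locally_nilpotent_derivation A gen"
  unfolding locally_nilpotent_derivation_def
proof (intro conjI derivation_gen ballI)
  fix f assume f: "f \<in> A"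
  obtain \<Gamma> N where \<Gamma>: "\<forall>s. \<forall>p\<in>X. f (\<alpha> s p) = poly (\<Gamma> p) s" "\<forall>p. degree (\<Gamma> p) \<le> N"
    using ex_orbit_poly[OF f] by blast
  have *: "(gen ^^ m) f \<in> A \<and> (\<forall>p\<in>X. orbit_poly p ((gen ^^ m) f) = (pderiv ^^ m) (orbit_poly p f))" for m
    by (induction m) (auto simp: f gen_in orbit_poly_gen)
  have "(gen ^^ Suc N) f = (\<lambda>_. 0)"
  proof
    fix p show "(gen ^^ Suc N) f p = 0"
    proof (cases "p \<in> X")
      case True
      then have "orbit_poly p f = \<Gamma> p" using \<Gamma>(1) by (intro orbit_poly_eqI f) auto
      then have "orbit_poly p ((gen ^^ Suc N) f) = 0"
        using * True pderiv_funpow_zero[of "\<Gamma> p" N] \<Gamma>(2) by metis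
      then have "poly (orbit_poly p ((gen ^^ Suc N) f)) 0 = 0" by simp
      then show ?thesis
        using poly_orbit_poly[OF conjunct1[OF *[of "Suc N"]] True, of 0] \<alpha>_0[OF True] by (simp del: funpow.simps)
    next
      case False
      then show ?thesis using coord_algebra_zero_outside * by blast
    qed
  qed
  then show "\<exists>n>0. (gen ^^ n) f = (\<lambda>_. 0)" by blast
qed

lemma kernel_gen_invariant:
  assumes f: "f \<in> A" and g: "gen f = (\<lambda>_. 0)" and p: "p \<in> X"
  shows "f (\<alpha> s p) = f p"
proof -
  have "orbit_poly p (gen f) = 0"
    by (rule orbit_poly_eqI[OF gen_in[OF f] p]) (simp add: g)
  then have "pderiv (orbit_poly p f) = 0" using orbit_poly_gen[OF f p] by simp
  then obtain c where c: "orbit_poly p f = [:c:]" by (metis degree_eq_zeroE pderiv_eq_0_iff)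
  then show ?thesis using poly_orbit_poly[OF f p, of s] poly_orbit_poly[OF f p, of 0] \<alpha>_0[OF p] by simp
qed

end

subsection \<open>The automorphism group\<close>

lemma regular_on_comp:
  assumes "regular_on I X \<phi>" "regular_on I X \<psi>" "\<And>p. p \<in> X \<Longrightarrow> \<psi> p \<in> X"
  shows "regular_on I X (compose X \<phi> \<psi>)"
  unfolding regular_on_def
proof
  fix i assume i: "i \<in> I"
  obtain F where F: "F \<in> poly_functions I" "\<And>p. p \<in> X \<Longrightarrow> \<phi> p i = F p" 
    using assms(1) i unfolding regular_on_def by blast
  have "\<forall>j. \<exists>G. j \<in> I \<longrightarrow> G \<in> poly_functions I \<and> (\<forall>p\<in>X. \<psi> p j = G p)"
    using assms(2) unfolding regular_on_def by blast
  then obtain G where G: "\<And>j. j \<in> I \<Longrightarrow> G j \<in> poly_functions I" "\<And>j p. j \<in> I \<Longrightarrow> p \<in> X \<Longrightarrow> \<psi> p j = G j p" by metis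
  have "\<forall>p\<in>X. compose X \<phi> \<psi> p i = F (\<lambda>j. G j p)"
  proof
    fix p assume p: "p \<in> X"
    have "compose X \<phi> \<psi> p i = F (\<psi> p)" using p assms(3) F(2) by (simp add: compose_def)
    also have "\<dots> = F (\<lambda>j. G j p)" using G(2) p by (intro poly_functions_cong[OF F(1)])
    finally show "compose X \<phi> \<psi> p i = F (\<lambda>j. G j p)" .
  qed
  moreover have "(\<lambda>p. F (\<lambda>j. G j p)) \<in> poly_functions I"
    by (rule poly_functions_subst[OF F(1)]) (rule G(1))
  ultimately show "\<exists>F\<in>poly_functions I. \<forall>p\<in>X. compose X \<phi> \<psi> p i = F p" by (rule bexI)
qed

lemma regular_on_cong:
  "regular_on I X \<phi> \<Longrightarrow> (\<And>p. p \<in> X \<Longrightarrow> \<phi> p = \<psi> p) \<Longrightarrow> regular_on I X \<psi>"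
  unfolding regular_on_def by simp

lemma regular_on_id: "regular_on I X (\<lambda>p\<in>X. p)"
  unfolding regular_on_def by (auto intro: poly_functions.coord)

lemma aut_group_carrier: "carrier (aut_group I X) = {\<phi> \<in> Bij X. regular_on I X \<phi> \<and> regular_on I X (inv_into X \<phi>)}"
  and aut_group_mult: "\<phi> \<in> Bij X \<Longrightarrow> \<psi> \<in> Bij X \<Longrightarrow> \<phi> \<otimes>\<^bsub>aut_group I X\<^esub> \<psi> = compose X \<phi> \<psi>"
  and aut_group_one: "\<one>\<^bsub>aut_group I X\<^esub> = (\<lambda>p\<in>X. p)"
  by (simp_all add: aut_group_def BijGroup_def)

lemma Bij_inv_eqI:
  assumes "\<phi> \<in> Bij X" "\<And>p. p \<in> X \<Longrightarrow> \<psi> p \<in> X" "\<And>p. p \<in> X \<Longrightarrow> \<phi> (\<psi> p) = p" "p \<in> X"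
  shows "inv_into X \<phi> p = \<psi> p"
  using assms by (intro inv_into_f_eq) (auto simp: Bij_def bij_betw_def)

lemma Bij_inv_into_right: "\<phi> \<in> Bij X \<Longrightarrow> p \<in> X \<Longrightarrow> \<phi> (inv_into X \<phi> p) = p"
  by (auto simp: Bij_def bij_betw_def f_inv_into_f)

lemma Bij_inv_into_left: "\<phi> \<in> Bij X \<Longrightarrow> p \<in> X \<Longrightarrow> inv_into X \<phi> (\<phi> p) = p"
  by (auto simp: Bij_def bij_betw_def inv_into_f_f)

lemma Bij_in: "\<phi> \<in> Bij X \<Longrightarrow> p \<in> X \<Longrightarrow> \<phi> p \<in> X"
  using Bij_imp_funcset by blast

lemma group_aut_group: "group (aut_group I X)"
proof -
  let ?C = "{\<phi> \<in> Bij X. regular_on I X \<phi> \<and> regular_on I X (inv_into X \<phi>)}"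
  have "subgroup ?C (BijGroup X)"
  proof (rule group.subgroupI[OF group_BijGroup])
    show "?C \<subseteq> carrier (BijGroup X)" by (auto simp: BijGroup_def)
    have "regular_on I X (inv_into X (\<lambda>p\<in>X. p))"
      by (rule regular_on_cong[OF regular_on_id]) (use Bij_inv_eqI[OF id_Bij, of X "\<lambda>p. p"] in auto)
    then show "?C \<noteq> {}" using id_Bij[of X] regular_on_id[of I X] by blast
  next
    fix \<phi> assume \<phi>: "\<phi> \<in> ?C"
    \<comment> \<open>The inverse in \<open>BijGroup\<close> is this restriction of
      \<open>inv_into\<close>; regularity depends only on the values on X.\<close>
    let ?i = "\<lambda>p\<in>X. inv_into X \<phi> p"
    have "?i \<in> Bij X" using \<phi> restrict_inv_into_Bij by blast
    moreover have "regular_on I X ?i" by (rule regular_on_cong[of I X "inv_into X \<phi>"]) (use \<phi> in auto)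
    moreover have "regular_on I X (inv_into X ?i)"
    proof (rule regular_on_cong[of I X \<phi>])
      show "\<phi> p = inv_into X ?i p" if "p \<in> X" for p
        by (rule Bij_inv_eqI[symmetric, OF \<open>?i \<in> Bij X\<close>]) (use \<phi> that in \<open>auto simp: Bij_in Bij_inv_into_left\<close>)
    qed (use \<phi> in auto)
    ultimately show "inv\<^bsub>BijGroup X\<^esub> \<phi> \<in> ?C" using \<phi> by (simp add: inv_BijGroup)
  next
    fix \<phi> \<psi> assume \<phi>: "\<phi> \<in> ?C" and \<psi>: "\<psi> \<in> ?C"
    have B: "compose X \<phi> \<psi> \<in> Bij X" using \<phi> \<psi> compose_Bij by blast
    have "regular_on I X (compose X \<phi> \<psi>)" using \<phi> \<psi> by (intro regular_on_comp) (auto simp: Bij_in)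
    moreover have "regular_on I X (inv_into X (compose X \<phi> \<psi>))"
    proof (rule regular_on_cong[of I X "compose X (inv_into X \<psi>) (inv_into X \<phi>)"])
      show "regular_on I X (compose X (inv_into X \<psi>) (inv_into X \<phi>))"
        using \<phi> \<psi> by (intro regular_on_comp) (auto simp: Bij_inv_into_mem)
      show "compose X (inv_into X \<psi>) (inv_into X \<phi>) p = inv_into X (compose X \<phi> \<psi>) p" if "p \<in> X" for p
        using \<phi> \<psi> that
        by (intro Bij_inv_eqI[symmetric, OF B]) (auto simp: compose_def Bij_inv_into_mem Bij_inv_into_right)
    qed
    ultimately show "\<phi> \<otimes>\<^bsub>BijGroup X\<^esub> \<psi> \<in> ?C" using B \<phi> \<psi> by (simp add: BijGroup_def)
  qed
  then show ?thesis
    unfolding aut_group_def using subgroup.subgroup_is_group group_BijGroup by blast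
qed

lemma additive_subgroup_action:
  fixes X :: "('v \<Rightarrow> 'a::field_char_0) set"
  assumes H: "additive_subgroup_of_aut I X H" and h: "h \<in> H"
  obtains \<alpha> s where "additive_action I X \<alpha>" "h = \<alpha> s"
proof -
  obtain \<alpha> where \<alpha>: "\<alpha> \<in> iso additive_group ((aut_group I X)\<lparr>carrier := H\<rparr>)"
    "\<And>i. i \<in> I \<Longrightarrow> \<exists>F\<in>poly_functions (insert None (Some ` I)). \<forall>s. \<forall>p\<in>X. \<alpha> s p i = F (case_option s p)"
    and sH: "subgroup H (aut_group I X)"
    using H unfolding additive_subgroup_of_aut_def by blast
  have bij: "bij_betw \<alpha> UNIV H" and hom: "\<And>s s'. \<alpha> (s + s') = \<alpha> s \<otimes>\<^bsub>aut_group I X\<^esub> \<alpha> s'"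
    using \<alpha>(1) by (auto simp: iso_def hom_def additive_group_def)
  have B: "\<alpha> s \<in> Bij X" for s
  proof -
    have "\<alpha> s \<in> H" using bij by (auto simp: bij_betw_def)
    then show ?thesis using subgroup.subset[OF sH] by (auto simp: aut_group_carrier)
  qed
  have add: "\<alpha> (s + s') p = \<alpha> s (\<alpha> s' p)" if "p \<in> X" for s s' p
    using that by (simp add: hom aut_group_mult[OF B B] compose_def)
  have "additive_action I X \<alpha>"
  proof
    show "\<alpha> s p \<in> X" if "p \<in> X" for s p using Bij_in[OF B that] .
    show "\<alpha> 0 p = p" if p: "p \<in> X" for p
    proof -
      have "\<alpha> 0 (\<alpha> 0 p) = \<alpha> 0 p" using add[OF p, of 0 0] by simp
      then show ?thesis using B[of 0] Bij_in[OF B p] p by (auto simp: Bij_def bij_betw_def inj_on_def)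
    qed
  qed (use add \<alpha>(2) in auto)
  moreover obtain s where "h = \<alpha> s" using h bij by (auto simp: bij_betw_def)
  ultimately show ?thesis using that by blast
qed

lemma saut_group_subset: "carrier (saut_group I X) \<subseteq> carrier (aut_group I X)"
proof -
  have "(\<Union> {H. additive_subgroup_of_aut I X H}) \<subseteq> carrier (aut_group I X)"
    unfolding additive_subgroup_of_aut_def using subgroup.subset by blast
  then show ?thesis unfolding saut_group_def using group.generate_incl[OF group_aut_group] by simp
qed

lemma saut_group_Bij: "\<phi> \<in> carrier (saut_group I X) \<Longrightarrow> \<phi> \<in> Bij X"
  using saut_group_subset[of I X] unfolding aut_group_carrier by blast

text \<open>Each additive subgroup has a locally nilpotent generator, which kills f, so f is
  constant on its orbits; this passes to products of elements of such subgroups.\<close>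

lemma makar_limanov_invariant:
  fixes X :: "('v \<Rightarrow> 'a::field_char_0) set"
  assumes f: "f \<in> makar_limanov I X" and \<phi>: "\<phi> \<in> carrier (saut_group I X)" and p: "p \<in> X"
  shows "f (\<phi> p) = f p"
proof -
  interpret G: group "aut_group I X" by (rule group_aut_group)
  let ?S = "\<Union> {H. additive_subgroup_of_aut I X H}"
  have Ssub: "?S \<subseteq> carrier (aut_group I X)"
    unfolding additive_subgroup_of_aut_def using subgroup.subset by blast
  have one: "f (h p) = f p" if h: "h \<in> ?S" and p: "p \<in> X" for h p
  proof -
    obtain H where H: "additive_subgroup_of_aut I X H" "h \<in> H" using h by blast
    obtain \<alpha> s where \<alpha>: "additive_action I X \<alpha>" "h = \<alpha> s" using additive_subgroup_action[OF H] .
    interpret additive_action I X \<alpha> by (rule \<alpha>(1))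
    show ?thesis using f lnd_gen kernel_gen_invariant[OF _ _ p] unfolding makar_limanov_def \<alpha>(2) by blast
  qed
  have "\<phi> \<in> generate (aut_group I X) ?S" using \<phi> by (simp add: saut_group_def)
  then have "\<forall>p\<in>X. f (\<phi> p) = f p"
  proof (induction rule: generate.induct)
    case one
    show ?case by (simp add: aut_group_one)
  next
    case (incl h)
    then show ?case using \<open>\<And>h p. h \<in> ?S \<Longrightarrow> p \<in> X \<Longrightarrow> f (h p) = f p\<close> by blast
  next
    case (inv h)
    then obtain H where H: "additive_subgroup_of_aut I X H" "h \<in> H" by blast
    then have "inv\<^bsub>aut_group I X\<^esub> h \<in> H"
      unfolding additive_subgroup_of_aut_def using subgroup.m_inv_closed by metis
    then show ?case using \<open>\<And>h p. h \<in> ?S \<Longrightarrow> p \<in> X \<Longrightarrow> f (h p) = f p\<close> H(1) by blast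
  next
    case (eng h1 h2)
    have "h1 \<in> Bij X" "h2 \<in> Bij X"
      using eng(1,2) G.generate_incl[OF Ssub] by (auto simp: aut_group_carrier)
    then show ?case using eng(3,4) by (simp add: aut_group_mult compose_def Bij_in)
  qed
  then show ?thesis using p by blast
qed

lemma saut_group_mult:
  assumes "\<phi> \<in> carrier (saut_group I X)" "\<psi> \<in> carrier (saut_group I X)"
  shows "compose X \<phi> \<psi> \<in> carrier (saut_group I X)"
proof -
  have "\<phi> \<in> Bij X" "\<psi> \<in> Bij X" using assms saut_group_Bij by auto
  then have "compose X \<phi> \<psi> = \<phi> \<otimes>\<^bsub>aut_group I X\<^esub> \<psi>" by (simp add: aut_group_mult)
  then show ?thesis using assms by (simp add: saut_group_def generate.eng)
qed

lemma saut_group_one: "(\<lambda>p\<in>X. p) \<in> carrier (saut_group I X)"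
  using generate.one[of "aut_group I X"] by (simp add: saut_group_def aut_group_one)

text \<open>A point with trivial stabilizer makes s -> \<alpha> s injective, so the image is
  isomorphic to the additive group, as \<open>additive_subgroup_of_aut\<close> demands. Restriction
  to X gives the representative that \<open>Bij\<close> requires.\<close>

lemma additive_action_in_saut_group:
  fixes X :: "('v \<Rightarrow> 'a::field_char_0) set"
  assumes act: "additive_action I X \<alpha>" and inj: "p \<in> X" "\<And>s. \<alpha> s p = p \<Longrightarrow> s = 0"
  shows "(\<lambda>p\<in>X. \<alpha> s p) \<in> carrier (saut_group I X)"
proof -
  interpret additive_action I X \<alpha> by (rule act)
  interpret G: group "aut_group I X" by (rule group_aut_group)
  define \<beta> where "\<beta> s = (\<lambda>p\<in>X. \<alpha> s p)" for s
  have inv: "\<alpha> s (\<alpha> (- s) p) = p" "\<alpha> (- s) (\<alpha> s p) = p" if "p \<in> X" for s p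
    using that by (simp_all add: \<alpha>_0 flip: \<alpha>_add)
  have B: "\<beta> s \<in> Bij X" for s
  proof -
    have "bij_betw (\<beta> s) X X"
      by (rule bij_betwI[of _ _ _ "\<alpha> (- s)"]) (auto simp: \<beta>_def \<alpha>_in inv)
    then show ?thesis by (simp add: Bij_def \<beta>_def)
  qed
  have reg: "regular_on I X (\<alpha> s)" for s
    unfolding regular_on_def
  proof
    fix i assume "i \<in> I"
    then obtain F where F: "F \<in> poly_functions (insert None (Some ` I))" "\<And>s p. p \<in> X \<Longrightarrow> \<alpha> s p i = F (case_option s p)"
      using \<alpha>_poly by blast
    have "(\<lambda>p. F (case_option s p)) \<in> poly_functions I"
      by (rule poly_functions_subst[OF F(1)]) (auto intro: poly_functions.intros)
    then show "\<exists>F\<in>poly_functions I. \<forall>p\<in>X. \<alpha> s p i = F p" using F(2) by (intro bexI) auto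
  qed
  have C: "\<beta> s \<in> carrier (aut_group I X)" for s
  proof -
    have "inv_into X (\<beta> s) p = \<alpha> (- s) p" if "p \<in> X" for p
      by (rule Bij_inv_eqI[OF B]) (use that in \<open>auto simp: \<beta>_def \<alpha>_in inv\<close>)
    then have "regular_on I X (inv_into X (\<beta> s))" by (intro regular_on_cong[OF reg[of "- s"]]) simp
    moreover have "regular_on I X (\<beta> s)" by (rule regular_on_cong[OF reg[of s]]) (simp add: \<beta>_def)
    ultimately show ?thesis using B by (simp add: aut_group_carrier)
  qed
  have mult: "\<beta> s \<otimes>\<^bsub>aut_group I X\<^esub> \<beta> s' = \<beta> (s + s')" for s s'
    unfolding aut_group_mult[OF B B] by (auto simp: \<beta>_def compose_def \<alpha>_in \<alpha>_add)
  have one: "\<beta> 0 = \<one>\<^bsub>aut_group I X\<^esub>" by (auto simp: aut_group_one \<beta>_def \<alpha>_0)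
  have sub: "subgroup (range \<beta>) (aut_group I X)"
  proof (rule G.subgroupI)
    fix h assume "h \<in> range \<beta>"
    then obtain s where "h = \<beta> s" by blast
    moreover have "inv\<^bsub>aut_group I X\<^esub> (\<beta> s) = \<beta> (- s)"
      by (rule G.inv_equality) (use mult[of "- s" s] one C in auto)
    ultimately show "inv\<^bsub>aut_group I X\<^esub> h \<in> range \<beta>" by simp
  qed (use C mult in auto)
  have "inj \<beta>"
  proof
    fix s s' assume eq: "\<beta> s = \<beta> s'"
    have "\<alpha> (s - s') p = p"
      using fun_cong[OF eq, of p] inj(1) inv(2)[OF inj(1), of s'] \<alpha>_add[OF inj(1), of "- s'" s]
      by (simp add: \<beta>_def)
    then show "s = s'" using inj(2)[of "s - s'"] by simp
  qed
  then have iso: "\<beta> \<in> iso additive_group ((aut_group I X)\<lparr>carrier := range \<beta>\<rparr>)"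
    by (auto simp: iso_def hom_def additive_group_def mult bij_betw_def)
  have "additive_subgroup_of_aut I X (range \<beta>)"
    unfolding additive_subgroup_of_aut_def
  proof (intro conjI sub bexI[OF _ iso] ballI)
    fix i assume "i \<in> I"
    then obtain F where "F \<in> poly_functions (insert None (Some ` I))" "\<And>s p. p \<in> X \<Longrightarrow> \<alpha> s p i = F (case_option s p)"
      using \<alpha>_poly by blast
    then show "\<exists>F\<in>poly_functions (insert None (Some ` I)). \<forall>s. \<forall>p\<in>X. \<beta> s p i = F (case_option s p)"
      by (intro bexI) (auto simp: \<beta>_def)
  qed
  then have "\<beta> s \<in> generate (aut_group I X) (\<Union> {H. additive_subgroup_of_aut I X H})"
    by (intro generate.incl) blast
  then show ?thesis by (simp add: saut_group_def \<beta>_def)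
qed

lemma saut_orbit_subset:
  assumes "\<phi> \<in> carrier (saut_group I X)" "p \<in> X"
  shows "saut_orbit I X (\<phi> p) \<subseteq> saut_orbit I X p"
proof
  fix q assume "q \<in> saut_orbit I X (\<phi> p)"
  then obtain \<psi> where \<psi>: "\<psi> \<in> carrier (saut_group I X)" "q = \<psi> (\<phi> p)" by (auto simp: saut_orbit_def orbit_def)
  then have "q = compose X \<psi> \<phi> p" using assms(2) by (simp add: compose_def)
  then show "q \<in> saut_orbit I X p"
    using saut_group_mult[OF \<psi>(1) assms(1)] by (auto simp: saut_orbit_def orbit_def)
qed

subsection \<open>Transitivity on the fibres over the last coordinates\<close>

text \<open>The divided difference ((x + s P)^k - x^k) / P, as a polynomial in x, s and P.\<close>
fun power_quot :: "nat \<Rightarrow> 'a \<Rightarrow> 'a \<Rightarrow> 'a \<Rightarrow> 'a::comm_ring_1"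
  where
    "power_quot 0 x s P = 0"
  | "power_quot (Suc k) x s P = x * power_quot k x s P + s * (x + s * P) ^ k"

lemma power_quot: "(x + s * P) ^ k = x ^ k + P * power_quot k x s P"
proof (induction k)
  case (Suc k)
  have "(x + s * P) ^ Suc k = x * (x + s * P) ^ k + s * P * (x + s * P) ^ k" by (simp add: distrib_right)
  also have "x * (x + s * P) ^ k = x * (x ^ k + P * power_quot k x s P)" by (simp only: Suc.IH)
  finally show ?case by (simp add: algebra_simps)
qed simp

text \<open>The cocycle identity that yields the group law for the z-coordinate of
  \<open>shear\<close>. Since P may be zero, it is proved by induction on k instead of by division
  by P.\<close>

lemma power_quot_add: "power_quot k x (s + s') P = power_quot k x s' P + power_quot k (x + s' * P) s P"
proof (induction k)
  case (Suc k)
  let ?Y = "(x + (s + s') * P) ^ k"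
  have Y: "?Y = (x + s' * P) ^ k + P * power_quot k (x + s' * P) s P"
    using power_quot[of "x + s' * P" s P k] by (simp add: algebra_simps)
  have "power_quot (Suc k) x (s + s') P
      = x * power_quot k x s' P + x * power_quot k (x + s' * P) s P + s * ?Y + s' * ?Y"
    unfolding power_quot.simps Suc.IH by (simp add: algebra_simps)
  also have "s' * ?Y = s' * (x + s' * P) ^ k + s' * P * power_quot k (x + s' * P) s P"
    unfolding Y by (simp add: algebra_simps)
  also have "s * ?Y = s * (x + s' * P + s * P) ^ k" by (simp add: algebra_simps)
  finally show ?case by (simp add: algebra_simps)
qed simp

lemma power_quot_0: "power_quot k x 0 P = 0"
  by (induction k) simp_all

lemma power_quot_poly_function:
  assumes "f \<in> poly_functions V" "g \<in> poly_functions V" "h \<in> poly_functions V"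
  shows "(\<lambda>p. power_quot k (f p) (g p) (h p)) \<in> poly_functions V"
  using assms
  by (induction k) (auto intro!: poly_functions.const poly_functions.add poly_functions.mult poly_functions_power)

context trinomial_hypersurface
begin

text \<open>The flow of the locally nilpotent derivation that sends v to P and z to minus the
  derivative of a + b with respect to v. The divided difference keeps it polynomial where P is
  zero.\<close>

definition shear :: "'v \<Rightarrow> 'a \<Rightarrow> ('v \<Rightarrow> 'a) \<Rightarrow> ('v \<Rightarrow> 'a)"
  where "shear v s p = (\<lambda>u\<in>I. if u = v then p v + s * mval e W p
    else if u = z then p z - mval e ((if v \<in> V0 then V0 else V1) - {v}) p * power_quot (e v) (p v) s (mval e W p)
    else p u)"

lemma additive_action_shear:
  assumes v: "v \<in> V0 \<union> V1" shows "additive_action I X (shear v)"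
proof -
  define S where "S = (if v \<in> V0 then V0 else V1)"
  define S' where "S' = (if v \<in> V0 then V1 else V0)"
  have S: "v \<in> S" "finite S" "S \<subseteq> I" "S' \<subseteq> I" "v \<notin> S'" "z \<notin> S" "z \<notin> S'" "v \<noteq> z" "v \<notin> W"
    using v disj fin by (auto simp: S_def S'_def)
  have SS: "mval e V0 p + mval e V1 p = mval e S p + mval e S' p" for p :: "'v \<Rightarrow> 'a"
    by (simp add: S_def S'_def add.commute)
  define P where "P p = mval e W p" for p :: "'v \<Rightarrow> 'a"
  define K where "K p = mval e (S - {v}) p" for p :: "'v \<Rightarrow> 'a"
  have sh: "shear v s p u = (if u = v then p v + s * P p else if u = z then p z - K p * power_quot (e v) (p v) s (P p) else p u)"
    if "u \<in> I" for s p u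
    using that by (simp add: shear_def P_def K_def S_def)
  have fix_mval: "mval e T (shear v s p) = mval e T p" if "T \<subseteq> I" "v \<notin> T" "z \<notin> T" for T s p
    using that sh by (intro mval_cong) auto
  have Psh: "P (shear v s p) = P p" for s p
    unfolding P_def using S disj by (intro fix_mval) auto
  have Ksh: "K (shear v s p) = K p" for s p
    unfolding K_def using S by (intro fix_mval) auto
  have vI: "v \<in> I" "z \<in> I" using v by auto
  have mS: "mval e S p = p v ^ e v * K p" for p :: "'v \<Rightarrow> 'a" unfolding K_def by (rule mval_remove[OF S(2,1)])
  show ?thesis
  proof
    fix p s assume p: "p \<in> X"
    have "mval e S (shear v s p) = (p v + s * P p) ^ e v * K p"
      by (simp add: mS Ksh sh[OF vI(1)])
    also have "\<dots> = mval e S p + P p * (K p * power_quot (e v) (p v) s (P p))"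
      unfolding power_quot mS by (simp add: algebra_simps)
    finally have 1: "mval e S (shear v s p) = mval e S p + P p * (K p * power_quot (e v) (p v) s (P p))" .
    have 2: "mval e S' (shear v s p) = mval e S' p" using S by (intro fix_mval) auto
    have 3: "shear v s p z = p z - K p * power_quot (e v) (p v) s (P p)"
      using sh[OF vI(2)] S by simp
    have "mval e S p + mval e S' p + p z * P p = 0" using p by (simp add: in_X SS P_def)
    then have "mval e V0 (shear v s p) + mval e V1 (shear v s p) + shear v s p z * P (shear v s p) = 0"
      unfolding SS 1 2 3 Psh by (simp add: algebra_simps)
    then show "shear v s p \<in> X" by (simp add: in_X P_def) (simp add: shear_def)
  next
    fix p assume p: "p \<in> X"
    show "shear v 0 p = p"
    proof
      fix u show "shear v 0 p u = p u"
        using p sh[of u 0 p] by (cases "u \<in> I") (auto simp: power_quot_0 shear_def in_X extensional_def)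
    qed
  next
    fix p s s' assume p: "p \<in> X"
    show "shear v (s + s') p = shear v s (shear v s' p)"
    proof
      fix u show "shear v (s + s') p u = shear v s (shear v s' p) u"
      proof (cases "u \<in> I")
        case True
        show ?thesis
          unfolding sh[OF True] Psh Ksh sh[OF vI(1)] sh[OF vI(2)] power_quot_add[of _ _ s s'] using S(8)
          by (auto simp: algebra_simps)
      qed (simp add: shear_def)
    qed
  next
    fix i assume i: "i \<in> I"
    let ?V = "insert None (Some ` I)"
    let ?r = "\<lambda>q :: 'v option \<Rightarrow> 'a. \<lambda>u. q (Some u)"
    have cr: "(\<lambda>q. q (Some u)) \<in> poly_functions ?V" if "u \<in> I" for u
      using that by (auto intro: poly_functions.coord)
    have mv: "(\<lambda>q. mval e T (?r q)) \<in> poly_functions ?V" if "T \<subseteq> I" "finite T" for T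
      unfolding mval_def using that cr by (intro poly_functions_prod poly_functions_power) auto
    have PP: "(\<lambda>q. P (?r q)) \<in> poly_functions ?V" unfolding P_def using fin by (intro mv) auto
    have KK: "(\<lambda>q. K (?r q)) \<in> poly_functions ?V" unfolding K_def using S by (intro mv) auto
    have N: "(\<lambda>q. q None) \<in> poly_functions ?V" by (auto intro: poly_functions.coord)
    define G where "G q = (if i = v then q (Some v) + q None * P (?r q)
      else if i = z then q (Some z) - K (?r q) * power_quot (e v) (q (Some v)) (q None) (P (?r q)) else q (Some i))" for q
    have "(\<lambda>q. q (Some v) + q None * P (?r q)) \<in> poly_functions ?V"
      by (intro poly_functions.add poly_functions.mult cr vI N PP)
    moreover have "(\<lambda>q. q (Some z) - K (?r q) * power_quot (e v) (q (Some v)) (q None) (P (?r q))) \<in> poly_functions ?V"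
      by (intro poly_functions_diff poly_functions.mult power_quot_poly_function cr vI N PP KK)
    ultimately have "G \<in> poly_functions ?V" using cr[OF i] unfolding G_def by (cases "i = v"; cases "i = z") auto
    moreover have "shear v s p i = G (case_option s p)" for s p by (simp add: sh[OF i] G_def)
    ultimately show "\<exists>F\<in>poly_functions ?V. \<forall>s. \<forall>p\<in>X. shear v s p i = F (case_option s p)" by blast
  qed
qed

lemma shear_in_saut_group:
  assumes v: "v \<in> V0 \<union> V1" and p: "p \<in> X" "mval e W p \<noteq> 0"
  shows "(\<lambda>p\<in>X. shear v s p) \<in> carrier (saut_group I X)"
proof (rule additive_action_in_saut_group[OF additive_action_shear[OF v] p(1)])
  fix s assume "shear v s p = p"
  then have "shear v s p v = p v" by simp
  then show "s = 0" using v p(2) by (simp add: shear_def split: if_splits)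
qed

text \<open>Shears set the coordinates x and y to their targets one at a time, each moving only that
  coordinate and z. At the end z is determined by the equation because P is nonzero.\<close>

lemma saut_transitive_on_fibre:
  assumes p: "p \<in> X" "mval e W p \<noteq> 0" and q: "q \<in> X" "\<And>w. w \<in> W \<Longrightarrow> q w = p w"
  shows "\<exists>\<phi>\<in>carrier (saut_group I X). \<phi> p = q"
proof -
  have "\<exists>\<phi>\<in>carrier (saut_group I X). \<forall>u\<in>T \<union> W. \<phi> p u = q u" if "T \<subseteq> V0 \<union> V1" for T
  proof -
    have "finite T" using that fin finite_subset by blast
    then show ?thesis using that
    proof (induction T rule: finite_induct)
      case empty
      show ?case by (rule bexI[OF _ saut_group_one]) (use p q in auto)
    next
      case (insert v T)
      then obtain \<phi> where \<phi>: "\<phi> \<in> carrier (saut_group I X)" "\<And>u. u \<in> T \<union> W \<Longrightarrow> \<phi> p u = q u" by auto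
      have \<phi>X: "\<phi> p \<in> X" by (rule Bij_in[OF saut_group_Bij[OF \<phi>(1)] p(1)])
      have W: "mval e W (\<phi> p) = mval e W p" using \<phi>(2) q(2) by (intro mval_cong) auto
      define s where "s = (q v - \<phi> p v) / mval e W p"
      define \<psi> where "\<psi> = (\<lambda>p\<in>X. shear v s p)"
      have v: "v \<in> V0 \<union> V1" using insert.prems by auto
      have \<psi>: "\<psi> \<in> carrier (saut_group I X)" unfolding \<psi>_def by (rule shear_in_saut_group[OF v p])
      show ?case
      proof (intro bexI[OF _ saut_group_mult[OF \<psi> \<phi>(1)]] ballI)
        fix u assume u: "u \<in> insert v T \<union> W"
        have "compose X \<psi> \<phi> p u = shear v s (\<phi> p) u" using p(1) \<phi>X by (simp add: compose_def \<psi>_def)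
        also have "\<dots> = q u"
        proof (cases "u = v")
          case True
          then show ?thesis using v p(2) W by (simp add: shear_def s_def)
        next
          case False
          then have "u \<in> T \<union> W" using u by auto
          moreover have "u \<noteq> z" "u \<in> I" using u v insert.prems disj by auto
          ultimately show ?thesis using False \<phi>(2) by (simp add: shear_def)
        qed
        finally show "compose X \<psi> \<phi> p u = q u" .
      qed
    qed
  qed
  then obtain \<phi> where \<phi>: "\<phi> \<in> carrier (saut_group I X)" "\<And>u. u \<in> V0 \<union> V1 \<union> W \<Longrightarrow> \<phi> p u = q u" by blast
  have \<phi>X: "\<phi> p \<in> X" by (rule Bij_in[OF saut_group_Bij[OF \<phi>(1)] p(1)])
  have m: "mval e V0 (\<phi> p) = mval e V0 q" "mval e V1 (\<phi> p) = mval e V1 q" "mval e W (\<phi> p) = mval e W q"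
    using \<phi>(2) by (auto intro!: mval_cong)
  have "mval e W q = mval e W p" using q(2) by (intro mval_cong) auto
  then have "\<phi> p z = q z" using \<phi>X q(1) p(2) unfolding in_X m by (metis add_left_cancel mult_right_cancel)
  then have "\<phi> p u = q u" for u
    using \<phi>(2) \<phi>X q(1) by (cases "u \<in> I") (auto simp: in_X extensional_def)
  then show ?thesis using \<phi>(1) by blast
qed

text \<open>Gives values of x and y for which z = 0 solves the equation over every w. For empty
  \<open>V0\<close> this means b = -1; otherwise all of them can be zero.\<close>

lemma ex_base_values: "\<exists>c. mval e V0 c + mval e V1 c = (0 :: 'a)"
proof (cases "V0 = {}")
  case True
  obtain y where y: "y \<in> V1" using V1_ne by blast
  obtain r :: 'a where r: "r ^ e y = - 1" using nth_root_exists[of "e y" "- 1"] e_pos[of y] y by auto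
  have "mval e V1 (\<lambda>u. if u = y then r else 1) = - 1"
    using mval_remove[OF fin(2) y, of e "\<lambda>u. if u = y then r else 1"] r by (simp add: mval_def)
  then show ?thesis using True by (intro exI[of _ "\<lambda>u. if u = y then r else 1"]) (simp add: mval_def)
next
  case False
  then have "mval e V0 (\<lambda>_. 0) = (0 :: 'a)" "mval e V1 (\<lambda>_. 0) = (0 :: 'a)"
    using V1_ne fin e_pos by (subst mval_eq_0_iff; auto)+
  then show ?thesis by (intro exI[of _ "\<lambda>_. 0"]) simp
qed

theorem makar_limanov_and_orbits:
  assumes parity: "\<not> ((\<forall>v\<in>V0. even (e v)) \<and> (\<exists>v\<in>V0. e v = 2))"
  shows "makar_limanov I X = coord_algebra W X \<and> generic_saut_orbits_separated_by_ML I X"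
proof -
  have crdW: "crd w \<in> makar_limanov I X" if w: "w \<in> W" for w
    unfolding makar_limanov_def
    using w lnd_kernel_W[OF _ _ parity w]
    by (auto simp: locally_nilpotent_derivation_def intro!: crd_in) blast
  obtain c where c: "mval e V0 c + mval e V1 c = (0 :: 'a)" using ex_base_values by blast
  \<comment> \<open>A section of the projection to w: \<open>b p\<close> is polynomial in the
    w-coordinates of p. An invariant f agrees with f (b p) wherever P is nonzero, hence everywhere,
    so it is a polynomial in w.\<close>
  define b where "b p = (\<lambda>u\<in>I. if u \<in> W then p u else if u = z then 0 else c u)" for p :: "'v \<Rightarrow> 'a"
  have bX: "b p \<in> X" for p
  proof -
    have "mval e V0 (\<lambda>u. if u \<in> W then p u else if u = z then 0 else c u) = mval e V0 c"
      "mval e V1 (\<lambda>u. if u \<in> W then p u else if u = z then 0 else c u) = mval e V1 c"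
      using disj by (auto intro!: mval_cong)
    then show ?thesis unfolding b_def restrict_in_X using c disj by simp
  qed
  have ml: "makar_limanov I X = coord_algebra W X"
  proof
    show "makar_limanov I X \<subseteq> coord_algebra W X"
    proof
      fix f assume f: "f \<in> makar_limanov I X"
      then have fA: "f \<in> A" by (simp add: makar_limanov_def)
      then obtain F where F: "F \<in> poly_functions I" "f = res X F" by (auto simp: coord_algebra_eq)
      define g where "g = res X (\<lambda>p. F (b p))"
      have "(\<lambda>p. F (b p)) \<in> poly_functions W"
      proof (rule poly_functions_subst[OF F(1)])
        show "(\<lambda>p. b p v) \<in> poly_functions W" if "v \<in> I" for v
          using that unfolding b_def by (cases "v \<in> W"; cases "v = z") (auto intro: poly_functions.intros)
      qed
      then have gW: "g \<in> coord_algebra W X" unfolding g_def by (rule res_in_coord_algebra)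
      then have gA: "g \<in> A"
        using poly_functions_mono[OF _ subI(3)] by (auto simp: coord_algebra_eq)
      have "(\<lambda>p. f p - g p) = (\<lambda>_. 0)"
      proof (rule dense_U)
        show "(\<lambda>p. f p - g p) \<in> A" by (rule coord_algebra_diff[OF fA gA])
        fix p assume p: "p \<in> X" "mval e W p \<noteq> 0"
        obtain \<phi> where \<phi>: "\<phi> \<in> carrier (saut_group I X)" "\<phi> p = b p"
          using saut_transitive_on_fibre[OF p bX, of p] by (auto simp: b_def)
        have "f p = f (b p)" using makar_limanov_invariant[OF f \<phi>(1) p(1)] \<phi>(2) by simp
        then show "f p - g p = 0" using p(1) bX by (simp add: F(2) g_def res_def)
      qed
      then have "f = g" by (simp add: fun_eq_iff)
      then show "f \<in> coord_algebra W X" using gW by simp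
    qed
    show "coord_algebra W X \<subseteq> makar_limanov I X"
    proof
      fix f assume f: "f \<in> coord_algebra W X"
      have WA: "g \<in> A" if "g \<in> coord_algebra W X" for g
        using that poly_functions_mono[OF _ subI(3)] by (auto simp: coord_algebra_eq)
      have "D f = (\<lambda>_. 0)" if "locally_nilpotent_derivation A D" for D
      proof -
        interpret derivation_on I X D
          by unfold_locales (use that in \<open>simp add: locally_nilpotent_derivation_def\<close>)
        show ?thesis using f
        proof (induction rule: coord_algebra_induct)
          case (coord v)
          then show ?case using crdW[OF coord] that by (simp add: makar_limanov_def)
        qed (auto simp: D_const D_add D_mult WA)
      qed
      then show "f \<in> makar_limanov I X" using WA[OF f] by (simp add: makar_limanov_def)
    qed
  qed
  have crdW_eq: "crd w p = p w" if "p \<in> X" for w p using that by (simp add: res_def)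
  have inv: "\<phi> p \<in> X \<and> (\<forall>w\<in>W. \<phi> p w = p w)" if \<phi>: "\<phi> \<in> carrier (saut_group I X)" and p: "p \<in> X" for \<phi> p
  proof -
    have X: "\<phi> p \<in> X" by (rule Bij_in[OF saut_group_Bij[OF \<phi>] p])
    then show ?thesis using makar_limanov_invariant[OF crdW \<phi> p] crdW_eq[OF X] crdW_eq[OF p] by simp
  qed
  define U where "U = {p \<in> X. mval e W p \<noteq> 0}"
  have "b (\<lambda>_. 1) \<in> U"
  proof -
    have "mval e W (b (\<lambda>_. 1)) = 1" by (simp add: mval_def b_def)
    then show ?thesis using bX by (simp add: U_def)
  qed
  then have "U \<noteq> {}" by blast
  moreover have "zariski_open I X U"
    unfolding zariski_open_def
  proof (intro exI[of _ "{res X (mval e W)}"] conjI)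
    show "{res X (mval e W)} \<subseteq> coord_algebra I X"
      using fin by (auto intro!: res_in_coord_algebra mval_poly_function)
    show "U = {p \<in> X. \<exists>f\<in>{res X (mval e W)}. f p \<noteq> 0}" by (auto simp: U_def res_def)
  qed
  moreover have "\<phi> ` U = U" if \<phi>: "\<phi> \<in> carrier (saut_group I X)" for \<phi>
  proof -
    have iff: "\<phi> p \<in> U \<longleftrightarrow> p \<in> U" if "p \<in> X" for p
    proof -
      have "mval e W (\<phi> p) = mval e W p" using inv[OF \<phi> that] by (intro mval_cong) auto
      then show ?thesis using inv[OF \<phi> that] that by (simp add: U_def)
    qed
    have "\<phi> ` X = X" using saut_group_Bij[OF \<phi>] by (auto simp: Bij_def bij_betw_def)
    show ?thesis
    proof (intro equalityI subsetI)
      fix q assume "q \<in> \<phi> ` U"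
      then obtain p where "p \<in> U" "q = \<phi> p" by blast
      then show "q \<in> U" using iff[of p] by (simp add: U_def)
    next
      fix q assume q: "q \<in> U"
      then have "q \<in> \<phi> ` X" using \<open>\<phi> ` X = X\<close> by (simp add: U_def)
      then obtain p where "p \<in> X" "q = \<phi> p" by blast
      then show "q \<in> \<phi> ` U" using iff[of p] q by simp
    qed
  qed
  moreover have "\<exists>f\<in>makar_limanov I X. f P \<noteq> f Q"
    if PQ: "P \<in> U" "Q \<in> U" "saut_orbit I X P \<noteq> saut_orbit I X Q" for P Q
  proof (rule ccontr)
    assume *: "\<not> (\<exists>f\<in>makar_limanov I X. f P \<noteq> f Q)"
    have X: "P \<in> X" "Q \<in> X" "mval e W P \<noteq> 0" "mval e W Q \<noteq> 0" using PQ by (auto simp: U_def)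
    have "P w = Q w" if "w \<in> W" for w
    proof -
      have "crd w P = crd w Q" using * crdW[OF that] by blast
      then show ?thesis using crdW_eq X by metis
    qed
    then obtain \<phi> \<psi> where "\<phi> \<in> carrier (saut_group I X)" "\<phi> P = Q" "\<psi> \<in> carrier (saut_group I X)" "\<psi> Q = P"
      using saut_transitive_on_fibre[OF X(1,3,2)] saut_transitive_on_fibre[OF X(2,4,1)] by metis
    then have "saut_orbit I X P = saut_orbit I X Q"
      using saut_orbit_subset X(1,2) by (metis subset_antisym)
    then show False using PQ(3) by simp
  qed
  ultimately have "generic_saut_orbits_separated_by_ML I X"
    unfolding generic_saut_orbits_separated_by_ML_def by (intro exI[of _ U]) blast
  then show ?thesis using ml by blast
qed

end

theorem proposition2:
  fixes n :: "nat \<Rightarrow> nat" and l :: "nat \<Rightarrow> nat \<Rightarrow> nat"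
    and X :: "(nat \<times> nat \<Rightarrow> 'a::{alg_closed_field, field_char_0}) set"
  assumes "n 1 \<ge> 1" and "n 2 \<ge> 2"
    and "\<And>i j. (i, j) \<in> var_index n \<Longrightarrow> (i, j) \<noteq> (2, 1) \<Longrightarrow> l i j \<ge> 2"
    and "\<And>a :: nat \<Rightarrow> nat. (\<And>k. k \<in> {1..n 0 - 1} \<Longrightarrow> a k > 0) \<Longrightarrow>
           l 0 ` {1..n 0} \<noteq> insert 2 ((\<lambda>k. 2 * a k) ` {1..n 0 - 1})"
    and "X = trinomial_variety n l"
  shows "makar_limanov (var_index n) X = coord_algebra ((\<lambda>j. (2, j)) ` {2..n 2}) X
    \<and> generic_saut_orbits_separated_by_ML (var_index n) X"
proof -
  define V where "V i A = (\<lambda>j. (i, j)) ` A" for i :: nat and A :: "nat set"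
  define e where "e = (\<lambda>(i, j). l i j)"
  have idx: "insert (2, 1) (V 0 {1..n 0} \<union> V 1 {1..n 1} \<union> V 2 {2..n 2}) = var_index n"
  proof -
    have "{0..2} = {0, 1, 2 :: nat}" by auto
    moreover have "{1..n 2} = insert 1 {2..n 2}" using assms(2) by auto
    ultimately show ?thesis by (auto simp: V_def var_index_def)
  qed
  have mv: "mval e (V i A) p = (\<Prod>j\<in>A. p (i, j) ^ l i j)" for i A and p :: "nat \<times> nat \<Rightarrow> 'a"
    unfolding mval_def V_def by (subst prod.reindex) (auto simp: inj_on_def e_def)
  have l2: "l i j \<ge> 2" if "(i, j) \<in> V 0 {1..n 0} \<union> V 1 {1..n 1} \<union> V 2 {2..n 2}" for i j
  proof (rule assms(3))
    show "(i, j) \<in> var_index n" using that unfolding idx[symmetric] by blast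
    show "(i, j) \<noteq> (2, 1)" using that by (auto simp: V_def)
  qed
  interpret trinomial_hypersurface "V 0 {1..n 0}" "V 1 {1..n 1}" "V 2 {2..n 2}" "(2, 1)" e X
  proof
    show "e v \<ge> 2" if "v \<in> V 0 {1..n 0} \<union> V 1 {1..n 1} \<union> V 2 {2..n 2}" for v
      using l2[of "fst v" "snd v"] that by (simp add: e_def case_prod_beta)
    show "X = {p \<in> insert (2, 1) (V 0 {1..n 0} \<union> V 1 {1..n 1} \<union> V 2 {2..n 2}) \<rightarrow>\<^sub>E UNIV.
      mval e (V 0 {1..n 0}) p + mval e (V 1 {1..n 1}) p + p (2, 1) * mval e (V 2 {2..n 2}) p = 0}"
      unfolding idx mv assms(5) trinomial_variety_def trinomial_def by simp
  qed (use assms(1) in \<open>auto simp: V_def\<close>)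
  have "\<not> ((\<forall>v\<in>V 0 {1..n 0}. even (e v)) \<and> (\<exists>v\<in>V 0 {1..n 0}. e v = 2))"
  proof
    assume *: "(\<forall>v\<in>V 0 {1..n 0}. even (e v)) \<and> (\<exists>v\<in>V 0 {1..n 0}. e v = 2)"
    then have ev: "even (l 0 j)" if "j \<in> {1..n 0}" for j using that by (auto simp: V_def e_def)
    obtain j0 where j0: "j0 \<in> {1..n 0}" "l 0 j0 = 2" using * by (auto simp: V_def e_def)
    \<comment> \<open>An enumeration of the indices other than j0 by 1, ..., n 0 - 1; the halves of
      the exponents at these indices serve as the numbers a_k of the hypothesis.\<close>
    define h where "h k = (if k < j0 then k else Suc k)" for k
    have h: "insert j0 (h ` {1..n 0 - 1}) = {1..n 0}"
    proof
      show "insert j0 (h ` {1..n 0 - 1}) \<subseteq> {1..n 0}" using j0(1) by (auto simp: h_def)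
      show "{1..n 0} \<subseteq> insert j0 (h ` {1..n 0 - 1})"
      proof
        fix j assume j: "j \<in> {1..n 0}"
        consider "j = j0" | "j < j0" | "j > j0" by linarith
        then show "j \<in> insert j0 (h ` {1..n 0 - 1})"
        proof cases
          case 2
          then have "j = h j" "j \<in> {1..n 0 - 1}" using j j0(1) by (auto simp: h_def)
          then show ?thesis by blast
        next
          case 3
          then have "j = h (j - 1)" "j - 1 \<in> {1..n 0 - 1}" using j j0(1) by (auto simp: h_def)
          then show ?thesis by blast
        qed simp
      qed
    qed
    define a where "a k = l 0 (h k) div 2" for k
    have hk: "h k \<in> {1..n 0}" if "k \<in> {1..n 0 - 1}" for k using h that by blast
    have a: "2 * a k = l 0 (h k)" if "k \<in> {1..n 0 - 1}" for k
      using ev[OF hk[OF that]] by (simp add: a_def)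
    have "a k > 0" if "k \<in> {1..n 0 - 1}" for k
      using l2[of 0 "h k"] hk[OF that] a[OF that] by (auto simp: V_def)
    then have "l 0 ` {1..n 0} \<noteq> insert 2 ((\<lambda>k. 2 * a k) ` {1..n 0 - 1})" by (rule assms(4))
    moreover have "(\<lambda>k. 2 * a k) ` {1..n 0 - 1} = l 0 ` h ` {1..n 0 - 1}"
      unfolding image_image using a by (intro image_cong) auto
    moreover have "l 0 ` {1..n 0} = insert 2 (l 0 ` h ` {1..n 0 - 1})"
      using j0(2) unfolding h[symmetric] by simp
    ultimately show False by simp
  qed
  from makar_limanov_and_orbits[OF this] show ?thesis unfolding idx by (simp add: V_def)
qed

end
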